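(* Let $X_1,X_2,\ldots$ be independent standard Gaussian random variables, let $f_1$ be a probability density on $\mathbb{R}$, let $\phi$ be the standard Gaussian density, and let $h(x)=f_1(x)/\phi(x)\ge0$. Suppose that the distribution of $h(X_1)$ is in the domain of attraction of the maximally skew Cauchy law. Let $\hat\theta_n$ be the maximum-likelihood estimator of $\theta\in[0,1]$ based on $X_1,\ldots,X_n$ in the mixture model with density $(1-\theta)\phi+\theta f_1$, and let $$\Lambda_n=2\sum_{i=1}^n\log\bigl(1+\hat\theta_n(h(X_i)-1)\bigr)$$ be the likelihood-ratio statistic for testing $\theta=0$. Let $G$ be the cumulative distribution function whose $u$th quantile is $$G^{-1}(u)=-2u-2\log(1-u)=2\sum_{r\ge2}\frac{u^r}{r},\qquad 0<u<1.$$ Then $$\lim_{n\to\infty}\mathbb{P}_0(\Lambda_n\le x\mid\Lambda_n>0)=G(x).$$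
   Context: $\mathbb{P}_0$ denotes probability when $X_1,\ldots,X_n$ are i.i.d. standard Gaussian (that is, $\theta=0$). $\hat\theta_n$ maximizes the concave function $\theta\mapsto\sum_{i=1}^n\log\{(1-\theta)\phi(X_i)+\theta f_1(X_i)\}$ over $[0,1]$. The maximally skew Cauchy law is the stable law with index $\alpha=1$ and skewness $\beta=1$, with log characteristic function $\log\psi(t)=-|t|-2it\log|t|/\pi$. A distribution is in its domain of attraction if, for i.i.d. $Y_1,Y_2,\ldots$ with that distribution, there exist deterministic $A_n\in\mathbb{R}$ and $B_n>0$ such that $B_n^{-1}\sum_{i=1}^nY_i-A_n$ converges in distribution to this law. *)

theory Defs
  imports "HOL-Probability.Probability"
begin

definition max_skew_cauchy :: "real measure \<Rightarrow> bool" where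
  "max_skew_cauchy \<nu> \<longleftrightarrow> real_distribution \<nu> \<and>
     (\<forall>t. char \<nu> t = exp (complex_of_real (- \<bar>t\<bar>)
                - 2 * \<i> * complex_of_real (t * ln \<bar>t\<bar>) / complex_of_real pi))"
  (* At t = 0 the logarithmic term vanishes, so the formula gives the required value 1. *)

text \<open>The i.i.d. sequence with marginal law \<open>\<mu>\<close> is realised as the coordinate process on the
  infinite product space; the law of the normalised sum depends on \<open>\<mu>\<close> only.\<close>

definition in_domain_of_attraction :: "real measure \<Rightarrow> real measure \<Rightarrow> bool" where
  "in_domain_of_attraction \<mu> \<nu> \<longleftrightarrow>
     (\<exists>(A :: nat \<Rightarrow> real) (B :: nat \<Rightarrow> real). (\<forall>n. B n > 0) \<and>
        weak_conv_m
          (\<lambda>n. distr (PiM (UNIV :: nat set) (\<lambda>_. \<mu>)) borel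
                 (\<lambda>Y. inverse (B n) * (\<Sum>i<n. Y i) - A n))
          \<nu>)"

definition prob_density :: "(real \<Rightarrow> real) \<Rightarrow> bool" where
  "prob_density f \<longleftrightarrow> f \<in> borel_measurable borel \<and> (\<forall>x. 0 \<le> f x) \<and>
     (\<integral>\<^sup>+ x. ennreal (f x) \<partial>lborel) = 1"

definition density_ratio :: "(real \<Rightarrow> real) \<Rightarrow> real \<Rightarrow> real" where
  "density_ratio f1 x = f1 x / std_normal_density x"

text \<open>The mixture density vanishes at an observation when \<open>\<theta> = 1\<close> and \<open>f1 x = 0\<close>. The
  log-likelihood is then minus infinity, whereas \<open>ln 0 = 0\<close> on the reals; hence the
  extended-real-valued logarithm.\<close>

definition ext_ln :: "real \<Rightarrow> ereal" where
  "ext_ln y = (if y > 0 then ereal (ln y) else - \<infinity>)"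

definition mixture_loglik :: "(real \<Rightarrow> real) \<Rightarrow> nat \<Rightarrow> (nat \<Rightarrow> real) \<Rightarrow> real \<Rightarrow> ereal" where
  "mixture_loglik f1 n xs \<theta> =
     (\<Sum>i<n. ext_ln ((1 - \<theta>) * std_normal_density (xs i) + \<theta> * f1 (xs i)))"

definition is_mixture_mle :: "(real \<Rightarrow> real) \<Rightarrow> nat \<Rightarrow> (nat \<Rightarrow> real) \<Rightarrow> real \<Rightarrow> bool" where
  "is_mixture_mle f1 n xs \<theta>hat \<longleftrightarrow>
     is_arg_max (mixture_loglik f1 n xs) (\<lambda>\<theta>. \<theta> \<in> {0..1}) \<theta>hat"

text \<open>The real logarithm is safe here: the log-likelihood at 0 is finite, so the arguments
  are positive whenever \<open>\<theta>\<close> is a maximum-likelihood estimate.\<close>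

definition lr_statistic :: "(real \<Rightarrow> real) \<Rightarrow> nat \<Rightarrow> (nat \<Rightarrow> real) \<Rightarrow> real \<Rightarrow> real" where
  "lr_statistic f1 n xs \<theta> = 2 * (\<Sum>i<n. ln (1 + \<theta> * (density_ratio f1 (xs i) - 1)))"

definition quantile :: "(real \<Rightarrow> real) \<Rightarrow> real \<Rightarrow> real" where
  "quantile G u = Inf {x. u \<le> G x}"

definition limit_quantile :: "real \<Rightarrow> real" where
  "limit_quantile u = - 2 * u - 2 * ln (1 - u)"

definition is_limit_cdf :: "(real \<Rightarrow> real) \<Rightarrow> bool" where
  "is_limit_cdf G \<longleftrightarrow> (\<exists>\<nu>. real_distribution \<nu> \<and> G = cdf \<nu>) \<and>
     (\<forall>u\<in>{0<..<1}. quantile G u = limit_quantile u)"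

lemma limit_quantile_strict_mono:
  assumes "0 < u" "u < v" "v < 1"
  shows "limit_quantile u < limit_quantile v"
proof -
  have "\<exists>y. (limit_quantile has_real_derivative y) (at x) \<and> 0 < y" if "u \<le> x" "x \<le> v" for x
  proof (intro exI conjI)
    show "(limit_quantile has_real_derivative (- 2 + 2 / (1 - x))) (at x)"
      unfolding limit_quantile_def[abs_def] using that assms
      by (auto intro!: derivative_eq_intros simp: field_simps)
    show "0 < - 2 + 2 / (1 - x)" using that assms by (simp add: field_simps)
  qed
  then show ?thesis using DERIV_pos_imp_increasing[OF assms(2), of limit_quantile] by blast
qed

lemma is_limit_cdf_unique:
  assumes "is_limit_cdf F" "is_limit_cdf G"
  shows "F = G"
proof
  fix x
  have *: "u \<le> H x \<longleftrightarrow> limit_quantile u \<le> x" if "is_limit_cdf H" "0 < u" "u < 1" for H u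
  proof -
    from that obtain \<nu> where \<nu>: "real_distribution \<nu>" "H = cdf \<nu>"
      by (auto simp: is_limit_cdf_def)
    then interpret cdf_distribution \<nu> by (simp add: cdf_distribution_def)
    show ?thesis using that pseudoinverse[of u x] \<nu>(2) by (simp add: is_limit_cdf_def quantile_def)
  qed
  have b: "0 \<le> H x \<and> H x \<le> 1" if "is_limit_cdf H" for H
    using that by (auto simp: is_limit_cdf_def cdf_def real_distribution_def
        intro!: prob_space.prob_le_1)
  have "H x \<le> K x" if "is_limit_cdf H" "is_limit_cdf K" for H K
  proof (rule ccontr)
    assume "\<not> H x \<le> K x"
    then obtain u where u: "K x < u" "u < H x" using dense[of "K x" "H x"] by auto
    then show False using b[OF that(1)] b[OF that(2)] *[OF that(1), of u] *[OF that(2), of u] by auto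
  qed
  then show "F x = G x" using assms by (intro antisym) auto
qed

lemma is_limit_cdf_exists: "\<exists>G. is_limit_cdf G"
proof -
  define U where "U = uniform_measure lborel {0<..<1::real}"
  define \<nu> where "\<nu> = distr U borel limit_quantile"
  interpret U: prob_space U unfolding U_def by (rule prob_space_uniform_measure) auto
  have meas: "limit_quantile \<in> borel_measurable U"
    unfolding limit_quantile_def[abs_def] U_def by simp
  interpret \<nu>: real_distribution \<nu>
    unfolding \<nu>_def real_distribution_def real_distribution_axioms_def
    using U.prob_space_distr[OF meas] by simp
  have cdf: "cdf \<nu> x = measure lborel ({0<..<1} \<inter> {w. limit_quantile w \<le> x})" for x
  proof -
    have "limit_quantile -` {..x} \<in> sets borel"
      using measurable_sets[OF meas, of "{..x}"] by (simp add: U_def)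
    then have "measure U (limit_quantile -` {..x}) =
        measure lborel ({0<..<1} \<inter> limit_quantile -` {..x})"
      unfolding U_def by (subst measure_uniform_measure) auto
    moreover have "cdf \<nu> x = measure U (limit_quantile -` {..x})"
      unfolding cdf_def \<nu>_def by (subst measure_distr[OF meas]) (auto simp: U_def)
    ultimately show ?thesis by (simp add: vimage_def)
  qed
  have meas2: "{w. limit_quantile w \<le> x} \<in> sets borel" for x
    using measurable_sets[OF meas, of "{..x}"] by (simp add: U_def vimage_def)
  have fm: "emeasure lborel ({0<..<1::real} \<inter> A) \<noteq> \<infinity>" for A
  proof -
    have "emeasure lborel ({0<..<1::real} \<inter> A) \<le> emeasure lborel {0<..<1::real}"
      by (intro emeasure_mono) auto
    then show ?thesis by (auto simp: top_unique)
  qed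
  have "quantile (cdf \<nu>) u = limit_quantile u" if u: "0 < u" "u < 1" for u
    unfolding quantile_def
  proof (rule cInf_eq_minimum)
    have "{0<..u} \<subseteq> {0<..<1} \<inter> {w. limit_quantile w \<le> limit_quantile u}"
    proof
      fix v assume v: "v \<in> {0<..u}"
      then show "v \<in> {0<..<1} \<inter> {w. limit_quantile w \<le> limit_quantile u}"
        using u limit_quantile_strict_mono[of v u] by (cases "v = u") auto
    qed
    then have "measure lborel {0<..u} \<le> cdf \<nu> (limit_quantile u)"
      unfolding cdf using fm meas2
      by (intro measure_mono_fmeasurable) (auto simp: fmeasurable_def less_top)
    then show "limit_quantile u \<in> {x. u \<le> cdf \<nu> x}" using u by simp
  next
    fix x assume "x \<in> {x. u \<le> cdf \<nu> x}"
    then have ux: "u \<le> cdf \<nu> x" by simp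
    show "limit_quantile u \<le> x"
    proof (rule ccontr)
      assume "\<not> limit_quantile u \<le> x"
      then have less: "x < limit_quantile u" by simp
      have "isCont limit_quantile u"
        unfolding limit_quantile_def[abs_def] using u by (auto intro!: continuous_intros)
      then have "(limit_quantile \<longlongrightarrow> limit_quantile u) (at_left u)"
        by (simp add: isCont_def filterlim_at_split)
      then have "eventually (\<lambda>w. x < limit_quantile w) (at_left u)"
        using less by (rule order_tendstoD(1))
      moreover have "eventually (\<lambda>w. w \<in> {0<..<u}) (at_left u)"
        using u by (intro eventually_at_left_real)
      ultimately have "eventually (\<lambda>w. x < limit_quantile w \<and> 0 < w \<and> w < u) (at_left u)"
        by eventually_elim auto
      then obtain w where w: "x < limit_quantile w" "0 < w" "w < u"
        using eventually_happens' trivial_limit_at_left_real by blast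
      have "{0<..<1} \<inter> {v. limit_quantile v \<le> x} \<subseteq> {0<..w}"
      proof
        fix v assume v: "v \<in> {0<..<1} \<inter> {v. limit_quantile v \<le> x}"
        then show "v \<in> {0<..w}"
          using w limit_quantile_strict_mono[of w v] by (cases "w < v") auto
      qed
      then have "cdf \<nu> x \<le> measure lborel {0<..w}"
        unfolding cdf using meas2 w
        by (intro measure_mono_fmeasurable) (auto simp: fmeasurable_def)
      then show False using ux w by simp
    qed
  qed
  then have "is_limit_cdf (cdf \<nu>)"
    unfolding is_limit_cdf_def using \<nu>.real_distribution_axioms by auto
  then show ?thesis by blast
qed

definition limit_cdf :: "real \<Rightarrow> real" where
  "limit_cdf = (THE G. is_limit_cdf G)"

lemma is_limit_cdf_limit_cdf: "is_limit_cdf limit_cdf"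
  unfolding limit_cdf_def
  by (rule theI'[where P = is_limit_cdf]) (use is_limit_cdf_exists is_limit_cdf_unique in blast)

end

theory Submission
  imports Defs
begin

text \<open>
  The likelihood ratio exceeds zero only through a single exceptionally large observation. Write
  \<open>h\<^sub>i = h (X\<^sub>i)\<close>: these are i.i.d., nonnegative and of mean one, with law \<open>\<mu>\<close>, tail
  \<open>T y = \<mu> {y<..}\<close> and expected excess \<open>\<ell> x = E (h - x)\<^sup>+\<close>.

  The domain of attraction enters only through \<open>T (x * y) / T y \<longlonglongrightarrow> 1 / x\<close> as \<open>y\<close> grows
  (\<open>tail_of_domain_of_attraction\<close>). For this it suffices to know the moduli of characteristic
  functions: symmetrising removes the centring constants, and the difference \<open>W\<close> of two independent
  copies satisfies \<open>n * E (1 - cos (t * W / B\<^sub>n)) \<longlonglongrightarrow> 2 * \<bar>t\<bar>\<close>. Up to a constant the right-hand side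
  is the integral of \<open>1 - cos (t * x)\<close> against \<open>1 / x\<^sup>2\<close>, so that the rescaled laws of \<open>W\<close>, multiplied
  by \<open>n\<close>, converge away from the origin to a measure proportional to \<open>1 / x\<^sup>2\<close>. Since \<open>h \<ge> 0\<close>, the
  tail of \<open>\<bar>W\<bar>\<close> is asymptotically \<open>2 * T\<close>.

  A tail of index minus one with finite mean makes \<open>\<ell>\<close> slowly varying, \<open>x * T x\<close> negligible against
  \<open>\<ell> x\<close>, and \<open>E (min h x)\<^sup>2 = O (x\<^sup>2 * T x)\<close>. Let \<open>b\<^sub>n\<close> solve \<open>n * \<ell> b\<^sub>n = b\<^sub>n\<close>, and let
  \<open>r\<^sub>n = n * T b\<^sub>n\<close>, which tends to zero. On the scale \<open>\<theta> = s / b\<^sub>n\<close> the observations below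
  \<open>\<epsilon> * b\<^sub>n\<close> together contribute about \<open>\<theta> * \<Sum> (h\<^sub>i - 1)\<close>, that is \<open>- s\<close>: the sum of the truncated
  terms has mean close to \<open>- n * \<ell> b\<^sub>n = - b\<^sub>n\<close>, and by Chebyshev's inequality it strays from there
  only with probability \<open>O (\<epsilon> * r\<^sub>n)\<close>. Two observations above \<open>\<epsilon> * b\<^sub>n\<close> have probability
  \<open>O (r\<^sub>n\<^sup>2)\<close>. A single observation \<open>y * b\<^sub>n\<close> adds \<open>ln (1 + s * y)\<close>, and the maximum of
  \<open>ln (1 + s * y) - s\<close> over \<open>s \<ge> 0\<close> is \<open>gain y = ln y - 1 + 1 / y\<close> if \<open>y \<ge> 1\<close> and zero otherwise.
  Some observation exceeds \<open>y * b\<^sub>n\<close> with probability asymptotic to \<open>r\<^sub>n / y\<close>. Therefore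
  \<open>\<Lambda>\<^sub>n > 2 * gain y\<close> has probability asymptotic to \<open>r\<^sub>n / y\<close> for every \<open>y \<ge> 1\<close>
  (\<open>prob_S_asymptotics\<close>), where \<open>y = 1\<close> is the event \<open>\<Lambda>\<^sub>n > 0\<close>. All errors are small compared
  with \<open>r\<^sub>n\<close>, which is what conditioning on an event of vanishing probability requires. Given
  \<open>\<Lambda>\<^sub>n > 0\<close> the limit is thus the law of \<open>2 * gain (1 / (1 - U))\<close> with \<open>U\<close> uniform, and
  \<open>2 * gain (1 / (1 - u)) = - 2 * u - 2 * ln (1 - u)\<close>.
\<close>

section \<open>Cosine integrals against a saturating weight\<close>

text \<open>This gives \<open>1 - cos (k * x) \<le> k\<^sup>2 * (1 - cos x)\<close> below, by which a bound on cosine integrals near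
  frequency zero spreads to all frequencies with quadratic growth.\<close>

lemma abs_sin_mult_le: "\<bar>sin (real k * z)\<bar> \<le> real k * \<bar>sin z\<bar>"
proof (induction k)
  case (Suc k)
  have "real (Suc k) * z = real k * z + z" by (simp add: algebra_simps)
  then have "\<bar>sin (real (Suc k) * z)\<bar> = \<bar>sin (real k * z) * cos z + cos (real k * z) * sin z\<bar>"
    by (simp only: sin_add)
  also have "\<dots> \<le> \<bar>sin (real k * z)\<bar> * \<bar>cos z\<bar> + \<bar>cos (real k * z)\<bar> * \<bar>sin z\<bar>"
    by (metis abs_mult abs_triangle_ineq)
  also have "\<dots> \<le> \<bar>sin (real k * z)\<bar> * 1 + 1 * \<bar>sin z\<bar>"
    by (intro add_mono mult_mono) auto
  also have "\<dots> \<le> real (Suc k) * \<bar>sin z\<bar>" using Suc by (simp add: algebra_simps)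
  finally show ?case .
qed simp

lemma one_minus_cos_eq: "1 - cos x = 2 * (sin (x / 2))\<^sup>2" for x :: real
  using cos_double_sin[of "x/2"] by simp

lemma one_minus_cos_mult_le: "1 - cos (real k * x) \<le> (real k)\<^sup>2 * (1 - cos x)"
proof -
  have "(sin (real k * (x / 2)))\<^sup>2 \<le> (real k * \<bar>sin (x/2)\<bar>)\<^sup>2"
    using power_mono[OF abs_sin_mult_le[of k "x/2"], of 2] by simp
  then show ?thesis by (simp add: one_minus_cos_eq power_mult_distrib)
qed

text \<open>The weight \<open>x\<^sup>2 / (1 + x\<^sup>2)\<close> turns a measure with a second-order singularity at the origin into a
  finite one and still sees all the mass away from the origin. It is chosen because it is the average
  of \<open>1 - cos (s * x)\<close> over a standard exponential frequency \<open>s\<close>.\<close>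

definition sat :: "real \<Rightarrow> real" where "sat x = x\<^sup>2 / (1 + x\<^sup>2)"

lemma sat_bounds: "0 \<le> sat x" "sat x \<le> 1"
  by (simp_all add: sat_def add_pos_nonneg pos_divide_le_eq)

lemma sat_measurable [measurable]: "sat \<in> borel_measurable borel"
  unfolding sat_def[abs_def] by measurable

lemma one_minus_cos_le_sat: "1 - cos (t * x) \<le> (2 + t\<^sup>2) * sat x"
proof -
  have "\<bar>sin (t * x / 2)\<bar> \<le> \<bar>t * x / 2\<bar>" by (rule abs_sin_x_le_abs_x)
  then have "(sin (t * x / 2))\<^sup>2 \<le> (t * x / 2)\<^sup>2" using abs_le_square_iff by blast
  then have "1 - cos (t * x) \<le> 2 * (t * x / 2)\<^sup>2" unfolding one_minus_cos_eq by simp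
  also have "\<dots> \<le> t\<^sup>2 * x\<^sup>2" by (simp add: power_mult_distrib power_divide)
  finally have "1 - cos (t * x) \<le> t\<^sup>2 * x\<^sup>2" .
  moreover have "(1 - cos (t * x)) * x\<^sup>2 \<le> 2 * x\<^sup>2"
    using cos_ge_minus_one[of "t * x"] by (intro mult_right_mono) auto
  ultimately have "(1 - cos (t * x)) * (1 + x\<^sup>2) \<le> (2 + t\<^sup>2) * x\<^sup>2"
    by (simp add: algebra_simps)
  moreover have "0 < 1 + x\<^sup>2" by (simp add: add_pos_nonneg)
  ultimately show ?thesis by (simp add: sat_def pos_le_divide_eq)
qed

abbreviation "exp_law \<equiv> density lborel (\<lambda>s. ennreal (exponential_density 1 s))"

lemma prob_space_exp_law: "prob_space exp_law"
  by (rule prob_space_exponential_density) simp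

lemma exp_law_cos: "(\<integral>s. 1 - cos (s * x) \<partial>exp_law) = sat x"
proof -
  let ?f = "\<lambda>s. exp (- s) * (1 - cos (s * x))"
  define c where "c = 1 / (1 + x\<^sup>2)"
  let ?F = "\<lambda>s. - exp (- s) + c * (exp (- s) * (cos (s * x) - x * sin (s * x)))"
  have p: "0 < 1 + x\<^sup>2" by (simp add: add_pos_nonneg)
  then have c: "c + c * x\<^sup>2 = 1" by (simp add: c_def field_simps)
  have "(\<integral>\<^sup>+ s. ennreal (?f s) * indicator {0..} s \<partial>lborel) = ennreal (0 - ?F 0)"
  proof (rule nn_integral_FTC_atLeast)
    fix s :: real
    show "DERIV ?F s :> ?f s"
    proof -
      have "DERIV ?F s :> exp (- s) - (c + c * x\<^sup>2) * (exp (- s) * cos (s * x))"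
        by (auto intro!: derivative_eq_intros simp: algebra_simps power2_eq_square)
      then show ?thesis by (simp add: c algebra_simps)
    qed
    show "0 \<le> ?f s" by simp
  next
    have "((\<lambda>s::real. exp (- s)) \<longlongrightarrow> 0) at_top"
      by (rule filterlim_compose[OF exp_at_bot filterlim_uminus_at_bot_at_top])
    moreover have "((\<lambda>s. exp (- s) * (cos (s * x) - x * sin (s * x))) \<longlongrightarrow> 0) at_top"
    proof (rule Lim_null_comparison)
      show "\<forall>\<^sub>F s in at_top. norm (exp (- s) * (cos (s * x) - x * sin (s * x))) \<le> exp (- s) * (1 + \<bar>x\<bar>)"
      proof (rule always_eventually, rule allI)
        fix s
        have "\<bar>cos (s * x) - x * sin (s * x)\<bar> \<le> \<bar>cos (s*x)\<bar> + \<bar>x\<bar> * \<bar>sin (s*x)\<bar>"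
          by (metis abs_mult abs_triangle_ineq4)
        also have "\<dots> \<le> 1 + \<bar>x\<bar> * 1" by (intro add_mono mult_left_mono) auto
        finally show "norm (exp (- s) * (cos (s * x) - x * sin (s * x))) \<le> exp (- s) * (1 + \<bar>x\<bar>)"
          by (simp add: abs_mult)
      qed
      show "((\<lambda>s. exp (- s) * (1 + \<bar>x\<bar>)) \<longlongrightarrow> 0) at_top"
        using tendsto_mult_right[OF calculation, of "1 + \<bar>x\<bar>"] by (simp add: mult.commute)
    qed
    ultimately show "(?F \<longlongrightarrow> 0) at_top"
      using tendsto_add[OF tendsto_minus[of _ 0] tendsto_mult_left[of _ 0 _ c]] by fastforce
  qed measurable
  moreover have "- ?F 0 = sat x" using c p by (simp add: sat_def c_def field_simps)
  ultimately have nn: "(\<integral>\<^sup>+ s. ennreal (?f s) * indicator {0..} s \<partial>lborel) = ennreal (sat x)"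
    by simp
  have "(\<integral>s. 1 - cos (s * x) \<partial>exp_law) = enn2real (\<integral>\<^sup>+ s. ennreal (1 - cos (s * x)) \<partial>exp_law)"
    by (rule integral_eq_nn_integral) auto
  also have "(\<integral>\<^sup>+ s. ennreal (1 - cos (s * x)) \<partial>exp_law)
      = (\<integral>\<^sup>+ s. ennreal (?f s) * indicator {0..} s \<partial>lborel)"
    by (subst nn_integral_density)
       (auto intro!: nn_integral_cong simp: exponential_density_def ennreal_mult'[symmetric] split: split_indicator)
  finally show ?thesis using nn sat_bounds(1)[of x] by simp
qed

text \<open>Supplies the dominating function when cosine integrals of quadratic growth are averaged.\<close>

lemma exp_law_square_integrable: "integrable exp_law (\<lambda>s. (a + \<bar>s\<bar>)\<^sup>2)"
proof -
  interpret prob_space exp_law by (rule prob_space_exp_law)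
  have "distributed exp_law lborel (\<lambda>s. s) (exponential_density 1)"
    by (auto simp: distributed_def distr_id2)
  then have i: "integrable exp_law (\<lambda>s. s ^ k)" for k
    by (rule erlang_ith_moment_integrable[rotated]) simp
  have "integrable exp_law (\<lambda>s. a\<^sup>2 + 2 * a * s + s ^ 2)"
    using i[of 0] i[of 1] i[of 2] by auto
  moreover have "AE s in exp_law. a\<^sup>2 + 2 * a * s + s ^ 2 = (a + \<bar>s\<bar>)\<^sup>2"
    by (subst AE_density) (auto simp: exponential_density_def power2_eq_square algebra_simps)
  ultimately show ?thesis by (subst integrable_cong_AE[symmetric]) auto
qed


text \<open>The Fourier transform of the weighted measure depends on the measure only through its cosine
  integrals \<open>U\<close>. Convergence of cosine integrals therefore carries over to characteristic functions
  of the weighted measures. The integrand is rewritten by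
  \<open>2 * cos (t * x) * cos (s * x) = cos ((t + s) * x) + cos ((t - s) * x)\<close>.\<close>

lemma cos_sat_integral:
  fixes m :: "real measure"
  assumes "sigma_finite_measure m" and [measurable_cong]: "sets m = sets borel" and int: "integrable m sat"
  defines "U \<equiv> \<lambda>t. \<integral>x. 1 - cos (t * x) \<partial>m"
  shows "(\<integral>x. cos (t * x) * sat x \<partial>m) = (\<integral>s. (U (t + s) + U (t - s)) / 2 - U t \<partial>exp_law)"
proof -
  interpret m: sigma_finite_measure m by fact
  interpret E: prob_space exp_law by (rule prob_space_exp_law)
  interpret mE: pair_sigma_finite m exp_law by unfold_locales
  have int1: "integrable m (\<lambda>x. 1 - cos (u * x))" for u
  proof (rule Bochner_Integration.integrable_bound)
    show "integrable m (\<lambda>x. (2 + u\<^sup>2) * sat x)" using int by simp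
    show "AE x in m. norm (1 - cos (u * x)) \<le> norm ((2 + u\<^sup>2) * sat x)"
      using one_minus_cos_le_sat[of u] sat_bounds(1) by (auto intro!: AE_I2 simp: abs_mult)
  qed measurable
  have intE: "integrable exp_law (\<lambda>s. 1 - cos (s * x))" for x
  proof (rule E.integrable_const_bound[of _ 2])
    have "norm (1 - cos y) \<le> 2" for y :: real using cos_ge_minus_one[of y] by simp
    then show "AE s in exp_law. norm (1 - cos (s * x)) \<le> 2" by blast
  qed measurable
  have intE2: "integrable exp_law (\<lambda>s. cos (t * x) * (1 - cos (s * x)))" for x
    using intE by (rule integrable_mult_right)
  have prod: "integrable (m \<Otimes>\<^sub>M exp_law) (case_prod (\<lambda>x s. cos (t * x) * (1 - cos (s * x))))"
  proof (rule mE.Fubini_integrable)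
    show "(\<lambda>(x, s). cos (t * x) * (1 - cos (s * x))) \<in> borel_measurable (m \<Otimes>\<^sub>M exp_law)"
      by measurable
    have eq: "(\<integral>s. norm (case (x, s) of (x, s) \<Rightarrow> cos (t * x) * (1 - cos (s * x))) \<partial>exp_law)
        = \<bar>cos (t * x)\<bar> * sat x" for x
      unfolding exp_law_cos[symmetric] by (simp add: abs_mult)
    show "integrable m (\<lambda>x. \<integral>s. norm (case (x, s) of (x, s) \<Rightarrow> cos (t * x) * (1 - cos (s * x))) \<partial>exp_law)"
      unfolding eq
      by (rule Bochner_Integration.integrable_bound[OF int])
         (auto intro!: AE_I2 simp: abs_mult sat_bounds intro: mult_left_le_one_le)
    show "AE x in m. integrable exp_law (\<lambda>s. case (x, s) of (x, s) \<Rightarrow> cos (t * x) * (1 - cos (s * x)))"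
      using intE2 by simp
  qed
  have "(\<integral>x. cos (t * x) * sat x \<partial>m) = (\<integral>x. (\<integral>s. cos (t * x) * (1 - cos (s * x)) \<partial>exp_law) \<partial>m)"
    unfolding exp_law_cos[symmetric] by simp
  also have "\<dots> = (\<integral>s. (\<integral>x. cos (t * x) * (1 - cos (s * x)) \<partial>m) \<partial>exp_law)"
    by (rule mE.Fubini_integral[symmetric, OF prod])
  also have "(\<lambda>s. \<integral>x. cos (t * x) * (1 - cos (s * x)) \<partial>m) = (\<lambda>s. (U (t + s) + U (t - s)) / 2 - U t)"
  proof
    fix s
    have "cos (t * x) * (1 - cos (s * x))
       = ((1 - cos ((t + s) * x)) + (1 - cos ((t - s) * x))) / 2 - (1 - cos (t * x))" for x
      by (simp add: ring_distribs cos_add cos_diff) (simp add: field_simps)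
    moreover have "(\<integral>x. (f x + g x) / 2 - h x \<partial>m) = ((\<integral>x. f x \<partial>m) + (\<integral>x. g x \<partial>m)) / 2 - (\<integral>x. h x \<partial>m)"
      if "integrable m f" "integrable m g" "integrable m h" for f g h :: "real \<Rightarrow> real"
      using that by simp
    ultimately show "(\<integral>x. cos (t * x) * (1 - cos (s * x)) \<partial>m) = (U (t + s) + U (t - s)) / 2 - U t"
      using int1 by (simp only: U_def)
  qed
  finally show ?thesis .
qed

text \<open>Up to a constant, the Levy measure of the symmetric Cauchy law.\<close>

abbreviation "inv_square \<equiv> density lborel (\<lambda>x. ennreal (1 / x\<^sup>2 :: real))"

lemma inv_square_nn_integral:
  assumes "a > 0" shows "(\<integral>\<^sup>+x. ennreal (1 / x\<^sup>2) * indicator {a..} x \<partial>lborel) = ennreal (1 / a)"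
proof -
  have "(\<integral>\<^sup>+x. ennreal (1 / x\<^sup>2) * indicator {a..} x \<partial>lborel) = ennreal (0 - (- (1 / a)))"
  proof (rule nn_integral_FTC_atLeast)
    fix x assume "a \<le> x"
    then show "((\<lambda>x. - (1 / x)) has_real_derivative 1 / x\<^sup>2) (at x)"
      using assms by (auto intro!: derivative_eq_intros simp: power2_eq_square)
  next
    show "((\<lambda>x. - (1 / x)) \<longlongrightarrow> 0) (at_top :: real filter)"
      using tendsto_minus[OF tendsto_inverse_0_at_top[OF filterlim_ident]]
      by (simp add: inverse_eq_divide)
  qed auto
  then show ?thesis by simp
qed

lemma inv_square_tail:
  assumes "a > 0" shows "emeasure inv_square {x. a < \<bar>x\<bar>} = ennreal (2 / a)"
proof -
  have h: "(\<integral>\<^sup>+x. ennreal (1 / x\<^sup>2) * indicator {..-a} x \<partial>lborel) = ennreal (1 / a)"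
  proof -
    let ?f = "\<lambda>x. ennreal (1 / x\<^sup>2) * indicator {a..} x"
    have "integral\<^sup>N lborel ?f = (\<integral>\<^sup>+x. ?f (0 + - 1 * x) \<partial>lborel)"
      by (subst nn_integral_real_affine[where c="-1" and t=0]) auto
    also have "(\<lambda>x. ?f (0 + - 1 * x)) = (\<lambda>x. ennreal (1 / x\<^sup>2) * indicator {..-a} x)"
      by (rule ext) (simp add: indicator_def le_minus_iff)
    finally show ?thesis using inv_square_nn_integral[OF assms] by simp
  qed
  have "emeasure inv_square {x. a < \<bar>x\<bar>} = (\<integral>\<^sup>+x. ennreal (1 / x\<^sup>2) * indicator {x. a < \<bar>x\<bar>} x \<partial>lborel)"
    by (subst emeasure_density) auto
  also have "\<dots> = (\<integral>\<^sup>+x. ennreal (1 / x\<^sup>2) * indicator {a..} x + ennreal (1 / x\<^sup>2) * indicator {..-a} x \<partial>lborel)"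
  proof (rule nn_integral_cong_AE)
    have "AE x in lborel. x \<noteq> a \<and> x \<noteq> - a" by (auto simp: AE_lborel_singleton)
    then show "AE x in lborel. ennreal (1 / x\<^sup>2) * indicator {x. a < \<bar>x\<bar>} x
      = ennreal (1 / x\<^sup>2) * indicator {a..} x + ennreal (1 / x\<^sup>2) * indicator {..-a} x"
      by eventually_elim (use assms in \<open>auto split: split_indicator\<close>)
  qed
  also have "\<dots> = ennreal (1/a) + ennreal (1/a)"
    using h inv_square_nn_integral[OF assms] by (subst nn_integral_add) auto
  finally show ?thesis using assms by (simp flip: ennreal_plus)
qed

lemma inv_square_sat: "integrable inv_square sat"
proof -
  have fin: "(\<integral>\<^sup>+x. ennreal (1 / (1 + x\<^sup>2)) \<partial>lborel) < \<infinity>"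
  proof -
    have "(\<integral>\<^sup>+x. ennreal (1 / (1 + x\<^sup>2)) \<partial>lborel)
      \<le> (\<integral>\<^sup>+x. indicator {-1..1::real} x + ennreal (1 / x\<^sup>2) * indicator {x. 1 < \<bar>x\<bar>} x \<partial>lborel)"
    proof (rule nn_integral_mono)
      fix x :: real
      have "0 < 1 + x\<^sup>2" by (simp add: add_pos_nonneg)
      then have "1 / (1 + x\<^sup>2) \<le> 1" "\<bar>x\<bar> > 1 \<Longrightarrow> 1 / (1 + x\<^sup>2) \<le> 1 / x\<^sup>2"
        by (auto intro!: divide_left_mono mult_pos_pos)
      then show "ennreal (1 / (1 + x\<^sup>2)) \<le> indicator {-1..1} x + ennreal (1 / x\<^sup>2) * indicator {x. 1 < \<bar>x\<bar>} x"
        by (cases "\<bar>x\<bar> > 1") (auto simp: indicator_def intro!: ennreal_leI ennreal_le_1[THEN iffD2])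
    qed
    also have "\<dots> = emeasure lborel {-1..1::real} + emeasure inv_square {x. 1 < \<bar>x\<bar>}"
      by (subst nn_integral_add) (auto simp: emeasure_density)
    also have "\<dots> < \<infinity>" by (simp add: inv_square_tail)
    finally show ?thesis .
  qed
  have "integrable lborel (\<lambda>x. 1 / (1 + x\<^sup>2) :: real)"
    by (rule integrableI_bounded) (use fin in \<open>auto simp: add_nonneg_nonneg\<close>)
  moreover have "AE x in lborel. 1 / (1 + x\<^sup>2) = (1 / x\<^sup>2) *\<^sub>R sat x"
    using AE_lborel_singleton[of 0] by eventually_elim (auto simp: sat_def)
  ultimately have "integrable lborel (\<lambda>x. (1 / x\<^sup>2) *\<^sub>R sat x)"
    by (subst integrable_cong_AE[symmetric]) auto
  then show ?thesis by (subst integrable_density) auto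
qed

text \<open>Substitute \<open>t * x\<close> for \<open>x\<close>. The positive constant on the right is removed by rescaling the
  measure.\<close>

lemma inv_square_cos: "(\<integral>x. 1 - cos (t * x) \<partial>inv_square) = \<bar>t\<bar> * (\<integral>x. 1 - cos x \<partial>inv_square)"
proof (cases "t = 0")
  case False
  have "(\<integral>x. 1 - cos x \<partial>inv_square) = (\<integral>x. 1 / x\<^sup>2 * (1 - cos x) \<partial>lborel)"
    by (subst integral_density) auto
  also have "\<dots> = \<bar>t\<bar> * (\<integral>x. 1 / (t * x)\<^sup>2 * (1 - cos (t * x)) \<partial>lborel)"
    using lborel_integral_real_affine[OF False, of "\<lambda>x. 1 / x\<^sup>2 * (1 - cos x)" 0] by simp
  also have "\<dots> = \<bar>t\<bar> * (1 / t\<^sup>2 * (\<integral>x. 1 / x\<^sup>2 * (1 - cos (t * x)) \<partial>lborel))"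
    by (simp add: power_mult_distrib flip: integral_mult_right_zero)
  also have "(\<integral>x. 1 / x\<^sup>2 * (1 - cos (t * x)) \<partial>lborel) = (\<integral>x. 1 - cos (t * x) \<partial>inv_square)"
    by (subst integral_density) auto
  finally have "(\<integral>x. 1 - cos x \<partial>inv_square) = \<bar>t\<bar> * (1 / t\<^sup>2 * (\<integral>x. 1 - cos (t * x) \<partial>inv_square))" .
  moreover have "\<bar>t\<bar> * (\<bar>t\<bar> * (1 / t\<^sup>2)) = 1"
    using False by (simp add: abs_if power2_eq_square)
  moreover have "i = a * c" if "c = a * (q * i)" "a * (a * q) = 1" for a c q i :: real
    using that by algebra
  ultimately show ?thesis by blast
qed simp

lemma inv_square_cos_pos: "0 < (\<integral>x. 1 - cos x \<partial>inv_square)"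
proof -
  have int: "integrable inv_square (\<lambda>x. 1 - cos x)"
    by (rule Bochner_Integration.integrable_bound[of _ "\<lambda>x. (2 + 1\<^sup>2) * sat x"])
       (use inv_square_sat one_minus_cos_le_sat[of 1] sat_bounds(1) in \<open>auto intro!: AE_I2 simp: abs_mult\<close>)
  have "(\<integral>x. 1 - cos x \<partial>inv_square) \<noteq> 0"
  proof
    assume "(\<integral>x. 1 - cos x \<partial>inv_square) = 0"
    then have "AE x in inv_square. 1 - cos x = 0"
      using integral_nonneg_eq_0_iff_AE[OF int] by auto
    then have "AE x in lborel. 0 < ennreal (1 / x\<^sup>2) \<longrightarrow> cos x = 1"
      by (subst (asm) AE_density) auto
    \<comment> \<open>The cosine is below one on \<open>{1..2}\<close>, an interval of positive length.\<close>
    then have "AE x in lborel. \<not> x \<in> {1..2::real}"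
    proof eventually_elim
      case (elim x)
      show ?case
      proof
        assume x: "x \<in> {1..2}"
        then have "cos x < cos 0" using pi_ge_two by (intro cos_monotone_0_pi) auto
        with elim x show False by (auto simp: ennreal_zero_less_divide)
      qed
    qed
    then have "emeasure lborel {1..2::real} = 0"
      by (subst (asm) AE_iff_measurable[where N="{1..2}"]) auto
    then show False by simp
  qed
  moreover have "0 \<le> (\<integral>x. 1 - cos x \<partial>inv_square)" by (rule Bochner_Integration.integral_nonneg) simp
  ultimately show ?thesis by linarith
qed

lemma (in real_distribution) char_Complex:
  "char M t = Complex (\<integral>x. cos (t * x) \<partial>M) (\<integral>x. sin (t * x) \<partial>M)"
proof (rule complex_eqI)
  have i: "integrable M (\<lambda>x. iexp (t * x))" by (rule integrable_iexp) auto
  show "Re (char M t) = Re (Complex (\<integral>x. cos (t * x) \<partial>M) (\<integral>x. sin (t * x) \<partial>M))"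
    unfolding char_def by (subst integral_Re[OF i, symmetric]) (simp add: Re_exp)
  show "Im (char M t) = Im (Complex (\<integral>x. cos (t * x) \<partial>M) (\<integral>x. sin (t * x) \<partial>M))"
    unfolding char_def by (subst integral_Im[OF i, symmetric]) (simp add: Im_exp)
qed

text \<open>Weighting by \<open>sat\<close> and normalising yields probability measures, to which Levy's continuity theorem
  applies.\<close>

definition sat_tilt :: "real measure \<Rightarrow> real measure" where
  "sat_tilt m = density m (\<lambda>x. ennreal (sat x / (\<integral>y. sat y \<partial>m)))"

lemma sat_tilt:
  assumes [measurable_cong]: "sets m = sets borel" and int: "integrable m sat" and pos: "0 < (\<integral>x. sat x \<partial>m)"
  shows real_distribution_sat_tilt: "real_distribution (sat_tilt m)"
    and integral_sat_tilt: "\<And>f :: real \<Rightarrow> real. f \<in> borel_measurable borel \<Longrightarrow>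
      (\<integral>x. f x \<partial>sat_tilt m) = (\<integral>x. f x * sat x \<partial>m) / (\<integral>x. sat x \<partial>m)"
proof -
  show "real_distribution (sat_tilt m)"
  proof (intro real_distribution.intro real_distribution_axioms.intro prob_spaceI)
    have "emeasure (sat_tilt m) (space (sat_tilt m)) = (\<integral>\<^sup>+x. ennreal (sat x / (\<integral>y. sat y \<partial>m)) \<partial>m)"
      unfolding sat_tilt_def by (subst emeasure_density) (auto intro!: nn_integral_cong)
    also have "\<dots> = ennreal (\<integral>x. sat x / (\<integral>y. sat y \<partial>m) \<partial>m)"
      using int pos sat_bounds(1) by (intro nn_integral_eq_integral) auto
    also have "\<dots> = 1" using pos by simp
    finally show "emeasure (sat_tilt m) (space (sat_tilt m)) = 1" .
  qed (auto simp: sat_tilt_def assms(1) sets_eq_imp_space_eq[OF assms(1)])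
  show "(\<integral>x. f x \<partial>sat_tilt m) = (\<integral>x. f x * sat x \<partial>m) / (\<integral>x. sat x \<partial>m)"
    if [measurable]: "f \<in> borel_measurable borel" for f :: "real \<Rightarrow> real"
    unfolding sat_tilt_def using pos sat_bounds(1)
    by (subst integral_density) (auto simp: mult.commute)
qed

text \<open>The integrand is odd. Together with the corresponding hypothesis on the approximating laws this makes
  all characteristic functions in the next lemma real.\<close>

lemma inv_square_odd: "(\<integral>x. sin (t * x) * sat x \<partial>inv_square) = 0"
proof -
  let ?f = "\<lambda>x. 1 / x\<^sup>2 * (sin (t * x) * sat x)"
  have "(\<integral>x. sin (t * x) * sat x \<partial>inv_square) = (\<integral>x. ?f x \<partial>lborel)"
    by (subst integral_density) auto
  moreover have "(\<integral>x. ?f x \<partial>lborel) = - (\<integral>x. ?f x \<partial>lborel)"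
    by (subst lborel_integral_real_affine[where c="-1" and t=0]) (auto simp: sat_def)
  ultimately show ?thesis by linarith
qed

text \<open>If the cosine integrals of the measures \<open>n * L n\<close> converge to those of a multiple of
  \<open>1 / x\<^sup>2\<close>, then so do their tails. The measures are infinite in the limit, so they are weighted by
  \<open>sat\<close>: by \<open>cos_sat_integral\<close> and dominated convergence the weighted and normalised measures have
  convergent characteristic functions, hence converge weakly, and integrating the bounded function
  \<open>1 / sat\<close>, cut off near the origin, undoes the weight. The tail of \<open>1 / x\<^sup>2\<close> beyond \<open>a\<close> is
  \<open>2 / a\<close>.\<close>

lemma tail_limit_of_cos_limit:
  fixes L :: "nat \<Rightarrow> real measure"
  assumes L: "\<And>n. real_distribution (L n)"
    and odd: "\<And>n t. (\<integral>x. sin (t * x) * sat x \<partial>L n) = 0"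
    and lim: "\<And>t. (\<lambda>n. real n * (\<integral>x. 1 - cos (t * x) \<partial>L n)) \<longlonglongrightarrow> 2 * \<bar>t\<bar>"
    and bound: "\<And>n t. n \<ge> n0 \<Longrightarrow> real n * (\<integral>x. 1 - cos (t * x) \<partial>L n) \<le> C * (1 + \<bar>t\<bar>)\<^sup>2"
  obtains c where "c > 0"
    "\<And>a. a > 0 \<Longrightarrow> (\<lambda>n. real n * measure (L n) {x. a < \<bar>x\<bar>}) \<longlonglongrightarrow> c / a"
proof -
  interpret L: real_distribution "L n" for n by (rule L)
  interpret E: prob_space exp_law by (rule prob_space_exp_law)
  define c0 where "c0 = (\<integral>x. 1 - cos x \<partial>inv_square)"
  have c0: "c0 > 0" unfolding c0_def by (rule inv_square_cos_pos)
  \<comment> \<open>With this factor the cosine integral of the limit measure is exactly \<open>2 * \<bar>t\<bar>\<close>.\<close>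
  define k where "k = 2 / c0"
  have k: "k > 0" "k * c0 = 2" using c0 by (auto simp: k_def)
  define U where "U n t = (\<integral>x. 1 - cos (t * x) \<partial>L n)" for n t
  have [measurable]: "U n \<in> borel_measurable borel" for n unfolding U_def by measurable
  have U0: "0 \<le> U n t" for n t unfolding U_def by (rule Bochner_Integration.integral_nonneg) simp
  define \<Phi> where "\<Phi> t = (\<integral>s. \<bar>t + s\<bar> + \<bar>t - s\<bar> - 2 * \<bar>t\<bar> \<partial>exp_law)" for t
  have satL: "integrable (L n) sat" for n
    using sat_bounds by (intro L.integrable_const_bound[of _ 1]) auto
  have C: "0 \<le> C"
  proof -
    have "0 \<le> real n0 * U n0 0" using U0 by simp
    also have "\<dots> \<le> C * (1 + \<bar>0\<bar>)\<^sup>2" using bound[of n0 0] by (simp add: U_def)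
    finally show ?thesis by simp
  qed
  have limcos: "(\<lambda>n. real n * (\<integral>x. cos (t * x) * sat x \<partial>L n)) \<longlonglongrightarrow> \<Phi> t" for t
  proof (rule LIMSEQ_offset[of _ n0])
    have "(\<lambda>n. \<integral>s. (real (n + n0) * U (n + n0) (t + s) + real (n + n0) * U (n + n0) (t - s)) / 2
        - real (n + n0) * U (n + n0) t \<partial>exp_law) \<longlonglongrightarrow> \<Phi> t"
      unfolding \<Phi>_def
    proof (rule integral_dominated_convergence)
      show "integrable exp_law (\<lambda>s. 2 * C * (1 + \<bar>t\<bar> + \<bar>s\<bar>)\<^sup>2)"
        using exp_law_square_integrable[of "1 + \<bar>t\<bar>"] by simp
      have l: "(\<lambda>n. real (n + n0) * U (n + n0) u) \<longlonglongrightarrow> 2 * \<bar>u\<bar>" for u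
        using lim[of u] unfolding U_def by (rule LIMSEQ_ignore_initial_segment)
      have "(\<lambda>n. (real (n + n0) * U (n + n0) (t + s) + real (n + n0) * U (n + n0) (t - s)) / 2
        - real (n + n0) * U (n + n0) t) \<longlonglongrightarrow> (2 * \<bar>t + s\<bar> + 2 * \<bar>t - s\<bar>) / 2 - 2 * \<bar>t\<bar>" for s
        by (intro tendsto_intros l) auto
      moreover have "(2 * \<bar>t + s\<bar> + 2 * \<bar>t - s\<bar>) / 2 - 2 * \<bar>t\<bar> = \<bar>t + s\<bar> + \<bar>t - s\<bar> - 2 * \<bar>t\<bar>" for s by simp
      ultimately show "AE s in exp_law. (\<lambda>n. (real (n + n0) * U (n + n0) (t + s) + real (n + n0) * U (n + n0) (t - s)) / 2
        - real (n + n0) * U (n + n0) t) \<longlonglongrightarrow> \<bar>t + s\<bar> + \<bar>t - s\<bar> - 2 * \<bar>t\<bar>" by simp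
      fix n
      have b: "0 \<le> real (n + n0) * U (n + n0) u \<and> real (n + n0) * U (n + n0) u \<le> C * (1 + \<bar>t\<bar> + \<bar>s\<bar>)\<^sup>2"
        if "\<bar>u\<bar> \<le> \<bar>t\<bar> + \<bar>s\<bar>" for u s
      proof
        show "0 \<le> real (n + n0) * U (n + n0) u" using U0 by simp
        have "real (n + n0) * U (n + n0) u \<le> C * (1 + \<bar>u\<bar>)\<^sup>2"
          unfolding U_def by (rule bound) simp
        also have "\<dots> \<le> C * (1 + \<bar>t\<bar> + \<bar>s\<bar>)\<^sup>2"
          using that C by (intro mult_left_mono power_mono) auto
        finally show "real (n + n0) * U (n + n0) u \<le> C * (1 + \<bar>t\<bar> + \<bar>s\<bar>)\<^sup>2" .
      qed
      have "norm ((real (n + n0) * U (n + n0) (t + s) + real (n + n0) * U (n + n0) (t - s)) / 2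
        - real (n + n0) * U (n + n0) t) \<le> 2 * C * (1 + \<bar>t\<bar> + \<bar>s\<bar>)\<^sup>2" for s
      proof -
        have aux: "norm ((p + q) / 2 - r) \<le> 2 * d"
          if "0 \<le> p \<and> p \<le> d" "0 \<le> q \<and> q \<le> d" "0 \<le> r \<and> r \<le> d" for p q r d :: real
          using that by (auto simp: abs_le_iff field_simps)
        show ?thesis unfolding mult.assoc[of 2] by (intro aux b) auto
      qed
      then show "AE s in exp_law. norm ((real (n + n0) * U (n + n0) (t + s) + real (n + n0) * U (n + n0) (t - s)) / 2
        - real (n + n0) * U (n + n0) t) \<le> 2 * C * (1 + \<bar>t\<bar> + \<bar>s\<bar>)\<^sup>2" by blast
    qed measurable
    moreover have "(\<integral>s. (real n * U n (t + s) + real n * U n (t - s)) / 2 - real n * U n t \<partial>exp_law)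
        = real n * (\<integral>x. cos (t * x) * sat x \<partial>L n)" for n
    proof -
      have "real n * (\<integral>x. cos (t * x) * sat x \<partial>L n)
         = real n * (\<integral>s. (U n (t + s) + U n (t - s)) / 2 - U n t \<partial>exp_law)"
        unfolding U_def using satL
        by (subst cos_sat_integral) (auto intro: L.sigma_finite_measure_axioms)
      also have "\<dots> = (\<integral>s. real n * ((U n (t + s) + U n (t - s)) / 2 - U n t) \<partial>exp_law)" by simp
      finally show ?thesis by (simp add: algebra_simps add_divide_distrib)
    qed
    ultimately show "(\<lambda>n. real (n + n0) * (\<integral>x. cos (t * x) * sat x \<partial>L (n + n0))) \<longlonglongrightarrow> \<Phi> t"
      by (simp only:)
  qed
  have inv_sf: "sigma_finite_measure inv_square"
    by (subst sigma_finite_measure.sigma_finite_iff_density_finite[OF sigma_finite_lborel]) auto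
  have limit: "k * (\<integral>x. cos (t * x) * sat x \<partial>inv_square) = \<Phi> t" for t
  proof -
    have "k * (\<integral>x. cos (t * x) * sat x \<partial>inv_square)
        = k * (\<integral>s. (\<bar>t + s\<bar> * c0 + \<bar>t - s\<bar> * c0) / 2 - \<bar>t\<bar> * c0 \<partial>exp_law)"
      by (subst cos_sat_integral[OF inv_sf _ inv_square_sat]) (simp_all add: inv_square_cos c0_def)
    also have "\<dots> = (\<integral>s. k * ((\<bar>t + s\<bar> * c0 + \<bar>t - s\<bar> * c0) / 2 - \<bar>t\<bar> * c0) \<partial>exp_law)" by simp
    also have "(\<lambda>s. k * ((\<bar>t + s\<bar> * c0 + \<bar>t - s\<bar> * c0) / 2 - \<bar>t\<bar> * c0)) = (\<lambda>s. (k * c0) * ((\<bar>t + s\<bar> + \<bar>t - s\<bar>) / 2 - \<bar>t\<bar>))"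
      by (simp add: algebra_simps add_divide_distrib)
    also have "\<dots> = (\<lambda>s. \<bar>t + s\<bar> + \<bar>t - s\<bar> - 2 * \<bar>t\<bar>)" unfolding k(2) by (rule ext) (simp add: field_simps)
    finally show ?thesis by (simp add: \<Phi>_def)
  qed
  define D where "D n = (\<integral>x. sat x \<partial>L n)" for n
  define d where "d = (\<integral>x. sat x \<partial>inv_square)"
  have d: "d > 0"
  proof -
    have "c0 \<le> (\<integral>x. 3 * sat x \<partial>inv_square)"
      unfolding c0_def
      using one_minus_cos_le_sat[of 1] inv_square_sat
      by (intro integral_mono_AE Bochner_Integration.integrable_bound[of inv_square "\<lambda>x. 3 * sat x" "\<lambda>x. 1 - cos x"])
        (auto simp: sat_bounds)
    then show ?thesis using c0 by (simp add: d_def)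
  qed
  have limD: "(\<lambda>n. real n * D n) \<longlonglongrightarrow> k * d"
    using limcos[of 0] limit[of 0] by (simp add: D_def d_def)
  have evD: "\<forall>\<^sub>F n in sequentially. D n > 0"
    using order_tendstoD(1)[OF limD, of 0] d k(1)
    by (auto elim!: eventually_mono simp: zero_less_mult_iff)
  define K where "K = sat_tilt inv_square"
  \<comment> \<open>The value for \<open>D n = 0\<close> is a dummy that keeps every member a probability law; it occurs for finitely many \<open>n\<close> only.\<close>
  define Kn where "Kn n = (if D n > 0 then sat_tilt (L n) else K)" for n
  interpret K: real_distribution K
    unfolding K_def using d inv_square_sat by (intro real_distribution_sat_tilt) (auto simp: d_def)
  have Kn: "real_distribution (Kn n)" for n
    unfolding Kn_def using real_distribution_sat_tilt[OF _ satL, of n] K.real_distribution_axioms by (auto simp: D_def)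
  have intK: "(\<integral>x. f x \<partial>K) = (\<integral>x. f x * sat x \<partial>inv_square) / d"
    if "f \<in> borel_measurable borel" for f :: "real \<Rightarrow> real"
    unfolding K_def d_def using that d inv_square_sat by (intro integral_sat_tilt) (auto simp: d_def)
  have intKn: "(\<integral>x. f x \<partial>Kn n) = (\<integral>x. f x * sat x \<partial>L n) / D n"
    if "f \<in> borel_measurable borel" "D n > 0" for f :: "real \<Rightarrow> real" and n
    using integral_sat_tilt[OF _ satL, of n f] that by (auto simp: Kn_def D_def)
  have weak: "weak_conv_m Kn K"
  proof (rule levy_continuity[OF Kn K.real_distribution_axioms])
    fix t
    have "(\<lambda>n. Complex ((real n * (\<integral>x. cos (t * x) * sat x \<partial>L n)) / (real n * D n)) 0) \<longlonglongrightarrow> Complex (\<Phi> t / (k * d)) 0"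
      using k d by (intro tendsto_Complex tendsto_divide limcos limD) auto
    also have "Complex (\<Phi> t / (k * d)) 0 = char K t"
      unfolding K.char_Complex using k d by (simp add: intK inv_square_odd flip: limit)
    finally show "(\<lambda>n. char (Kn n) t) \<longlonglongrightarrow> char K t"
    proof (rule Lim_transform_eventually)
      show "\<forall>\<^sub>F n in sequentially. Complex ((real n * (\<integral>x. cos (t * x) * sat x \<partial>L n)) / (real n * D n)) 0 = char (Kn n) t"
        using evD eventually_gt_at_top[of 0]
        by eventually_elim (simp add: real_distribution.char_Complex[OF Kn] intKn odd)
    qed
  qed
  show ?thesis
  proof (rule that)
    show "2 * k > 0" using k by simp
    fix a :: real assume a: "a > 0"
    let ?f = "\<lambda>x. indicator {x. a < \<bar>x\<bar>} x * (1 / sat x)"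
    have fsat: "?f x * sat x = indicator {x. a < \<bar>x\<bar>} x" for x
      using a by (auto simp: indicator_def sat_def add_nonneg_eq_0_iff)
    have "(\<lambda>n. \<integral>x. ?f x \<partial>Kn n) \<longlonglongrightarrow> (\<integral>x. ?f x \<partial>K)"
    proof (rule weak_conv_imp_bdd_ae_continuous_conv[OF Kn K.real_distribution_axioms weak])
      have cont: "isCont ?f x" if "x \<noteq> a" "x \<noteq> - a" for x
      proof (cases "a < \<bar>x\<bar>")
        case True
        have "isCont (\<lambda>x. 1 / sat x) x"
          unfolding sat_def[abs_def] using a True
          by (intro continuous_intros) (auto simp: add_nonneg_eq_0_iff)
        moreover have "open {x::real. a < \<bar>x\<bar>}" by (intro open_Collect_less continuous_intros)
        then have "\<forall>\<^sub>F y in nhds x. a < \<bar>y\<bar>" using True by (auto simp: eventually_nhds)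
        then have "\<forall>\<^sub>F y in nhds x. ?f y = 1 / sat y" by eventually_elim simp
        ultimately show ?thesis using isCont_cong[of ?f "\<lambda>x. 1 / sat x" x] by blast
      next
        case False
        then have "\<bar>x\<bar> < a" using that by auto
        moreover have "open {x::real. \<bar>x\<bar> < a}" by (intro open_Collect_less continuous_intros)
        ultimately have "\<forall>\<^sub>F y in nhds x. \<bar>y\<bar> < a" by (auto simp: eventually_nhds)
        then have "\<forall>\<^sub>F y in nhds x. ?f y = 0" by eventually_elim simp
        then show ?thesis using isCont_cong[of ?f "\<lambda>x. 0" x] by simp
      qed
      have "emeasure K {x. \<not> isCont ?f x} \<le> emeasure K {a, -a}"
        using cont by (intro emeasure_mono) auto
      also have "\<dots> = 0"
      proof -
        have null: "{a, -a} \<in> null_sets (density m g)"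
          if "{a, -a} \<in> null_sets m" "g \<in> borel_measurable m" for m and g :: "real \<Rightarrow> ennreal"
        proof -
          have "AE x in m. x \<in> {a, -a} \<longrightarrow> g x = 0"
            using AE_not_in[OF that(1)] by (rule eventually_mono) blast
          then show ?thesis using that null_sets_density_iff[of g m "{a, -a}"] by blast
        qed
        have "{a, -a} \<in> null_sets lborel" by (intro finite_imp_null_set_lborel) simp
        then have "{a, -a} \<in> null_sets inv_square"
          by (rule null) auto
        then have "{a, -a} \<in> null_sets K"
          unfolding K_def sat_tilt_def by (rule null) auto
        then show ?thesis by auto
      qed
      finally show "emeasure K {x. \<not> isCont ?f x} = 0" by simp
      fix x :: real
      show "norm (?f x) \<le> 1 + 1 / a\<^sup>2"
      proof (cases "a < \<bar>x\<bar>")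
        case True
        then have "a\<^sup>2 \<le> x\<^sup>2" using a abs_le_square_iff[of a x] by simp
        then have "1 / x\<^sup>2 \<le> 1 / a\<^sup>2"
          using a True by (intro divide_left_mono mult_pos_pos) auto
        moreover have "1 / sat x = 1 + 1 / x\<^sup>2" using True a by (auto simp: sat_def field_simps)
        moreover have "0 \<le> 1 / sat x" using sat_bounds(1)[of x] by simp
        ultimately show ?thesis using True by simp
      qed simp
    qed measurable
    moreover have "(\<integral>x. ?f x \<partial>K) = (2 / a) / d"
    proof -
      have "(\<integral>x. ?f x \<partial>K) = (\<integral>x. indicator {x. a < \<bar>x\<bar>} x \<partial>inv_square) / d"
        by (subst intK) (simp_all only: fsat, measurable)
      also have "(\<integral>x. indicator {x. a < \<bar>x\<bar>} x \<partial>inv_square) = measure inv_square {x. a < \<bar>x\<bar>}" by simp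
      also have "\<dots> = 2 / a" using inv_square_tail[OF a] a by (simp add: measure_def)
      finally show ?thesis .
    qed
    ultimately have "(\<lambda>n. (real n * D n) * (\<integral>x. ?f x \<partial>Kn n)) \<longlonglongrightarrow> (k * d) * ((2 / a) / d)"
      using tendsto_mult[OF limD] by (simp only:)
    also have "(k * d) * ((2 / a) / d) = 2 * k / a" using d by simp
    finally show "(\<lambda>n. real n * measure (L n) {x. a < \<bar>x\<bar>}) \<longlonglongrightarrow> 2 * k / a"
    proof (rule Lim_transform_eventually)
      show "\<forall>\<^sub>F n in sequentially. (real n * D n) * (\<integral>x. ?f x \<partial>Kn n) = real n * measure (L n) {x. a < \<bar>x\<bar>}"
        using evD
      proof eventually_elim
        case (elim n)
        have "(\<integral>x. ?f x \<partial>Kn n) = (\<integral>x. indicator {x. a < \<bar>x\<bar>} x \<partial>L n) / D n"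
          by (subst intKn[OF _ elim]) (simp_all only: fsat, measurable)
        then show ?case using elim by simp
      qed
    qed
  qed
qed

section \<open>Characteristic functions of normalised sums\<close>

lemma indep_vars_PiM_coordinates:
  fixes \<mu> :: "real measure"
  assumes "real_distribution \<mu>"
  shows "prob_space.indep_vars (PiM (UNIV :: nat set) (\<lambda>_. \<mu>)) (\<lambda>_. borel) (\<lambda>i Y. Y i) UNIV"
proof -
  interpret \<mu>: real_distribution \<mu> by fact
  interpret P: prob_space "PiM (UNIV :: nat set) (\<lambda>_. \<mu>)"
    by (intro prob_space_PiM \<mu>.prob_space_axioms)
  have "distr (PiM UNIV (\<lambda>_. \<mu>)) borel (\<lambda>Y. Y i) = \<mu>" for i :: nat
    using distr_PiM_component[of UNIV "\<lambda>_. \<mu>" i] \<mu>.prob_space_axioms by (simp cong: distr_cong)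
  moreover have "distr (PiM UNIV (\<lambda>_. \<mu>)) (PiM UNIV (\<lambda>_. borel)) (\<lambda>Y. Y) = PiM (UNIV :: nat set) (\<lambda>_. \<mu>)"
    by (rule distr_id2) (rule sets_PiM_cong, auto)
  ultimately show ?thesis
    by (subst P.indep_vars_iff_distr_eq_PiM') (auto simp: restrict_UNIV)
qed

text \<open>Taking logarithms in \<open>x\<^sub>n\<^sup>n \<longlonglongrightarrow> exp (- c)\<close> forces \<open>x\<^sub>n \<longlonglongrightarrow> 1\<close>, and \<open>- ln x\<close> agrees with
  \<open>1 - x\<close> to first order there.\<close>

lemma exp_power_limit:
  fixes x :: "nat \<Rightarrow> real"
  assumes x: "\<And>n. 0 \<le> x n" "\<And>n. x n \<le> 1" and lim: "(\<lambda>n. x n ^ n) \<longlonglongrightarrow> exp (- c)"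
  shows "(\<lambda>n. real n * (1 - x n)) \<longlonglongrightarrow> c"
proof -
  define y where "y n = - ln (x n)" for n
  have ev: "\<forall>\<^sub>F n in sequentially. 0 < n \<and> 0 < x n"
    using order_tendstoD(1)[OF lim, of 0] eventually_gt_at_top[of 0]
  proof (simp, elim eventually_elim2)
    fix n :: nat assume "0 < x n ^ n" "0 < n"
    then show "0 < n \<and> 0 < x n" using x(1)[of n] by (cases "x n = 0") (auto simp: power_0_left)
  qed
  have "(\<lambda>n. - ln (x n ^ n)) \<longlonglongrightarrow> - ln (exp (- c))" by (intro tendsto_intros lim) auto
  then have "(\<lambda>n. - ln (x n ^ n)) \<longlonglongrightarrow> c" by simp
  then have ny: "(\<lambda>n. real n * y n) \<longlonglongrightarrow> c"
    by (rule Lim_transform_eventually) (use ev in \<open>auto elim!: eventually_mono simp: y_def ln_realpow\<close>)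
  have "(\<lambda>n. (real n * y n) * inverse (real n)) \<longlonglongrightarrow> c * 0"
    by (intro tendsto_mult ny lim_inverse_n)
  then have "(\<lambda>n. (real n * y n) * inverse (real n)) \<longlonglongrightarrow> 0" by simp
  then have y0: "y \<longlonglongrightarrow> 0"
    by (rule Lim_transform_eventually) (use ev in \<open>auto elim!: eventually_mono\<close>)
  have "(\<lambda>n. real n * y n - (real n * y n) * y n) \<longlonglongrightarrow> c - c * 0"
    by (intro tendsto_diff tendsto_mult ny y0)
  then have low: "(\<lambda>n. real n * y n - (real n * y n) * y n) \<longlonglongrightarrow> c" by simp
  show ?thesis
  proof (rule tendsto_sandwich[OF _ _ low])
    show "(\<lambda>n. real n * y n) \<longlonglongrightarrow> c" by (rule ny)
    show "\<forall>\<^sub>F n in sequentially. real n * (1 - x n) \<le> real n * y n"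
      using ev
    proof eventually_elim
      case (elim n)
      then have "1 - x n \<le> y n" using ln_le_minus_one[of "x n"] by (simp add: y_def)
      then show ?case by (intro mult_left_mono) auto
    qed
    show "\<forall>\<^sub>F n in sequentially. real n * y n - real n * y n * y n \<le> real n * (1 - x n)"
      using ev
    proof eventually_elim
      case (elim n)
      have yn: "0 \<le> y n" using elim x(2)[of n] by (simp add: y_def)
      have "1 + y n \<le> exp (y n)" by (rule exp_ge_add_one_self)
      then have "(1 + y n) * x n \<le> 1" using elim by (simp add: y_def exp_minus field_simps)
      then have "(1 - y n) * ((1 + y n) * x n) \<le> 1 - y n \<or> y n > 1"
        using mult_left_mono[of "(1 + y n) * x n" 1 "1 - y n"] by (cases "y n > 1") auto
      then have "y n - y n * y n \<le> 1 - x n"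
      proof
        assume *: "(1 - y n) * ((1 + y n) * x n) \<le> 1 - y n"
        have "x n = (1 - y n) * ((1 + y n) * x n) + (y n * y n) * x n" by (simp add: algebra_simps)
        also have "\<dots> \<le> (1 - y n) + (y n * y n) * 1"
          using * x(2)[of n] by (intro add_mono mult_left_mono) auto
        finally show ?thesis by simp
      next
        assume "y n > 1"
        then have "1 * y n \<le> y n * y n" by (intro mult_right_mono) auto
        then show ?thesis using x(2)[of n] by simp
      qed
      from mult_left_mono[OF this, of "real n"] show ?case by (simp add: algebra_simps)
    qed
  qed
qed

lemma char_distr_affine:
  assumes "real_distribution N"
  shows "char (distr N borel (\<lambda>x. c * x - a)) t = exp (- \<i> * t * a) * char N (c * t)"
proof -
  interpret N: real_distribution N by fact
  have "char (distr N borel (\<lambda>x. c * x - a)) t = (CLINT x|N. iexp (t * (c * x - a)))"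
    by (simp add: char_def integral_distr)
  also have "(\<lambda>x. iexp (t * (c * x - a))) = (\<lambda>x. exp (- \<i> * t * a) * iexp (c * t * x))"
    by (rule ext) (simp add: exp_add[symmetric] algebra_simps)
  finally show ?thesis by (simp add: char_def)
qed

text \<open>The distance of a characteristic function from one is at most \<open>E (min 2 (\<tau> * \<bar>x\<bar>))\<close> for
  \<open>\<bar>t\<bar> \<le> \<tau>\<close>. This is the integral of a bounded continuous function, so it converges along the sequence,
  and its limit is small for small \<open>\<tau>\<close>. Uniformity in \<open>t\<close> is what pointwise convergence of
  characteristic functions would not give.\<close>

lemma weak_conv_char_near_zero:
  fixes N :: "nat \<Rightarrow> real measure"
  assumes N: "\<And>n. real_distribution (N n)" and \<nu>: "real_distribution \<nu>" and weak: "weak_conv_m N \<nu>"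
  obtains \<tau> n0 where "\<tau> > 0" "\<And>n t. n \<ge> n0 \<Longrightarrow> \<bar>t\<bar> \<le> \<tau> \<Longrightarrow> norm (char (N n) t) \<ge> 1 / 2"
proof -
  interpret N: real_distribution "N n" for n by (rule N)
  interpret \<nu>: real_distribution \<nu> by fact
  have "(\<lambda>m. \<integral>x. min 2 (inverse (real (Suc m)) * \<bar>x\<bar>) \<partial>\<nu>) \<longlonglongrightarrow> (\<integral>x. 0 \<partial>\<nu>)"
  proof (rule integral_dominated_convergence)
    show "integrable \<nu> (\<lambda>x. 2 :: real)" by simp
    show "AE x in \<nu>. (\<lambda>m. min 2 (inverse (real (Suc m)) * \<bar>x\<bar>)) \<longlonglongrightarrow> 0"
    proof (rule AE_I2)
      fix x :: real
      have "(\<lambda>m. min 2 (inverse (real (Suc m)) * \<bar>x\<bar>)) \<longlonglongrightarrow> min 2 (0 * \<bar>x\<bar>)"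
        by (intro tendsto_intros LIMSEQ_inverse_real_of_nat)
      then show "(\<lambda>m. min 2 (inverse (real (Suc m)) * \<bar>x\<bar>)) \<longlonglongrightarrow> 0" by simp
    qed
  qed (auto simp: min_def)
  then have "\<forall>\<^sub>F m in sequentially. (\<integral>x. min 2 (inverse (real (Suc m)) * \<bar>x\<bar>) \<partial>\<nu>) < 1 / 2"
    by (intro order_tendstoD(2)) auto
  then obtain m where m: "(\<integral>x. min 2 (inverse (real (Suc m)) * \<bar>x\<bar>) \<partial>\<nu>) < 1 / 2"
    by (auto simp: eventually_sequentially)
  define \<tau> where "\<tau> = inverse (real (Suc m))"
  have "(\<lambda>n. \<integral>x. min 2 (\<tau> * \<bar>x\<bar>) \<partial>N n) \<longlonglongrightarrow> (\<integral>x. min 2 (\<tau> * \<bar>x\<bar>) \<partial>\<nu>)"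
    by (rule weak_conv_imp_integral_bdd_continuous_conv[OF N \<nu> weak, where B=2])
       (auto simp: \<tau>_def intro!: continuous_intros)
  then have "\<forall>\<^sub>F n in sequentially. (\<integral>x. min 2 (\<tau> * \<bar>x\<bar>) \<partial>N n) < 1 / 2"
    using m unfolding \<tau>_def by (rule order_tendstoD(2))
  then obtain n0 where n0: "\<And>n. n \<ge> n0 \<Longrightarrow> (\<integral>x. min 2 (\<tau> * \<bar>x\<bar>) \<partial>N n) < 1 / 2"
    by (auto simp: eventually_sequentially)
  show ?thesis
  proof (rule that)
    show "\<tau> > 0" by (simp add: \<tau>_def)
    fix n t assume n: "n \<ge> n0" and t: "\<bar>t\<bar> \<le> \<tau>"
    have i: "integrable (N n) (\<lambda>x. iexp (t * x))" by (rule N.integrable_iexp) auto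
    have "norm (char (N n) t - 1) = norm (CLINT x|N n. iexp (t * x) - 1)"
      unfolding char_def using i N.prob_space by simp
    also have "\<dots> \<le> (\<integral>x. min 2 (\<tau> * \<bar>x\<bar>) \<partial>N n)"
    proof (rule Bochner_Integration.integral_norm_bound_integral)
      show "integrable (N n) (\<lambda>x. min 2 (\<tau> * \<bar>x\<bar>))"
        by (rule N.integrable_const_bound[of _ 2]) (auto simp: \<tau>_def)
      fix x
      have "norm (iexp (t * x) - 1) \<le> norm (iexp (t * x)) + norm (1 :: complex)" by (rule norm_triangle_ineq4)
      then have "norm (iexp (t * x) - 1) \<le> 2" by simp
      moreover have "norm (iexp (t * x) - 1) \<le> \<bar>t\<bar> * \<bar>x\<bar>"
        using iexp_approx1[of "t * x" 0] by (simp add: abs_mult)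
      moreover have "\<bar>t\<bar> * \<bar>x\<bar> \<le> \<tau> * \<bar>x\<bar>" using t by (intro mult_right_mono) auto
      ultimately show "norm (iexp (t * x) - 1) \<le> min 2 (\<tau> * \<bar>x\<bar>)" by simp
    qed (use i in auto)
    also have "\<dots> < 1 / 2" using n by (rule n0)
    finally have "norm (1 - char (N n) t) < 1 / 2" by (simp add: norm_minus_commute)
    then show "norm (char (N n) t) \<ge> 1 / 2"
      using norm_triangle_ineq2[of 1 "1 - char (N n) t"] by simp
  qed
qed

lemma norm_char_max_skew_cauchy:
  assumes "max_skew_cauchy \<nu>" shows "norm (char \<nu> t) = exp (- \<bar>t\<bar>)"
  using assms by (simp add: max_skew_cauchy_def norm_exp_eq_Re)

section \<open>Regular variation of the tail\<close>

text \<open>If \<open>R\<close> vanished somewhere, positivity of \<open>R (a * B n)\<close> for a large \<open>a\<close> would keep \<open>B n\<close> below a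
  level at which \<open>R\<close> is positive, so \<open>R (B n)\<close> would be bounded below and \<open>n * R (B n)\<close> would
  diverge.\<close>

lemma positive_of_scaled_limit:
  fixes R :: "real \<Rightarrow> real"
  assumes mono: "antimono R" and nonneg: "\<And>y. 0 \<le> R y" and B: "\<And>n :: nat. B n > 0" and c: "c > 0"
    and lim: "\<And>a. a > 0 \<Longrightarrow> (\<lambda>n. real n * R (a * B n)) \<longlonglongrightarrow> c / a"
  shows "R y > 0"
proof (rule ccontr)
  assume "\<not> R y > 0"
  then have Ry: "R y = 0" using nonneg[of y] by simp
  have pos: "\<forall>\<^sub>F n in sequentially. R (a * B n) > 0" if "a > 0" for a
    using order_tendstoD(1)[OF lim[OF that], of 0] that c
    by (auto elim!: eventually_mono simp: zero_less_mult_iff)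
  then obtain n1 where n1: "R (B n1) > 0" using pos[of 1] by (auto simp: eventually_sequentially)
  have lt: "z < y" if "R z > 0" for z
    using antimonoD[OF mono, of y z] that Ry by (cases "z < y") auto
  then have y: "B n1 < y" "0 < y" using n1 B[of n1] by (auto intro: less_trans)
  have "\<forall>\<^sub>F n in sequentially. R (y / B n1 * B n) > 0" using y B by (intro pos) auto
  then have "\<forall>\<^sub>F n in sequentially. B n < B n1"
  proof eventually_elim
    case (elim n)
    have "y / B n1 * B n < y" by (rule lt[OF elim])
    then show ?case using y B[of n1] by (simp add: field_simps)
  qed
  then have ev: "\<forall>\<^sub>F n in sequentially. real n * R (B n1) \<le> real n * R (1 * B n)"
    by eventually_elim (auto intro!: mult_left_mono antimonoD[OF mono])
  have "filterlim (\<lambda>n. R (B n1) * real n) at_top sequentially"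
    by (rule filterlim_tendsto_pos_mult_at_top[OF tendsto_const n1 filterlim_real_sequentially])
  then have "filterlim (\<lambda>n. real n * R (1 * B n)) at_top sequentially"
    by (rule filterlim_at_top_mono) (use ev in \<open>simp add: mult.commute\<close>)
  then show False
    using lim[of 1] not_tendsto_and_filterlim_at_infinity[OF trivial_limit_sequentially lim[of 1]]
      filterlim_at_top_imp_at_infinity by auto
qed

text \<open>The passage from the discrete scale \<open>B n\<close> to a continuous argument goes through the values of \<open>R\<close>:
  to a level \<open>y\<close> belongs the index \<open>N y\<close>, the integer part of \<open>1 / R y\<close>, and monotonicity of \<open>R\<close>
  shows that \<open>y / B (N y)\<close> tends to \<open>c\<close>.\<close>

lemma tail_regularly_varying:
  fixes R :: "real \<Rightarrow> real"
  assumes mono: "antimono R" and nonneg: "\<And>y. 0 \<le> R y" and R0: "(R \<longlongrightarrow> 0) at_top"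
    and B: "\<And>n :: nat. B n > 0" and c: "c > 0"
    and lim: "\<And>a. a > 0 \<Longrightarrow> (\<lambda>n. real n * R (a * B n)) \<longlonglongrightarrow> c / a"
    and x: "x > 0"
  shows "((\<lambda>y. R (x * y) / R y) \<longlongrightarrow> 1 / x) at_top"
proof -
  have pos: "R y > 0" for y by (rule positive_of_scaled_limit[OF mono nonneg B c lim])
  define N where "N y = nat \<lfloor>1 / R y\<rfloor>" for y
  have N: "real (N y) * R y \<le> 1" "1 - R y \<le> real (N y) * R y" for y
  proof -
    have f: "0 \<le> \<lfloor>1 / R y\<rfloor>" using pos[of y] by simp
    then have "real (N y) = of_int \<lfloor>1 / R y\<rfloor>" by (simp add: N_def)
    then have "real (N y) \<le> 1 / R y" "1 / R y - 1 \<le> real (N y)"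
      using floor_correct[of "1 / R y"] by linarith+
    then show "real (N y) * R y \<le> 1" "1 - R y \<le> real (N y) * R y"
      using pos[of y] by (auto simp: field_simps)
  qed
  have NR: "((\<lambda>y. real (N y) * R y) \<longlongrightarrow> 1) at_top"
  proof (rule tendsto_sandwich)
    show "((\<lambda>y. 1 - R y) \<longlongrightarrow> 1) at_top" using tendsto_diff[OF tendsto_const R0, of 1] by simp
    show "((\<lambda>y. 1) \<longlongrightarrow> (1::real)) at_top" by simp
  qed (use N in auto)
  have "filterlim (\<lambda>y. 1 / R y) at_top at_top"
    using filterlim_inverse_at_top[OF R0] pos by (simp add: inverse_eq_divide)
  then have "filterlim (\<lambda>y. nat \<lfloor>1 / R y\<rfloor>) sequentially at_top"
    by (intro filterlim_compose[OF filterlim_nat_sequentially] filterlim_compose[OF filterlim_floor_sequentially])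
  then have Ntop: "filterlim N sequentially at_top" unfolding N_def[abs_def] .
  have limN: "((\<lambda>y. real (N y) * R (a * B (N y))) \<longlongrightarrow> c / a) at_top" if "a > 0" for a
    using filterlim_compose[OF lim[OF that] Ntop] .
  have lower: "\<forall>\<^sub>F y in at_top. a * B (N y) < y" if a: "0 < a" "a < c" for a
  proof -
    have "1 < c / a" using a by simp
    from order_tendstoD(1)[OF limN[OF a(1)] this] show ?thesis
    proof eventually_elim
      case (elim y)
      then have "real (N y) * R y < real (N y) * R (a * B (N y))" using N(1)[of y] by linarith
      then have "R y < R (a * B (N y))" by (simp add: mult_less_cancel_left)
      then show "a * B (N y) < y" using antimonoD[OF mono, of y "a * B (N y)"] by (meson not_le)
    qed
  qed
  have upper: "\<forall>\<^sub>F y in at_top. y < a * B (N y)" if a: "c < a" for a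
  proof -
    have a0: "a > 0" using a c by simp
    have "((\<lambda>y. real (N y) * R (a * B (N y)) - real (N y) * R y) \<longlongrightarrow> c / a - 1) at_top"
      by (intro tendsto_diff limN NR a0)
    moreover have "c / a - 1 < 0" using a a0 by simp
    ultimately have "\<forall>\<^sub>F y in at_top. real (N y) * R (a * B (N y)) - real (N y) * R y < 0"
      by (rule order_tendstoD(2))
    then show ?thesis
    proof eventually_elim
      case (elim y)
      then have "R (a * B (N y)) < R y" by (simp add: mult_less_cancel_left)
      then show "y < a * B (N y)" using antimonoD[OF mono, of "a * B (N y)" y] by (meson not_le)
    qed
  qed
  have "((\<lambda>y. real (N y) * R (x * y)) \<longlongrightarrow> 1 / x) at_top"
  proof (rule order_tendstoI)
    fix l assume l: "l < 1 / x"
    \<comment> \<open>Any \<open>a > c\<close> with \<open>l < c / (x * a)\<close> serves; if \<open>l > 0\<close> this is an interval, of which the midpoint is taken.\<close>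
    define a where "a = (if l \<le> 0 then c + 1 else (c + c / (l * x)) / 2)"
    have a: "c < a" "l < c / (x * a)"
    proof -
      have "c < a \<and> l < c / (x * a)"
      proof (cases "l \<le> 0")
        case True
        then show ?thesis using c x by (auto simp: a_def intro: le_less_trans[of l 0])
      next
        case False
        then have lx: "0 < l * x" "l * x < 1" using l x by (auto simp: field_simps)
        then have "c < c / (l * x)" using c by (simp add: field_simps)
        moreover have "c < (c + r) / 2 \<and> (c + r) / 2 < r" if "c < r" for r using that by simp
        ultimately have "c < a" "a < c / (l * x)" using False unfolding a_def by presburger+
        then show ?thesis using lx x c False by (auto simp: field_simps)
      qed
      then show "c < a" "l < c / (x * a)" by auto
    qed
    then have xa: "0 < x * a" using c x by simp
    show "\<forall>\<^sub>F y in at_top. l < real (N y) * R (x * y)"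
      using upper[OF a(1)] order_tendstoD(1)[OF limN[OF xa] a(2)]
    proof eventually_elim
      case (elim y)
      have "R (x * a * B (N y)) \<le> R (x * y)"
        using elim(1) x by (intro antimonoD[OF mono]) (simp add: mult.assoc)
      then have "real (N y) * R (x * a * B (N y)) \<le> real (N y) * R (x * y)" by (intro mult_left_mono) auto
      then show ?case using elim(2) by linarith
    qed
  next
    fix u assume u: "1 / x < u"
    define a where "a = (c + c / (u * x)) / 2"
    have ux: "1 < u * x" using u x by (simp add: field_simps)
    then have "c / (u * x) < c" using c by (simp add: field_simps)
    moreover have "0 < c / (u * x)" using c ux by simp
    moreover have "0 < (c + r) / 2 \<and> (c + r) / 2 < c \<and> r < (c + r) / 2" if "r < c" "0 < r" for r
      using that by simp
    ultimately have a: "0 < a" "a < c" "c / (u * x) < a" unfolding a_def by blast+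
    have u0: "u > 0" using u x by (meson less_trans zero_less_divide_1_iff)
    have au: "c / (x * a) < u" using a(1,3) ux u0 x by (simp add: field_simps)
    have xa: "0 < x * a" using a x by simp
    show "\<forall>\<^sub>F y in at_top. real (N y) * R (x * y) < u"
      using lower[OF a(1,2)] order_tendstoD(2)[OF limN[OF xa] au]
    proof eventually_elim
      case (elim y)
      have "R (x * y) \<le> R (x * a * B (N y))"
        using elim(1) x by (intro antimonoD[OF mono]) (simp add: mult.assoc)
      then have "real (N y) * R (x * y) \<le> real (N y) * R (x * a * B (N y))" by (intro mult_left_mono) auto
      then show ?case using elim(2) by linarith
    qed
  qed
  then have "((\<lambda>y. (real (N y) * R (x * y)) / (real (N y) * R y)) \<longlongrightarrow> (1 / x) / 1) at_top"
    by (intro tendsto_divide NR) auto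
  then have "((\<lambda>y. (real (N y) * R (x * y)) / (real (N y) * R y)) \<longlongrightarrow> 1 / x) at_top" by simp
  then show ?thesis
  proof (rule Lim_transform_eventually)
    show "\<forall>\<^sub>F y in at_top. (real (N y) * R (x * y)) / (real (N y) * R y) = R (x * y) / R y"
      using order_tendstoD(1)[OF NR, of 0] by (auto elim!: eventually_mono)
  qed
qed

text \<open>The hypotheses relate the tail \<open>T\<close> of a nonnegative variable to the tail \<open>R\<close> of the absolute
  difference of two independent copies. They squeeze \<open>2 * T y / R y\<close> between one and
  \<open>R (y - K) / (R y * (1 - T K))\<close>; regular variation of \<open>R\<close> absorbs the shift by \<open>K\<close>.\<close>

lemma regular_variation_transfer:
  fixes R T :: "real \<Rightarrow> real"
  assumes mono: "antimono R" and Rpos: "\<And>y. 0 < R y" and T0: "(T \<longlongrightarrow> 0) at_top"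
    and RV: "\<And>x. x > 0 \<Longrightarrow> ((\<lambda>y. R (x * y) / R y) \<longlongrightarrow> 1 / x) at_top"
    and le: "\<And>y. 0 \<le> y \<Longrightarrow> R y \<le> 2 * T y"
    and ge: "\<And>y K. 0 \<le> y \<Longrightarrow> 0 \<le> K \<Longrightarrow> 2 * (T (y + K) * (1 - T K)) \<le> R y"
    and x: "x > 0"
  shows "((\<lambda>y. T (x * y) / T y) \<longlongrightarrow> 1 / x) at_top"
proof -
  have ratio: "((\<lambda>y. 2 * T y / R y) \<longlongrightarrow> 1) at_top"
  proof (rule order_tendstoI)
    fix l :: real assume "l < 1"
    show "\<forall>\<^sub>F y in at_top. l < 2 * T y / R y"
      using eventually_ge_at_top[of 0]
    proof eventually_elim
      case (elim y)
      then have "1 \<le> 2 * T y / R y" using le[of y] Rpos[of y] by simp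
      then show ?case using \<open>l < 1\<close> by linarith
    qed
  next
    fix u :: real assume u: "1 < u"
    \<comment> \<open>One factor \<open>q\<close> pays for the shift by \<open>K\<close>, another for the division by \<open>1 - T K\<close>.\<close>
    then obtain q where q: "1 < q" "q < sqrt u" using dense[of 1 "sqrt u"] by auto
    have qu: "q * q < u"
      using mult_strict_mono[OF q(2) q(2)] q u by simp
    have "\<forall>\<^sub>F K in at_top. T K < 1 - 1 / q"
      using T0 q by (intro order_tendstoD(2)) auto
    then have "\<forall>\<^sub>F K in at_top. T K < 1 - 1 / q \<and> 0 \<le> K"
      using eventually_ge_at_top[of 0] by (rule eventually_conj)
    then obtain K where K: "T K < 1 - 1 / q" "0 \<le> K"
      by (auto simp: eventually_at_top_linorder)
    have "((\<lambda>y. R ((1 / q) * y) / R y) \<longlongrightarrow> 1 / (1 / q)) at_top" using q by (intro RV) auto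
    moreover have "1 / (1 / q) < u / q" using qu q by (simp add: field_simps)
    ultimately have "\<forall>\<^sub>F y in at_top. R ((1 / q) * y) / R y < u / q" by (rule order_tendstoD(2))
    then show "\<forall>\<^sub>F y in at_top. 2 * T y / R y < u"
      using eventually_ge_at_top[of "K / (1 - 1 / q)"] eventually_ge_at_top[of K]
    proof eventually_elim
      case (elim y)
      have "1 / q < 1" using q by simp
      then have "(1 / q) * y \<le> y - K" using elim(2) by (simp add: pos_divide_le_eq algebra_simps)
      then have "R (y - K) \<le> R ((1 / q) * y)" by (intro antimonoD[OF mono])
      moreover have "2 * (T y * (1 - T K)) \<le> R (y - K)" using ge[of "y - K" K] elim K by simp
      moreover have "0 \<le> T y" using le[of y] Rpos[of y] elim K by simp
      then have "T y * (1 / q) \<le> T y * (1 - T K)" using K by (intro mult_left_mono) auto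
      ultimately have "2 * T y * (1 / q) \<le> R ((1 / q) * y)" by linarith
      also have "\<dots> < u / q * R y" using elim(1) Rpos[of y] by (simp add: pos_divide_less_eq)
      finally show ?case using Rpos[of y] q by (simp add: field_simps)
    qed
  qed
  have "filterlim (\<lambda>y. x * y) at_top at_top"
    by (rule filterlim_tendsto_pos_mult_at_top[OF tendsto_const x filterlim_ident])
  then have "((\<lambda>y. 2 * T (x * y) / R (x * y)) \<longlongrightarrow> 1) at_top"
    by (rule filterlim_compose[OF ratio])
  then have "((\<lambda>y. (2 * T (x * y) / R (x * y)) * (R (x * y) / R y) / (2 * T y / R y)) \<longlongrightarrow> 1 * (1 / x) / 1) at_top"
    by (intro tendsto_divide tendsto_mult RV x ratio) auto
  moreover have "(2 * T (x * y) / R (x * y)) * (R (x * y) / R y) / (2 * T y / R y) = T (x * y) / T y" for y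
    using Rpos[of y] Rpos[of "x * y"] by simp
  ultimately show ?thesis by simp
qed

text \<open>Any frequency is a multiple \<open>k * u\<close> of some \<open>u\<close> with \<open>\<bar>u\<bar> \<le> \<tau>\<close>, where \<open>k\<close> is at most
  \<open>\<bar>t\<bar> / \<tau> + 1\<close>.\<close>

lemma one_minus_char_growth:
  assumes "real_distribution L" "\<tau> > 0" and near: "\<And>t. \<bar>t\<bar> \<le> \<tau> \<Longrightarrow> (\<integral>x. 1 - cos (t * x) \<partial>L) \<le> A"
  shows "(\<integral>x. 1 - cos (t * x) \<partial>L) \<le> A * ((1 / \<tau> + 1) * (1 + \<bar>t\<bar>))\<^sup>2"
proof -
  interpret L: real_distribution L by fact
  have int: "integrable L (\<lambda>x. 1 - cos (u * x))" for u
  proof (rule L.integrable_const_bound[of _ 2])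
    have "norm (1 - cos y) \<le> 2" for y :: real using cos_ge_minus_one[of y] by simp
    then show "AE x in L. norm (1 - cos (u * x)) \<le> 2" by blast
  qed measurable
  have A: "0 \<le> A" using near[of 0] assms(2) by simp
  define k where "k = Suc (nat \<lfloor>\<bar>t\<bar> / \<tau>\<rfloor>)"
  have "0 \<le> \<lfloor>\<bar>t\<bar> / \<tau>\<rfloor>" using assms(2) by simp
  then have "real k = of_int \<lfloor>\<bar>t\<bar> / \<tau>\<rfloor> + 1" by (simp add: k_def)
  then have k: "real k \<le> \<bar>t\<bar> / \<tau> + 1" "\<bar>t\<bar> / \<tau> \<le> real k"
    using floor_correct[of "\<bar>t\<bar> / \<tau>"] by linarith+
  have k0: "real k > 0" by (simp add: k_def)
  have "(\<integral>x. 1 - cos (t * x) \<partial>L) \<le> (\<integral>x. (real k)\<^sup>2 * (1 - cos (t / real k * x)) \<partial>L)"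
  proof (rule integral_mono[OF int])
    show "integrable L (\<lambda>x. (real k)\<^sup>2 * (1 - cos (t / real k * x)))" using int by (rule integrable_mult_right)
    show "1 - cos (t * x) \<le> (real k)\<^sup>2 * (1 - cos (t / real k * x))" for x
      using one_minus_cos_mult_le[of k "t / real k * x"] k0 by simp
  qed
  also have "\<dots> = (real k)\<^sup>2 * (\<integral>x. 1 - cos (t / real k * x) \<partial>L)" by simp
  also have "\<dots> \<le> (real k)\<^sup>2 * A"
    using k(2) k0 assms(2) by (intro mult_left_mono near) (auto simp: field_simps)
  also have "\<dots> \<le> ((1 / \<tau> + 1) * (1 + \<bar>t\<bar>))\<^sup>2 * A"
  proof (intro mult_right_mono power_mono A)
    have "\<bar>t\<bar> / \<tau> + 1 \<le> (1 / \<tau> + 1) * (1 + \<bar>t\<bar>)" using assms(2) by (simp add: field_simps)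
    then show "real k \<le> (1 / \<tau> + 1) * (1 + \<bar>t\<bar>)" using k(1) by linarith
  qed (use k0 in simp)
  finally show ?thesis by (simp add: mult.commute)
qed

text \<open>The modulus of the characteristic function of the normalised sum is
  \<open>\<bar>\<phi> (t / B\<^sub>n)\<bar>\<^sup>n\<close>, free of the centring constants, and tends to \<open>exp (- \<bar>t\<bar>)\<close>. Since
  \<open>\<bar>\<phi>\<bar>\<^sup>2\<close> is the characteristic function of the difference of two independent copies, the cosine
  integrals of its rescaled law, times \<open>n\<close>, converge to \<open>2 * \<bar>t\<bar>\<close>. The tail of the difference is then
  compared with that of \<open>\<mu>\<close>, using that \<open>\<mu>\<close> lives on the nonnegative half-line.\<close>

theorem tail_of_domain_of_attraction:
  fixes \<mu> \<nu> :: "real measure"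
  assumes \<mu>: "real_distribution \<mu>" and nonneg: "AE x in \<mu>. 0 \<le> x"
    and \<nu>: "max_skew_cauchy \<nu>" and dom: "in_domain_of_attraction \<mu> \<nu>"
  shows "\<And>x. x > 0 \<Longrightarrow> ((\<lambda>y. measure \<mu> {x * y<..} / measure \<mu> {y<..}) \<longlongrightarrow> 1 / x) at_top"
    and "\<And>y. 0 < measure \<mu> {y<..}"
proof -
  interpret \<mu>: real_distribution \<mu> by fact
  define P where "P = PiM (UNIV :: nat set) (\<lambda>_. \<mu>)"
  interpret P: prob_space P unfolding P_def by (intro prob_space_PiM \<mu>.prob_space_axioms)
  have \<nu>': "real_distribution \<nu>" using \<nu> by (simp add: max_skew_cauchy_def)
  have indep: "P.indep_vars (\<lambda>_. borel) (\<lambda>i Y. Y i) UNIV"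
    unfolding P_def by (rule indep_vars_PiM_coordinates[OF \<mu>])
  have coord [measurable]: "(\<lambda>Y. Y i) \<in> borel_measurable P" for i
    using indep by (auto simp: P.indep_vars_def)
  have law: "distr P borel (\<lambda>Y. Y i) = \<mu>" for i
    using distr_PiM_component[of UNIV "\<lambda>_. \<mu>" i] \<mu>.prob_space_axioms by (simp add: P_def cong: distr_cong)
  obtain A B where B: "\<And>n. B n > 0"
    and weak: "weak_conv_m (\<lambda>n. distr P borel (\<lambda>Y. inverse (B n) * (\<Sum>i<n. Y i) - A n)) \<nu>"
    using dom unfolding in_domain_of_attraction_def P_def by blast
  define N where "N n = distr P borel (\<lambda>Y. inverse (B n) * (\<Sum>i<n. Y i) - A n)" for n
  have N: "real_distribution (N n)" for n
    unfolding N_def by (rule P.real_distribution_distr) measurable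
  define \<phi> where "\<phi> = char \<mu>"
  have norm_char_N: "norm (char (N n) t) = norm (\<phi> (t / B n)) ^ n" for n t
  proof -
    let ?S = "distr P borel (\<lambda>Y. \<Sum>i<n. Y i)"
    have S: "real_distribution ?S" by (rule P.real_distribution_distr) measurable
    have "N n = distr ?S borel (\<lambda>x. inverse (B n) * x - A n)"
      unfolding N_def by (subst distr_distr) (auto simp: comp_def)
    then have "norm (char (N n) t) = norm (char ?S (inverse (B n) * t))"
      by (simp add: char_distr_affine[OF S] norm_mult)
    also have "char ?S (inverse (B n) * t) = (\<Prod>i<n. char (distr P borel (\<lambda>Y. Y i)) (inverse (B n) * t))"
      by (rule P.char_distr_sum) (rule P.indep_vars_subset[OF indep], simp)
    finally show ?thesis by (simp add: law \<phi>_def norm_power divide_inverse mult.commute)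
  qed
  have lim\<phi>: "(\<lambda>n. norm (\<phi> (t / B n)) ^ n) \<longlonglongrightarrow> exp (- \<bar>t\<bar>)" for t
    using tendsto_norm[OF levy_continuity1[OF N \<nu>' weak[folded N_def], of t]]
    by (simp add: norm_char_N norm_char_max_skew_cauchy[OF \<nu>])

  \<comment> \<open>The law of the difference of two independent copies.\<close>
  define L where "L = distr P borel (\<lambda>Y. Y 0 - Y 1)"
  interpret L: real_distribution L unfolding L_def by (rule P.real_distribution_distr) measurable
  have charL: "char L t = complex_of_real ((norm (\<phi> t))\<^sup>2)" for t
  proof -
    let ?Z = "\<lambda>i Y. (if i = 0 then 1 else - 1) * (Y i :: real)"
    have "P.indep_vars (\<lambda>_. borel) ?Z {0, Suc 0}"
      by (rule P.indep_vars_subset[OF P.indep_vars_compose2[OF indep]]) auto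
    then have "char (distr P borel (\<lambda>Y. \<Sum>i\<in>{0, Suc 0}. ?Z i Y)) t = (\<Prod>i\<in>{0, Suc 0}. char (distr P borel (?Z i)) t)"
      by (rule P.char_distr_sum)
    then have 1: "char L t = \<phi> t * char (distr P borel (\<lambda>Y. - Y 1)) t"
      by (simp add: L_def law \<phi>_def)
    have "distr P borel (\<lambda>Y. - Y 1) = distr \<mu> borel (\<lambda>x. (-1) * x - 0)"
      by (subst law[of 1, symmetric], subst distr_distr) (auto simp: comp_def)
    then have "char (distr P borel (\<lambda>Y. - Y 1)) t = \<phi> (- t)"
      using char_distr_affine[OF \<mu>, of "-1" 0 t] by (simp add: \<phi>_def)
    also have "\<phi> (- t) = cnj (\<phi> t)" by (simp add: \<phi>_def \<mu>.char_Complex complex_eq_iff)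
    finally show ?thesis unfolding complex_norm_square using 1 by simp
  qed
  have sinL: "(\<integral>x. sin (t * x) \<partial>L) = 0" for t
    using arg_cong[OF charL[of t], of Im] by (simp add: L.char_Complex)
  have L_sym: "distr L borel uminus = L"
  proof (rule Levy_uniqueness)
    show *: "real_distribution (distr L borel uminus)" by (rule L.real_distribution_distr) simp
    interpret L': real_distribution "distr L borel uminus" by (rule *)
    show "char (distr L borel uminus) = char L"
      by (rule ext) (simp add: L'.char_Complex L.char_Complex integral_distr sinL)
  qed (rule L.real_distribution_axioms)
  define Ln where "Ln n = distr L borel (\<lambda>x. x / B n)" for n
  have Ln: "real_distribution (Ln n)" for n
    unfolding Ln_def by (rule L.real_distribution_distr) simp
  have cosLn: "(\<integral>x. 1 - cos (t * x) \<partial>Ln n) = 1 - (norm (\<phi> (t / B n)))\<^sup>2" for n t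
  proof -
    interpret Ln: real_distribution "Ln n" by (rule Ln)
    have "char (Ln n) t = char L (t / B n)"
      using char_distr_affine[OF L.real_distribution_axioms, of "inverse (B n)" 0 t]
      by (simp add: Ln_def divide_inverse mult.commute)
    then have "(\<integral>x. cos (t * x) \<partial>Ln n) = (norm (\<phi> (t / B n)))\<^sup>2"
      by (simp add: charL Ln.char_Complex complex_eq_iff)
    moreover have "integrable (Ln n) (\<lambda>x. cos (t * x))"
      by (rule Ln.integrable_const_bound[of _ 1]) auto
    ultimately show ?thesis using Ln.prob_space by simp
  qed
  have odd: "(\<integral>x. sin (t * x) * sat x \<partial>Ln n) = 0" for n t
  proof -
    let ?g = "\<lambda>x. sin (t * (x / B n)) * sat (x / B n)"
    have "(\<integral>x. ?g x \<partial>L) = (\<integral>x. ?g x \<partial>distr L borel uminus)" by (simp add: L_sym)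
    also have "\<dots> = (\<integral>x. - ?g x \<partial>L)" by (subst integral_distr) (auto simp: sat_def)
    finally have "(\<integral>x. ?g x \<partial>L) = 0" by simp
    then show ?thesis unfolding Ln_def by (subst integral_distr) auto
  qed
  have lim: "(\<lambda>n. real n * (\<integral>x. 1 - cos (t * x) \<partial>Ln n)) \<longlonglongrightarrow> 2 * \<bar>t\<bar>" for t
  proof -
    have "(\<lambda>n. (norm (\<phi> (t / B n)) ^ n)\<^sup>2) \<longlonglongrightarrow> (exp (- \<bar>t\<bar>))\<^sup>2" by (intro tendsto_power lim\<phi>)
    then have "(\<lambda>n. ((norm (\<phi> (t / B n)))\<^sup>2) ^ n) \<longlonglongrightarrow> exp (- (2 * \<bar>t\<bar>))"
      by (simp add: power_mult[symmetric] mult.commute exp_double[symmetric])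
    then show ?thesis
      unfolding cosLn using \<mu>.cmod_char_le_1
      by (intro exp_power_limit) (auto simp: \<phi>_def power_le_one)
  qed
  \<comment> \<open>A bound on \<open>n * (1 - w)\<close> uniform in the frequency, needed for dominated convergence.\<close>
  obtain \<tau> n0 where \<tau>: "\<tau> > 0" and near: "\<And>n t. n \<ge> n0 \<Longrightarrow> \<bar>t\<bar> \<le> \<tau> \<Longrightarrow> norm (char (N n) t) \<ge> 1 / 2"
    using weak_conv_char_near_zero[OF N \<nu>' weak[folded N_def]] by blast
  have bound: "real n * (\<integral>x. 1 - cos (t * x) \<partial>Ln n) \<le> ln 4 * (1 / \<tau> + 1)\<^sup>2 * (1 + \<bar>t\<bar>)\<^sup>2"
    if n: "n \<ge> Suc n0" for n t
  proof -
    have "(\<integral>x. 1 - cos (t * x) \<partial>Ln n) \<le> (ln 4 / real n) * ((1 / \<tau> + 1) * (1 + \<bar>t\<bar>))\<^sup>2"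
    proof (rule one_minus_char_growth[OF Ln \<tau>])
      fix u assume u: "\<bar>u\<bar> \<le> \<tau>"
      define w where "w = (norm (\<phi> (u / B n)))\<^sup>2"
      have "(1 / 2)\<^sup>2 \<le> (norm (\<phi> (u / B n)) ^ n)\<^sup>2"
        using near[of n u] n u by (intro power_mono) (auto simp: norm_char_N)
      then have "1 / 4 \<le> w ^ n" by (simp add: w_def power2_eq_square power_mult_distrib[symmetric])
      moreover from this have w: "w > 0" using n by (cases "w = 0") (auto simp: w_def power_0_left)
      ultimately have "ln (1 / 4) \<le> ln (w ^ n)" by (subst ln_le_cancel_iff) auto
      then have "- ln 4 \<le> real n * ln w" using w by (simp add: ln_realpow ln_div)
      also have "\<dots> \<le> real n * (w - 1)" using ln_le_minus_one[OF w] by (intro mult_left_mono) auto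
      finally have "real n * (1 - w) \<le> ln 4" by (simp add: algebra_simps)
      then show "(\<integral>x. 1 - cos (u * x) \<partial>Ln n) \<le> ln 4 / real n"
        unfolding cosLn w_def[symmetric] using n by (simp add: field_simps)
    qed
    from mult_left_mono[OF this, of "real n"]
    have "real n * (\<integral>x. 1 - cos (t * x) \<partial>Ln n) \<le> ln 4 * ((1 / \<tau> + 1) * (1 + \<bar>t\<bar>))\<^sup>2"
      using n by simp
    then show ?thesis by (simp only: power_mult_distrib mult.assoc)
  qed
  obtain c where c: "c > 0" and tail: "\<And>a. a > 0 \<Longrightarrow> (\<lambda>n. real n * measure (Ln n) {x. a < \<bar>x\<bar>}) \<longlonglongrightarrow> c / a"
    using tail_limit_of_cos_limit[OF Ln odd lim bound] by blast

  \<comment> \<open>The difference exceeds a level essentially only if one of the two copies does.\<close>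
  define R where "R y = measure L {x. y < \<bar>x\<bar>}" for y
  define T where "T y = measure \<mu> {y<..}" for y
  have "measure (Ln n) {x. a < \<bar>x\<bar>} = R (a * B n)" for a n
    unfolding Ln_def R_def using B[of n]
    by (subst measure_distr) (auto intro!: arg_cong[where f="measure L"] simp: field_simps)
  with tail have tailR: "\<And>a. a > 0 \<Longrightarrow> (\<lambda>n. real n * R (a * B n)) \<longlonglongrightarrow> c / a" by simp
  have R_mono: "antimono R" unfolding R_def by (intro antimonoI L.finite_measure_mono) auto
  have R_nonneg: "0 \<le> R y" for y by (simp add: R_def)
  have R_eq: "R y = P.prob {Y \<in> space P. y < \<bar>Y 0 - Y 1\<bar>}" for y
    unfolding R_def L_def by (subst measure_distr) (auto intro!: arg_cong[where f=P.prob])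
  have T_eq: "P.prob {Y \<in> space P. y < Y i} = T y" for y i
    unfolding T_def by (subst law[of i, symmetric], subst measure_distr) (auto intro!: arg_cong[where f=P.prob])
  have T_compl: "P.prob {Y \<in> space P. Y i \<le> y} = 1 - T y" for y i
  proof -
    have "{Y \<in> space P. Y i \<le> y} = space P - {Y \<in> space P. y < Y i}" by auto
    then show ?thesis using P.prob_compl[of "{Y \<in> space P. y < Y i}"] by (simp add: T_eq)
  qed
  have nn: "AE Y in P. 0 \<le> Y i" for i
    using nonneg by (subst (asm) law[of i, symmetric], subst (asm) AE_distr_iff) auto
  have le: "R y \<le> 2 * T y" if "0 \<le> y" for y
  proof -
    have "R y \<le> P.prob ({Y \<in> space P. y < Y 0} \<union> {Y \<in> space P. y < Y 1})"
      unfolding R_eq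
    proof (rule P.finite_measure_mono_AE)
      show "AE Y in P. Y \<in> {Y \<in> space P. y < \<bar>Y 0 - Y 1\<bar>}
          \<longrightarrow> Y \<in> {Y \<in> space P. y < Y 0} \<union> {Y \<in> space P. y < Y 1}"
        using nn[of 0] nn[of 1] by eventually_elim auto
    qed measurable
    also have "\<dots> \<le> T y + T y"
      using measure_Un_le[of "{Y \<in> space P. y < Y 0}" P "{Y \<in> space P. y < Y 1}"] by (simp add: T_eq)
    finally show ?thesis by simp
  qed
  have ge: "2 * (T (y + K) * (1 - T K)) \<le> R y" if "0 \<le> y" "0 \<le> K" for y K
  proof -
    have pair: "P.prob {Y \<in> space P. y + K < Y i \<and> Y j \<le> K} = T (y + K) * (1 - T K)" if ij: "i \<noteq> j" for i j
    proof -
      have "P.prob (\<Inter>k\<in>{i, j}. (\<lambda>Y. Y k) -` (if k = i then {y + K<..} else {..K}) \<inter> space P)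
        = (\<Prod>k\<in>{i, j}. P.prob ((\<lambda>Y. Y k) -` (if k = i then {y + K<..} else {..K}) \<inter> space P))"
        by (rule P.indep_varsD[OF indep]) auto
      also have "(\<Inter>k\<in>{i, j}. (\<lambda>Y. Y k) -` (if k = i then {y + K<..} else {..K}) \<inter> space P)
          = {Y \<in> space P. y + K < Y i \<and> Y j \<le> K}" using ij by auto
      also have "(\<Prod>k\<in>{i, j}. P.prob ((\<lambda>Y. Y k) -` (if k = i then {y + K<..} else {..K}) \<inter> space P))
        = P.prob {Y \<in> space P. y + K < Y i} * P.prob {Y \<in> space P. Y j \<le> K}"
        using ij by (auto intro!: arg_cong2[where f="(*)"] arg_cong[where f=P.prob])
      finally show ?thesis by (simp add: T_eq T_compl)
    qed
    have "T (y + K) * (1 - T K) + T (y + K) * (1 - T K)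
      = P.prob ({Y \<in> space P. y + K < Y 0 \<and> Y 1 \<le> K} \<union> {Y \<in> space P. y + K < Y 1 \<and> Y 0 \<le> K})"
      using that pair[of 0 1] pair[of 1 0] by (subst P.finite_measure_Union) auto
    also have "\<dots> \<le> R y" unfolding R_eq by (rule P.finite_measure_mono) (use that in auto)
    finally show ?thesis by (simp only: mult_2)
  qed
  have T0: "(T \<longlongrightarrow> 0) at_top"
  proof -
    have "((\<lambda>y. 1 - cdf \<mu> y) \<longlongrightarrow> 1 - 1) at_top"
      by (intro tendsto_intros \<mu>.cdf_lim_at_top_prob)
    moreover have "1 - cdf \<mu> y = T y" for y
      using \<mu>.prob_compl[of "{..y}"] by (simp add: cdf_def T_def Compl_eq_Diff_UNIV[symmetric])
    ultimately show ?thesis by simp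
  qed
  have R0: "(R \<longlongrightarrow> 0) at_top"
  proof (rule tendsto_sandwich[of "\<lambda>_. 0"])
    show "\<forall>\<^sub>F y in at_top. R y \<le> 2 * T y"
      using eventually_ge_at_top[of 0] by eventually_elim (rule le)
    show "((\<lambda>y. 2 * T y) \<longlongrightarrow> 0) at_top" using tendsto_mult[OF tendsto_const T0, of 2] by simp
  qed (auto simp: R_nonneg)
  have R_pos: "0 < R y" for y by (rule positive_of_scaled_limit[OF R_mono R_nonneg B c tailR])
  show "((\<lambda>y. measure \<mu> {x * y<..} / measure \<mu> {y<..}) \<longlongrightarrow> 1 / x) at_top" if "x > 0" for x
    unfolding T_def[symmetric]
    by (rule regular_variation_transfer[OF R_mono R_pos T0 tail_regularly_varying[OF R_mono R_nonneg R0 B c tailR] le ge that])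
  show "0 < measure \<mu> {y<..}" for y
  proof -
    have "0 < 2 * T (max y 0)" using R_pos[of "max y 0"] le[of "max y 0"] by linarith
    also have "T (max y 0) \<le> measure \<mu> {y<..}" unfolding T_def by (intro \<mu>.finite_measure_mono) auto
    finally show ?thesis by simp
  qed
qed

section \<open>Excess and truncated moments of a tail of index minus one\<close>

text \<open>A finite mean at tail index minus one is a borderline case: the tail and the truncated second moment
  follow power laws, whereas the excess decays more slowly than any power. This separation of scales is
  what makes a single observation decisive.\<close>

locale unit_mean_cauchy_tail = real_distribution \<mu> for \<mu> +
  assumes nonneg: "AE x in \<mu>. 0 \<le> x"
    and integrable_id: "integrable \<mu> (\<lambda>x. x)" and mean_one: "(\<integral>x. x \<partial>\<mu>) = 1"
    and tail_pos: "\<And>y. 0 < measure \<mu> {y<..}"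
    and tail_ratio: "\<And>x. x > 0 \<Longrightarrow> ((\<lambda>y. measure \<mu> {x * y<..} / measure \<mu> {y<..}) \<longlongrightarrow> 1 / x) at_top"
begin

definition T :: "real \<Rightarrow> real" where "T y = measure \<mu> {y<..}"
definition excess :: "real \<Rightarrow> real" where "excess x = (\<integral>h. max 0 (h - x) \<partial>\<mu>)"
definition trunc2 :: "real \<Rightarrow> real" where "trunc2 x = (\<integral>h. (min h x)\<^sup>2 \<partial>\<mu>)"

lemma T_pos: "0 < T y" and T_le_1: "T y \<le> 1"
  and T_ratio: "x > 0 \<Longrightarrow> ((\<lambda>y. T (x * y) / T y) \<longlongrightarrow> 1 / x) at_top"
  using tail_pos tail_ratio by (auto simp: T_def)

lemma T_antimono: "x \<le> y \<Longrightarrow> T y \<le> T x"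
  unfolding T_def by (intro finite_measure_mono) auto

lemma integrable_excess: "integrable \<mu> (\<lambda>h. max 0 (h - x))"
  by (intro integrable_max) (auto intro: integrable_id)

lemma integrable_ind: "integrable \<mu> (\<lambda>h. c * indicator {x<..} h :: real)"
  by (intro integrable_mult_right) (simp add: integrable_indicator_iff less_top[symmetric])

text \<open>An increment of the excess is the integral of the tail, estimated here by the tail at the endpoints.\<close>

lemma excess_diff:
  assumes "x \<le> y"
  shows "(y - x) * T y \<le> excess x - excess y" "excess x - excess y \<le> (y - x) * T x"
proof -
  have eq: "excess x - excess y = (\<integral>h. max 0 (h - x) - max 0 (h - y) \<partial>\<mu>)"
    unfolding excess_def by (rule Bochner_Integration.integral_diff[symmetric]; rule integrable_excess)
  have ind: "c * T z = (\<integral>h. c * indicator {z<..} h \<partial>\<mu>)" for c z by (simp add: T_def)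
  note i = Bochner_Integration.integrable_diff[OF integrable_excess[of x] integrable_excess[of y]]
  show "(y - x) * T y \<le> excess x - excess y"
    unfolding eq ind by (rule integral_mono[OF integrable_ind i]) (use assms in \<open>auto simp: indicator_def\<close>)
  show "excess x - excess y \<le> (y - x) * T x"
    unfolding eq ind by (rule integral_mono[OF i integrable_ind]) (use assms in \<open>auto simp: indicator_def\<close>)
qed

lemma excess_nonneg: "0 \<le> excess x"
  unfolding excess_def by (rule Bochner_Integration.integral_nonneg) simp

lemma excess_pos: "0 < excess x"
  using excess_diff(1)[of x "x + 1"] T_pos[of "x + 1"] excess_nonneg[of "x + 1"] by simp

lemma excess_antimono: "x \<le> y \<Longrightarrow> excess y \<le> excess x"
proof -
  assume xy: "x \<le> y"
  then have "0 \<le> (y - x) * T y" using T_pos[of y] by simp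
  then show "excess y \<le> excess x" using excess_diff(1)[OF xy] by linarith
qed

lemma excess_0: "excess 0 = 1"
proof -
  have "excess 0 = (\<integral>h. h \<partial>\<mu>)"
    unfolding excess_def by (rule integral_cong_AE) (use nonneg in \<open>auto elim!: eventually_mono\<close>)
  then show ?thesis by (simp add: mean_one)
qed

lemma isCont_excess: "isCont excess x"
proof -
  have lip: "\<bar>excess u - excess v\<bar> \<le> \<bar>u - v\<bar>" if "u \<le> v" for u v
    using excess_diff(2)[OF that] excess_antimono[OF that] that
      mult_left_mono[OF T_le_1[of u], of "v - u"] by auto
  have "dist (excess y) (excess x) \<le> dist y x" for y
    using lip[of x y] lip[of y x] unfolding dist_real_def by linarith
  then show ?thesis unfolding continuous_at_eps_delta by (meson le_less_trans)
qed

lemma excess_tendsto_0: "(excess \<longlongrightarrow> 0) at_top"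
proof -
  have "((\<lambda>x. \<integral>h. max 0 (h - x) \<partial>\<mu>) \<longlongrightarrow> (\<integral>h. 0 \<partial>\<mu>)) at_top"
  proof (rule integral_dominated_convergence_at_top)
    show "integrable \<mu> (\<lambda>h. \<bar>h\<bar>)" using integrable_id by simp
    show "AE h in \<mu>. ((\<lambda>x. max 0 (h - x)) \<longlongrightarrow> 0) at_top"
    proof (rule AE_I2)
      fix h :: real
      have "\<forall>\<^sub>F x in at_top. max 0 (h - x) = 0"
        using eventually_ge_at_top[of h] by eventually_elim simp
      then show "((\<lambda>x. max 0 (h - x)) \<longlongrightarrow> 0) at_top" by (rule tendsto_eventually)
    qed
    show "\<forall>\<^sub>F x in at_top. AE h in \<mu>. norm (max 0 (h - x)) \<le> \<bar>h\<bar>"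
      using eventually_ge_at_top[of 0] by eventually_elim auto
  qed measurable
  then show ?thesis unfolding excess_def[abs_def] by simp
qed

text \<open>Each of the dyadic blocks \<open>[2\<^sup>j * x, 2\<^sup>j\<^sup>+\<^sup>1 * x]\<close> contributes about \<open>x * T x / 2\<close> or more to the
  excess, because the tail halves when its argument doubles; hence \<open>excess x\<close> eventually outweighs any
  multiple of \<open>x * T x\<close>.\<close>

lemma tail_negligible: "((\<lambda>x. x * T x / excess x) \<longlongrightarrow> 0) at_top"
proof (rule order_tendstoI)
  fix a :: real assume "a < 0"
  show "\<forall>\<^sub>F x in at_top. a < x * T x / excess x"
    using eventually_ge_at_top[of 0]
  proof eventually_elim
    case (elim x)
    then have "0 \<le> x * T x / excess x" using T_pos[of x] excess_pos[of x] by simp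
    then show ?case using \<open>a < 0\<close> by linarith
  qed
next
  fix a :: real assume a: "0 < a"
  obtain J :: nat where J: "4 / a < real J" using reals_Archimedean2 by blast
  moreover have "0 < 4 / a" using a by simp
  ultimately have J0: "real J > 0" by linarith
  have ev: "\<forall>\<^sub>F x in at_top. 1 / 2 / 2 ^ Suc j < T (2 ^ Suc j * x) / T x" for j :: nat
    by (rule order_tendstoD(1)[OF T_ratio]) (simp_all add: field_simps)
  have "\<forall>\<^sub>F x in at_top. \<forall>j\<in>{..<J}. 1 / 2 / 2 ^ Suc j < T (2 ^ Suc j * x) / T x"
    using ev by (intro eventually_ball_finite) auto
  then show "\<forall>\<^sub>F x in at_top. x * T x / excess x < a"
    using eventually_gt_at_top[of 0]
  proof eventually_elim
    case (elim x)
    have step: "x * T x / 4 \<le> excess (2 ^ j * x) - excess (2 ^ Suc j * x)" if "j < J" for j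
    proof -
      have "1 / 2 / 2 ^ Suc j * T x < T (2 ^ Suc j * x)"
        using elim(1) that T_pos[of x] by (simp add: pos_less_divide_eq)
      then have "2 ^ j * x * (1 / 2 / 2 ^ Suc j * T x) \<le> 2 ^ j * x * T (2 ^ Suc j * x)"
        using elim(2) by (intro mult_left_mono) auto
      moreover have "2 ^ j * x * (1 / 2 / 2 ^ Suc j * T x) = x * T x / 4" by simp
      moreover have "2 ^ j * x * T (2 ^ Suc j * x) \<le> excess (2 ^ j * x) - excess (2 ^ Suc j * x)"
        using excess_diff(1)[of "2 ^ j * x" "2 ^ Suc j * x"] elim(2) by (simp add: algebra_simps)
      ultimately show ?thesis by linarith
    qed
    have "real J * (x * T x / 4) = (\<Sum>j<J. x * T x / 4)" by simp
    also have "\<dots> \<le> (\<Sum>j<J. excess (2 ^ j * x) - excess (2 ^ Suc j * x))"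
      using step by (intro sum_mono) auto
    also have "\<dots> = excess x - excess (2 ^ J * x)"
      using sum_lessThan_telescope'[of "\<lambda>j. excess (2 ^ j * x)" J] by simp
    also have "\<dots> \<le> excess x" using excess_nonneg by simp
    finally have "x * T x \<le> (4 / real J) * excess x" using J0 by (simp add: field_simps)
    then have "x * T x / excess x \<le> 4 / real J" using excess_pos[of x] by (simp add: pos_divide_le_eq)
    also have "\<dots> < a" using J a J0 by (simp add: field_simps)
    finally show ?case .
  qed
qed

text \<open>The excess changes between \<open>x\<close> and \<open>c * x\<close> by at most \<open>(c - 1) * x * T x\<close>, which is negligible.\<close>

lemma excess_slowly_varying:
  assumes "a > 0" shows "((\<lambda>x. excess (a * x) / excess x) \<longlongrightarrow> 1) at_top"
proof -
  have ge1: "((\<lambda>x. excess (c * x) / excess x) \<longlongrightarrow> 1) at_top" if c: "c \<ge> 1" for c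
  proof (rule tendsto_sandwich)
    have "((\<lambda>x. 1 - (c - 1) * (x * T x / excess x)) \<longlongrightarrow> 1 - (c - 1) * 0) at_top"
      by (intro tendsto_intros tail_negligible)
    then show "((\<lambda>x. 1 - (c - 1) * (x * T x / excess x)) \<longlongrightarrow> 1) at_top" by simp
    show "\<forall>\<^sub>F x in at_top. 1 - (c - 1) * (x * T x / excess x) \<le> excess (c * x) / excess x"
      using eventually_ge_at_top[of 0]
    proof eventually_elim
      case (elim x)
      have "x \<le> c * x" using elim c by (simp add: mult_le_cancel_right1)
      from excess_diff(2)[OF this] have "excess x - (c - 1) * (x * T x) \<le> excess (c * x)"
        by (simp add: algebra_simps)
      from divide_right_mono[OF this excess_nonneg[of x]] show ?case
        using excess_pos[of x] by (simp add: diff_divide_distrib)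
    qed
    show "\<forall>\<^sub>F x in at_top. excess (c * x) / excess x \<le> 1"
      using eventually_ge_at_top[of 0]
    proof eventually_elim
      case (elim x)
      have "x \<le> c * x" using elim c by (simp add: mult_le_cancel_right1)
      then show ?case using excess_antimono excess_pos[of x] by simp
    qed
  qed simp
  show ?thesis
  proof (cases "a \<ge> 1")
    case False
    then have "1 / a \<ge> 1" using assms by simp
    then have "((\<lambda>x. excess (1 / a * (a * x)) / excess (a * x)) \<longlongrightarrow> 1) at_top"
      by (rule filterlim_compose[OF ge1 filterlim_tendsto_pos_mult_at_top[OF tendsto_const assms filterlim_ident]])
    then have "((\<lambda>x. inverse (excess x / excess (a * x))) \<longlongrightarrow> inverse 1) at_top"
      using assms by (intro tendsto_inverse) auto
    then show ?thesis by simp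
  qed (rule ge1)
qed

lemma integrable_trunc:
  assumes "0 \<le> x" shows "integrable \<mu> (\<lambda>h. min h x)" "integrable \<mu> (\<lambda>h. (min h x)\<^sup>2)"
proof -
  show "integrable \<mu> (\<lambda>h. min h x)"
    by (rule integrable_const_bound[of _ x]) (use nonneg assms in \<open>auto elim!: eventually_mono\<close>)
  show "integrable \<mu> (\<lambda>h. (min h x)\<^sup>2)"
    by (rule integrable_const_bound[of _ "x\<^sup>2"]) (use nonneg assms in \<open>auto elim!: eventually_mono intro!: power_mono\<close>)
qed

lemma trunc_mean: "0 \<le> x \<Longrightarrow> (\<integral>h. min h x \<partial>\<mu>) = 1 - excess x"
proof -
  have "(\<integral>h. min h x \<partial>\<mu>) = (\<integral>h. h - max 0 (h - x) \<partial>\<mu>)"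
    by (rule Bochner_Integration.integral_cong) auto
  also have "\<dots> = 1 - excess x"
    unfolding excess_def using integrable_id integrable_excess by (subst Bochner_Integration.integral_diff) (auto simp: mean_one)
  finally show ?thesis .
qed

lemma trunc2_step:
  assumes "0 \<le> x" shows "trunc2 (2 * x) \<le> trunc2 x + 3 * (x\<^sup>2 * T x)"
proof -
  have "trunc2 (2 * x) \<le> (\<integral>h. (min h x)\<^sup>2 + 3 * x\<^sup>2 * indicator {x<..} h \<partial>\<mu>)"
    unfolding trunc2_def
  proof (rule integral_mono_AE)
    show "AE h in \<mu>. (min h (2 * x))\<^sup>2 \<le> (min h x)\<^sup>2 + 3 * x\<^sup>2 * indicator {x<..} h"
      using nonneg
    proof eventually_elim
      case (elim h)
      have "(min h (2 * x))\<^sup>2 \<le> (2 * x)\<^sup>2" using elim assms by (intro power_mono) auto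
      moreover have "min h (2 * x) = min h x" if "h \<le> x" using that elim assms by simp
      ultimately show ?case using assms elim by (cases "h \<le> x") (auto simp: indicator_def power2_eq_square)
    qed
  qed (use assms integrable_trunc integrable_ind in auto)
  also have "\<dots> = trunc2 x + 3 * (x\<^sup>2 * T x)"
    unfolding trunc2_def using assms integrable_trunc integrable_ind
    by (subst Bochner_Integration.integral_add) (auto simp: T_def)
  finally show ?thesis .
qed

lemma trunc2_le_square: "0 \<le> x \<Longrightarrow> trunc2 x \<le> x\<^sup>2"
proof -
  assume x: "0 \<le> x"
  have "trunc2 x \<le> (\<integral>h. x\<^sup>2 \<partial>\<mu>)"
    unfolding trunc2_def using x nonneg
    by (intro integral_mono_AE integrable_trunc) (auto elim!: eventually_mono intro!: power_mono)
  then show ?thesis using prob_space by simp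
qed

text \<open>Doubling \<open>x\<close> adds at most \<open>3 * x\<^sup>2 * T x\<close> to the truncated second moment and multiplies
  \<open>x\<^sup>2 * T x\<close> by nearly two. So the truncated moment behaves like a geometric sum dominated by its
  last term.\<close>

lemma trunc2_bound:
  obtains C where "C > 0" "\<forall>\<^sub>F x in at_top. trunc2 x \<le> C * (x\<^sup>2 * T x)"
proof -
  \<comment> \<open>Any constant strictly between one quarter and one half would do.\<close>
  have "\<forall>\<^sub>F y in at_top. 2 / 5 < T (2 * y) / T y" by (rule order_tendstoD(1)[OF T_ratio]) auto
  then obtain x1 where x1: "\<And>y. y \<ge> x1 \<Longrightarrow> 2 / 5 < T (2 * y) / T y"
    by (auto simp: eventually_at_top_linorder)
  define x0 where "x0 = max x1 1"
  have x0: "x0 > 0" "\<And>y. y \<ge> x0 \<Longrightarrow> 2 / 5 * T y \<le> T (2 * y)"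
    using x1 T_pos by (auto simp: x0_def pos_less_divide_eq less_imp_le)
  define q where "q x = x\<^sup>2 * T x" for x
  \<comment> \<open>Five makes the induction step work, as \<open>C + 3 \<le> 8 / 5 * C\<close>; the other bound covers the first dyadic block.\<close>
  define C where "C = max 5 (4 / T (2 * x0))"
  have C: "C \<ge> 5" "4 / T (2 * x0) \<le> C" by (auto simp: C_def)
  have claim: "trunc2 x \<le> C * q x" if "x0 \<le> x" "x \<le> 2 ^ Suc k * x0" for k x
    using that
  proof (induction k arbitrary: x)
    case 0
    then have x: "x0 \<le> x" "x \<le> 2 * x0" by auto
    have "trunc2 x \<le> x\<^sup>2" using x x0 by (intro trunc2_le_square) auto
    also have "\<dots> \<le> (2 * x0)\<^sup>2" using x x0 by (intro power_mono) auto
    also have "\<dots> = (4 / T (2 * x0)) * (x0\<^sup>2 * T (2 * x0))" using T_pos[of "2 * x0"] by (simp add: power2_eq_square)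
    also have "\<dots> \<le> C * (x\<^sup>2 * T x)"
      using C x x0 T_pos by (intro mult_mono power_mono T_antimono) (auto intro: less_imp_le)
    finally show ?case by (simp add: q_def)
  next
    case (Suc k)
    show ?case
    proof (cases "x \<le> 2 * x0")
      case True
      have "(2 :: real) \<le> 2 ^ Suc k" by simp
      then have "2 * x0 \<le> 2 ^ Suc k * x0" using x0(1) by (intro mult_right_mono) auto
      then have "x \<le> 2 ^ Suc k * x0" using True by linarith
      then show ?thesis using Suc by blast
    next
      case False
      define y where "y = x / 2"
      have y: "x = 2 * y" "x0 \<le> y" "y \<le> 2 ^ Suc k * x0" using False Suc.prems by (auto simp: y_def)
      have "trunc2 x \<le> trunc2 y + 3 * q y"
        unfolding y(1) q_def using y x0 by (intro trunc2_step) auto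
      also have "\<dots> \<le> (C + 3) * q y" using Suc.IH[OF y(2,3)] by (simp add: algebra_simps)
      also have "\<dots> \<le> (8 / 5 * C) * q y"
        using C by (intro mult_right_mono) (auto simp: q_def T_pos less_imp_le)
      also have "\<dots> = C * (4 * y\<^sup>2 * (2 / 5 * T y))" by (simp add: q_def)
      also have "\<dots> \<le> C * (4 * y\<^sup>2 * T x)"
        unfolding y(1) using x0(2)[OF y(2)] C by (intro mult_left_mono) auto
      also have "\<dots> = C * q x" by (simp add: q_def y(1) power_mult_distrib)
      finally show ?thesis .
    qed
  qed
  show ?thesis
  proof (rule that)
    show "C > 0" using C by simp
    show "\<forall>\<^sub>F x in at_top. trunc2 x \<le> C * (x\<^sup>2 * T x)"
      using eventually_ge_at_top[of x0]
    proof eventually_elim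
      case (elim x)
      obtain k where "x / x0 < 2 ^ k" using real_arch_pow[of 2 "x / x0"] by auto
      then have "x < 2 ^ k * x0" using x0 by (simp add: pos_divide_less_eq)
      also have "\<dots> \<le> 2 ^ Suc k * x0" using x0(1) by (intro mult_right_mono) auto
      finally have "x \<le> 2 ^ Suc k * x0" by simp
      then show ?case using claim[OF elim] by (simp add: q_def)
    qed
  qed
qed

text \<open>This is the scale on which the deficit of the truncated sum, \<open>n * excess (b n)\<close>, matches a single
  observation of size \<open>b n\<close>.\<close>

lemma norming_sequence:
  obtains b where "\<And>n. 0 \<le> b n" "\<And>n. real n * excess (b n) = b n" "filterlim b at_top sequentially"
proof -
  have "\<exists>x\<ge>0. x \<le> real n \<and> x - real n * excess x = 0" for n
  proof (rule IVT)
    have "excess (real n) \<le> 1" using excess_antimono[of 0 "real n"] excess_0 by simp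
    then show "0 \<le> real n - real n * excess (real n)"
      using mult_left_mono[of "excess (real n)" 1 "real n"] by simp
  qed (auto intro!: continuous_intros isCont_excess excess_nonneg mult_nonneg_nonneg)
  then obtain b where b: "\<And>n. 0 \<le> b n" "\<And>n. b n - real n * excess (b n) = 0" by metis
  show ?thesis
  proof (rule that)
    show "filterlim b at_top sequentially"
      unfolding filterlim_at_top
    proof
      fix Z :: real
      have "filterlim (\<lambda>n. excess Z * real n) at_top sequentially"
        by (rule filterlim_tendsto_pos_mult_at_top[OF tendsto_const excess_pos filterlim_real_sequentially])
      then have "\<forall>\<^sub>F n in sequentially. Z < excess Z * real n" by (simp add: filterlim_at_top_dense)
      then show "\<forall>\<^sub>F n in sequentially. Z \<le> b n"
      proof eventually_elim
        case (elim n)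
        show ?case
        proof (rule ccontr)
          assume "\<not> Z \<le> b n"
          then have "excess Z \<le> excess (b n)" by (intro excess_antimono) auto
          then have "real n * excess Z \<le> real n * excess (b n)" by (intro mult_left_mono) auto
          then show False using elim b(2)[of n] \<open>\<not> Z \<le> b n\<close> by (simp add: mult.commute)
        qed
      qed
    qed
  qed (use b in auto)
qed

end

section \<open>The mixture likelihood when one observation dominates\<close>

text \<open>The maximum over \<open>r \<ge> 0\<close> of \<open>ln (1 + r * y) - r\<close> for \<open>y \<ge> 1\<close>, attained at \<open>r = 1 - 1 / y\<close>.\<close>

definition gain :: "real \<Rightarrow> real" where "gain y = ln y - 1 + 1 / y"

lemma gain_max:
  assumes "y > 0" "r \<ge> 0" shows "ln (1 + r * y) - r \<le> gain y"
proof -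
  have p: "0 < 1 / y + r" using assms by (simp add: add_pos_nonneg)
  have "1 + r * y = y * (1 / y + r)" using assms by (simp add: field_simps)
  then have "ln (1 + r * y) = ln y + ln (1 / y + r)" using p assms by (simp add: ln_mult)
  also have "\<dots> \<le> ln y + (1 / y + r - 1)" using ln_le_minus_one[OF p] by simp
  finally show ?thesis by (simp add: gain_def)
qed

lemma gain_mono:
  assumes "1 \<le> y" "y \<le> x" shows "gain y \<le> gain x"
proof -
  define s where "s = 1 - 1 / y"
  have s: "0 \<le> s" "1 + s * y = y" using assms by (auto simp: s_def field_simps)
  have "gain y = ln (1 + s * y) - s" unfolding s(2) by (simp add: gain_def s_def)
  also have "\<dots> \<le> ln (1 + s * x) - s"
    using s assms mult_left_mono[of y x s] by (simp add: ln_mono)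
  also have "\<dots> \<le> gain x" using s assms by (intro gain_max) auto
  finally show ?thesis .
qed

lemma gain_1 [simp]: "gain 1 = 0" by (simp add: gain_def)

lemma gain_pos: "y > 1 \<Longrightarrow> 0 < gain y"
proof -
  assume y: "y > 1"
  have "ln (1 / y) \<noteq> 1 / y - 1" using ln_eq_minus_one[of "1 / y"] y by auto
  moreover have "ln (1 / y) \<le> 1 / y - 1" using y by (intro ln_le_minus_one) auto
  moreover have "ln (1 / y) = - ln y" using y by (simp add: ln_div)
  ultimately show ?thesis by (simp add: gain_def)
qed

text \<open>Concavity makes the bound uniform in \<open>\<theta>\<close>: the contribution of every observation but the largest is
  replaced by its tangent at \<open>\<theta> = 0\<close>, which leaves a linear term with slope at most
  \<open>- (1 - 2 * \<eta>) * b\<close> and one logarithm. The maximum over \<open>\<theta>\<close> is then \<open>gain_max\<close>.\<close>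

lemma loglik_upper:
  fixes h :: "nat \<Rightarrow> real"
  assumes h: "\<And>i. i < n \<Longrightarrow> 0 \<le> h i" and b: "0 < b" and e: "0 \<le> e" and \<eta>: "2 * \<eta> < 1" "1 \<le> \<eta> * b" and y: "1 \<le> y"
    and single: "\<And>i j. i < n \<Longrightarrow> j < n \<Longrightarrow> e < h i \<Longrightarrow> e < h j \<Longrightarrow> i = j"
    and D: "(\<Sum>i<n. min (h i) e - 1) \<le> - ((1 - \<eta>) * b)"
    and max: "\<And>i. i < n \<Longrightarrow> h i \<le> (1 - 2 * \<eta>) * b * y"
    and \<theta>: "0 \<le> \<theta>" "\<And>i. i < n \<Longrightarrow> 0 < 1 + \<theta> * (h i - 1)"
  shows "(\<Sum>i<n. ln (1 + \<theta> * (h i - 1))) \<le> gain y"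
proof -
  have "n \<noteq> 0"
  proof
    assume "n = 0"
    moreover have "0 < (1 - \<eta>) * b" using \<eta>(1) b by (intro mult_pos_pos) linarith+
    ultimately show False using D by simp
  qed
  then obtain j where j: "j < n" "\<And>i. i < n \<Longrightarrow> i \<noteq> j \<Longrightarrow> h i \<le> e"
    using single by (metis gr0I not_le)
  have split: "(\<Sum>i<n. f i) = f j + (\<Sum>i\<in>{..<n} - {j}. f i)" for f :: "nat \<Rightarrow> real"
    using j(1) by (simp add: sum.remove)
  have "(\<Sum>i\<in>{..<n} - {j}. ln (1 + \<theta> * (h i - 1))) \<le> (\<Sum>i\<in>{..<n} - {j}. \<theta> * (h i - 1))"
  proof (rule sum_mono)
    fix i assume "i \<in> {..<n} - {j}"
    then show "ln (1 + \<theta> * (h i - 1)) \<le> \<theta> * (h i - 1)" using ln_le_minus_one[OF \<theta>(2), of i] by simp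
  qed
  also have "\<dots> = \<theta> * (\<Sum>i\<in>{..<n} - {j}. min (h i) e - 1)"
    unfolding sum_distrib_left using j(2) by (intro sum.cong) auto
  also have "\<dots> \<le> \<theta> * (- ((1 - 2 * \<eta>) * b))"
  proof (intro mult_left_mono \<theta>(1))
    have "0 \<le> min (h j) e" using h j(1) e by auto
    moreover have "(1 - \<eta>) * b = b - \<eta> * b" "(1 - 2 * \<eta>) * b = b - 2 * (\<eta> * b)"
      by (simp_all add: algebra_simps)
    ultimately show "(\<Sum>i\<in>{..<n} - {j}. min (h i) e - 1) \<le> - ((1 - 2 * \<eta>) * b)"
      using D \<eta>(2) unfolding split[of "\<lambda>i. min (h i) e - 1"] by linarith
  qed
  finally have rest: "(\<Sum>i\<in>{..<n} - {j}. ln (1 + \<theta> * (h i - 1))) \<le> - (\<theta> * ((1 - 2 * \<eta>) * b))" by simp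
  \<comment> \<open>In the rescaled parameter \<open>r\<close> the bound takes the form of \<open>gain_max\<close>.\<close>
  define r where "r = \<theta> * ((1 - 2 * \<eta>) * b)"
  have r: "0 \<le> r" using \<theta>(1) \<eta>(1) b by (simp add: r_def)
  have "\<theta> * (h j - 1) \<le> \<theta> * ((1 - 2 * \<eta>) * b * y)"
    using max[OF j(1)] \<theta>(1) by (intro mult_left_mono) auto
  then have "ln (1 + \<theta> * (h j - 1)) \<le> ln (1 + r * y)"
    using \<theta>(2)[OF j(1)] by (intro ln_mono) (auto simp: r_def mult.assoc)
  then have "(\<Sum>i<n. ln (1 + \<theta> * (h i - 1))) \<le> ln (1 + r * y) - r"
    using rest unfolding split[of "\<lambda>i. ln (1 + \<theta> * (h i - 1))"] r_def by linarith
  also have "\<dots> \<le> gain y" using y r by (intro gain_max) auto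
  finally show ?thesis .
qed

text \<open>Evaluates the log-likelihood at the near-optimal parameter \<open>\<theta> = s / b\<close>. The observations other than
  the large one are at most \<open>\<epsilon> * b\<close>, so their arguments are small and the second-order expansion of
  the logarithm applies; its quadratic error is controlled by the sum of squares.\<close>

lemma loglik_lower:
  fixes h :: "nat \<Rightarrow> real"
  assumes h: "\<And>i. i < n \<Longrightarrow> 0 \<le> h i" and b: "2 \<le> b" and s: "0 \<le> s" "s \<le> 1"
    and \<epsilon>: "0 \<le> \<epsilon>" "\<epsilon> \<le> 1 / 2" and \<eta>: "0 \<le> \<eta>" and y: "1 \<le> y"
    and single: "\<And>i j. i < n \<Longrightarrow> j < n \<Longrightarrow> \<epsilon> * b < h i \<Longrightarrow> \<epsilon> * b < h j \<Longrightarrow> i = j"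
    and D: "- ((1 + \<eta>) * b) \<le> (\<Sum>i<n. min (h i) (\<epsilon> * b) - 1)"
    and sq: "(\<Sum>i<n. (min (h i) (\<epsilon> * b) - 1)\<^sup>2) \<le> \<eta> * b\<^sup>2"
    and j: "j < n" "y * b < h j"
  shows "ln (1 + s * y - s / b) - s - (3 * \<eta> + \<epsilon>) \<le> (\<Sum>i<n. ln (1 + s / b * (h i - 1)))"
proof -
  define \<theta> where "\<theta> = s / b"
  define u where "u i = min (h i) (\<epsilon> * b) - 1" for i
  have \<theta>: "0 \<le> \<theta>" "\<theta> * b = s" "\<theta> \<le> 1 / 2" using s b by (auto simp: \<theta>_def field_simps)
  have "\<epsilon> * b \<le> y * b" using \<epsilon> y b by (intro mult_right_mono) auto
  then have small: "h i \<le> \<epsilon> * b" if "i < n" "i \<noteq> j" for i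
    using single[OF that(1) j(1)] that j(2) by force
  have split: "(\<Sum>i<n. f i) = f j + (\<Sum>i\<in>{..<n} - {j}. f i)" for f :: "nat \<Rightarrow> real"
    using j(1) by (simp add: sum.remove)
  have uj: "u j \<le> \<epsilon> * b" by (simp add: u_def)
  have "\<theta> * (- ((1 + \<eta> + \<epsilon>) * b)) - 2 * \<theta>\<^sup>2 * (\<eta> * b\<^sup>2)
     \<le> \<theta> * (\<Sum>i\<in>{..<n} - {j}. u i) - 2 * \<theta>\<^sup>2 * (\<Sum>i\<in>{..<n} - {j}. (u i)\<^sup>2)"
  proof (intro diff_mono mult_left_mono)
    show "- ((1 + \<eta> + \<epsilon>) * b) \<le> (\<Sum>i\<in>{..<n} - {j}. u i)"
      using D uj unfolding u_def[symmetric] split[of u] by (simp add: algebra_simps)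
    show "(\<Sum>i\<in>{..<n} - {j}. (u i)\<^sup>2) \<le> \<eta> * b\<^sup>2"
      using sq zero_le_power2[of "u j"] unfolding u_def[symmetric] split[of "\<lambda>i. (u i)\<^sup>2"] by linarith
  qed (use \<theta> in auto)
  also have "\<dots> = (\<Sum>i\<in>{..<n} - {j}. \<theta> * u i - 2 * (\<theta> * u i)\<^sup>2)"
    by (simp add: sum_subtractf sum_distrib_left power_mult_distrib mult.assoc)
  also have "\<dots> \<le> (\<Sum>i\<in>{..<n} - {j}. ln (1 + \<theta> * (h i - 1)))"
  proof (rule sum_mono)
    fix i assume i: "i \<in> {..<n} - {j}"
    then have ui: "u i = h i - 1" using small[of i] by (auto simp: u_def)
    have "\<theta> * u i \<le> \<theta> * (\<epsilon> * b)" using \<theta> by (intro mult_left_mono) (auto simp: u_def)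
    also have "\<dots> = s * \<epsilon>" using \<theta>(2) by (simp add: algebra_simps)
    also have "\<dots> \<le> 1 * (1 / 2)" using s \<epsilon> by (intro mult_mono) auto
    finally have "\<theta> * u i \<le> 1 / 2" by simp
    moreover have "\<theta> * (- 1) \<le> \<theta> * u i" using h[of i] i \<theta>(1) unfolding ui by (intro mult_left_mono) auto
    ultimately have "\<bar>\<theta> * u i\<bar> \<le> 1 / 2" using \<theta>(3) by auto
    from abs_ln_one_plus_x_minus_x_bound[OF this]
    show "\<theta> * u i - 2 * (\<theta> * u i)\<^sup>2 \<le> ln (1 + \<theta> * (h i - 1))" unfolding ui by linarith
  qed
  finally have rest: "\<theta> * (- ((1 + \<eta> + \<epsilon>) * b)) - 2 * \<theta>\<^sup>2 * (\<eta> * b\<^sup>2) \<le> (\<Sum>i\<in>{..<n} - {j}. ln (1 + \<theta> * (h i - 1)))" .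
  have "\<theta> * (- ((1 + \<eta> + \<epsilon>) * b)) - 2 * \<theta>\<^sup>2 * (\<eta> * b\<^sup>2) = - (1 + \<eta> + \<epsilon>) * (\<theta> * b) - 2 * \<eta> * (\<theta> * b)\<^sup>2"
    by (simp add: algebra_simps power_mult_distrib)
  also have "\<dots> = - s - s * (\<eta> + \<epsilon>) - 2 * \<eta> * s\<^sup>2" unfolding \<theta>(2) by (simp add: algebra_simps)
  also have "\<dots> \<ge> - s - (3 * \<eta> + \<epsilon>)"
  proof -
    have "s * (\<eta> + \<epsilon>) \<le> 1 * (\<eta> + \<epsilon>)" using s \<eta> \<epsilon> by (intro mult_right_mono) auto
    moreover have "2 * \<eta> * s\<^sup>2 \<le> 2 * \<eta> * 1" using s \<eta> by (intro mult_left_mono) (auto simp: power_le_one)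
    ultimately show ?thesis by (simp add: algebra_simps)
  qed
  finally have rest': "- s - (3 * \<eta> + \<epsilon>) \<le> (\<Sum>i\<in>{..<n} - {j}. ln (1 + \<theta> * (h i - 1)))" using rest by linarith
  have "\<theta> * (y * b) \<le> \<theta> * h j" using j(2) \<theta>(1) by (intro mult_left_mono) auto
  moreover have "\<theta> * (y * b) = s * y" using \<theta>(2) by (simp add: algebra_simps)
  ultimately have "1 + s * y - s / b \<le> 1 + \<theta> * (h j - 1)" by (simp add: \<theta>_def algebra_simps)
  moreover have "0 < 1 + s * y - s / b"
  proof -
    have "0 \<le> s * y" "\<theta> \<le> 1 / 2" using s y \<theta> by auto
    then show ?thesis unfolding \<theta>_def[symmetric] by linarith
  qed
  ultimately have "ln (1 + s * y - s / b) \<le> ln (1 + \<theta> * (h j - 1))" by (intro ln_mono) auto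
  then show ?thesis using rest' unfolding \<theta>_def[symmetric] split[of "\<lambda>i. ln (1 + \<theta> * (h i - 1))"] by linarith
qed

section \<open>One big jump in an i.i.d. sample\<close>

text \<open>The observed density ratios under the null hypothesis. Nonnegativity is assumed at every sample
  point, so that the likelihood bounds hold without exceptional sets.\<close>

locale iid_heavy_sample = prob_space M + tail: unit_mean_cauchy_tail \<mu>
  for M :: "'a measure" and \<mu> :: "real measure" +
  fixes H :: "nat \<Rightarrow> 'a \<Rightarrow> real"
  assumes indep: "indep_vars (\<lambda>_. borel) H UNIV"
    and law: "\<And>i. distr M borel (H i) = \<mu>"
    and H_nonneg: "\<And>i \<omega>. \<omega> \<in> space M \<Longrightarrow> 0 \<le> H i \<omega>"
begin

lemma H_measurable [measurable]: "H i \<in> borel_measurable M"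
  using indep by (auto simp: indep_vars_def)

lemma integral_H:
  fixes f :: "real \<Rightarrow> real"
  assumes "f \<in> borel_measurable borel"
  shows "(\<integral>\<omega>. f (H i \<omega>) \<partial>M) = (\<integral>x. f x \<partial>\<mu>)"
  using assms by (subst law[of i, symmetric], subst integral_distr) auto

lemma prob_H: "prob {\<omega> \<in> space M. t < H i \<omega>} = tail.T t"
  unfolding tail.T_def
  by (subst law[of i, symmetric], subst measure_distr) (auto intro!: arg_cong[where f=prob])

lemma prob_pair:
  assumes "i \<noteq> j" shows "prob {\<omega> \<in> space M. t < H i \<omega> \<and> t < H j \<omega>} = tail.T t * tail.T t"
proof -
  have vim: "prob (H k -` {t<..} \<inter> space M) = tail.T t" for k
    unfolding prob_H[of t k, symmetric] by (rule arg_cong[where f=prob]) auto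
  have "prob (\<Inter>k\<in>{i, j}. H k -` {t<..} \<inter> space M) = (\<Prod>k\<in>{i, j}. prob (H k -` {t<..} \<inter> space M))"
    by (rule indep_varsD[OF indep]) auto
  also have "(\<Inter>k\<in>{i, j}. H k -` {t<..} \<inter> space M) = {\<omega> \<in> space M. t < H i \<omega> \<and> t < H j \<omega>}" by auto
  also have "(\<Prod>k\<in>{i, j}. prob (H k -` {t<..} \<inter> space M)) = (\<Prod>k\<in>{i, j}. tail.T t)"
    by (simp only: vim)
  finally show ?thesis using assms by simp
qed

lemma prob_two_large:
  "prob {\<omega> \<in> space M. \<exists>i<n. \<exists>j<n. i \<noteq> j \<and> t < H i \<omega> \<and> t < H j \<omega>} \<le> (real n * tail.T t)\<^sup>2"
proof -
  let ?I = "{..<n} \<times> {..<n}"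
  let ?A = "\<lambda>(i, j). {\<omega> \<in> space M. i \<noteq> j \<and> t < H i \<omega> \<and> t < H j \<omega>}"
  have "{\<omega> \<in> space M. \<exists>i<n. \<exists>j<n. i \<noteq> j \<and> t < H i \<omega> \<and> t < H j \<omega>} = (\<Union>p\<in>?I. ?A p)" by auto
  then have "prob {\<omega> \<in> space M. \<exists>i<n. \<exists>j<n. i \<noteq> j \<and> t < H i \<omega> \<and> t < H j \<omega>} \<le> (\<Sum>p\<in>?I. prob (?A p))"
    by (simp only:) (rule finite_measure_subadditive_finite, auto)
  also have "\<dots> \<le> (\<Sum>p\<in>?I. tail.T t * tail.T t)"
  proof (rule sum_mono)
    fix p :: "nat \<times> nat"
    obtain i j where p: "p = (i, j)" by force
    show "prob (?A p) \<le> tail.T t * tail.T t"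
      using prob_pair[of i j t] tail.T_pos[of t] by (cases "i = j") (auto simp: p)
  qed
  also have "\<dots> = (real n * tail.T t)\<^sup>2" by (simp add: power2_eq_square algebra_simps)
  finally show ?thesis .
qed

text \<open>The lower bound is Bonferroni's inequality with pair probabilities bounded by independence.\<close>

lemma prob_some_large:
  shows "prob {\<omega> \<in> space M. \<exists>i<n. t < H i \<omega>} \<le> real n * tail.T t"
    and "real n * tail.T t - (real n * tail.T t)\<^sup>2 \<le> prob {\<omega> \<in> space M. \<exists>i<n. t < H i \<omega>}"
proof -
  let ?A = "\<lambda>i. {\<omega> \<in> space M. t < H i \<omega>}"
  have U: "{\<omega> \<in> space M. \<exists>i<n. t < H i \<omega>} = (\<Union>i\<in>{..<n}. ?A i)" by auto
  have "prob (\<Union>i\<in>{..<n}. ?A i) \<le> (\<Sum>i<n. prob (?A i))"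
    by (rule finite_measure_subadditive_finite) auto
  then show "prob {\<omega> \<in> space M. \<exists>i<n. t < H i \<omega>} \<le> real n * tail.T t" by (simp add: U prob_H)
  have "real n * tail.T t - (real n * tail.T t)\<^sup>2 \<le> prob (\<Union>i\<in>{..<n}. ?A i)"
  proof (induction n)
    case (Suc n)
    have "prob (?A n \<inter> (\<Union>i\<in>{..<n}. ?A i)) = prob (\<Union>i\<in>{..<n}. ?A n \<inter> ?A i)"
      by (rule arg_cong[where f=prob]) auto
    also have "\<dots> \<le> (\<Sum>i<n. prob (?A n \<inter> ?A i))"
      by (rule finite_measure_subadditive_finite) auto
    also have "\<dots> = (\<Sum>i<n. tail.T t * tail.T t)"
    proof (rule sum.cong)
      fix i assume "i \<in> {..<n}"
      moreover have "?A n \<inter> ?A i = {\<omega> \<in> space M. t < H n \<omega> \<and> t < H i \<omega>}" by auto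
      ultimately show "prob (?A n \<inter> ?A i) = tail.T t * tail.T t" using prob_pair[of n i t] by auto
    qed simp
    finally have "prob (?A n \<inter> (\<Union>i\<in>{..<n}. ?A i)) \<le> real n * (tail.T t)\<^sup>2" by (simp add: power2_eq_square)
    moreover have "prob (?A n \<union> (\<Union>i\<in>{..<n}. ?A i)) = prob (?A n) + prob (\<Union>i\<in>{..<n}. ?A i) - prob (?A n \<inter> (\<Union>i\<in>{..<n}. ?A i))"
      by (rule measure_Un3) (auto simp: fmeasurable_eq_sets)
    moreover have "(\<Union>i\<in>{..<Suc n}. ?A i) = ?A n \<union> (\<Union>i\<in>{..<n}. ?A i)" by (auto simp: less_Suc_eq)
    moreover have "(real (Suc n) * tail.T t)\<^sup>2 = (real n * tail.T t)\<^sup>2 + 2 * (real n * (tail.T t)\<^sup>2) + (tail.T t)\<^sup>2"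
      by (simp add: power2_eq_square algebra_simps)
    moreover have "real (Suc n) * tail.T t = real n * tail.T t + tail.T t" by (simp add: algebra_simps)
    moreover have "0 \<le> real n * (tail.T t)\<^sup>2" "0 \<le> (tail.T t)\<^sup>2" by auto
    ultimately show ?case using Suc prob_H[of t n] by (simp only:)
  qed simp
  then show "real n * tail.T t - (real n * tail.T t)\<^sup>2 \<le> prob {\<omega> \<in> space M. \<exists>i<n. t < H i \<omega>}" by (simp add: U)
qed

text \<open>Only truncated sums have a variance; \<open>dev\<close> and \<open>dev2\<close> are the first-order and second-order terms of
  the log-likelihood of the observations truncated at \<open>e\<close>.\<close>

definition dev :: "real \<Rightarrow> nat \<Rightarrow> 'a \<Rightarrow> real" where "dev e n \<omega> = (\<Sum>i<n. min (H i \<omega>) e - 1)"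
definition dev2 :: "real \<Rightarrow> nat \<Rightarrow> 'a \<Rightarrow> real" where "dev2 e n \<omega> = (\<Sum>i<n. (min (H i \<omega>) e - 1)\<^sup>2)"

lemma dev_measurable [measurable]: "dev e n \<in> borel_measurable M" "dev2 e n \<in> borel_measurable M"
  unfolding dev_def[abs_def] dev2_def[abs_def] by measurable

text \<open>The second moment about one, rather than about the mean, is bounded by the plain second moment because
  the truncated mean \<open>1 - excess e\<close> is at least one half.\<close>

lemma truncated_moments:
  assumes e: "0 \<le> e" "tail.excess e \<le> 1 / 2"
  shows "integrable M (\<lambda>\<omega>. (min (H i \<omega>) e - 1)\<^sup>2)" "(\<integral>\<omega>. (min (H i \<omega>) e - 1)\<^sup>2 \<partial>M) \<le> tail.trunc2 e"
    "integrable M (\<lambda>\<omega>. min (H i \<omega>) e)" "(\<integral>\<omega>. min (H i \<omega>) e - 1 \<partial>M) = - tail.excess e"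
proof -
  show int: "integrable M (\<lambda>\<omega>. min (H i \<omega>) e)"
    using e H_nonneg by (intro integrable_const_bound[of _ e]) auto
  have "(min x e)\<^sup>2 \<le> e\<^sup>2" if "0 \<le> x" for x using that e by (intro power_mono) auto
  then have int2: "integrable M (\<lambda>\<omega>. (min (H i \<omega>) e)\<^sup>2)"
    using H_nonneg by (intro integrable_const_bound[of _ "e\<^sup>2"]) auto
  have sq: "(x - 1)\<^sup>2 = x\<^sup>2 - 2 * x + 1" for x :: real by (simp add: power2_eq_square algebra_simps)
  show "integrable M (\<lambda>\<omega>. (min (H i \<omega>) e - 1)\<^sup>2)" unfolding sq using int int2 by simp
  have m: "(\<integral>\<omega>. min (H i \<omega>) e \<partial>M) = 1 - tail.excess e"
    using integral_H[of "\<lambda>x. min x e" i] tail.trunc_mean[OF e(1)] by simp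
  then show "(\<integral>\<omega>. min (H i \<omega>) e - 1 \<partial>M) = - tail.excess e" using int by (simp add: prob_space)
  have "(\<integral>\<omega>. (min (H i \<omega>) e - 1)\<^sup>2 \<partial>M) = (\<integral>\<omega>. (min (H i \<omega>) e)\<^sup>2 \<partial>M) - 2 * (1 - tail.excess e) + 1"
    unfolding sq using int int2 m by (simp add: prob_space)
  also have "(\<integral>\<omega>. (min (H i \<omega>) e)\<^sup>2 \<partial>M) = tail.trunc2 e"
    unfolding tail.trunc2_def by (rule integral_H) simp
  finally show "(\<integral>\<omega>. (min (H i \<omega>) e - 1)\<^sup>2 \<partial>M) \<le> tail.trunc2 e" using e by simp
qed

lemma prob_dev2:
  assumes e: "0 \<le> e" "tail.excess e \<le> 1 / 2" and a: "0 < a"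
  shows "prob {\<omega> \<in> space M. a \<le> dev2 e n \<omega>} \<le> real n * tail.trunc2 e / a"
proof -
  have "prob {\<omega> \<in> space M. a \<le> dev2 e n \<omega>} \<le> (\<integral>\<omega>. dev2 e n \<omega> \<partial>M) / a"
    unfolding dev2_def using a truncated_moments(1)[OF e]
    by (intro integral_Markov_inequality_measure[where A="{}"]) (auto intro!: AE_I2 sum_nonneg)
  also have "(\<integral>\<omega>. dev2 e n \<omega> \<partial>M) = (\<Sum>i<n. \<integral>\<omega>. (min (H i \<omega>) e - 1)\<^sup>2 \<partial>M)"
    unfolding dev2_def using truncated_moments(1)[OF e] by (intro Bochner_Integration.integral_sum)
  also have "\<dots> \<le> (\<Sum>i<n. tail.trunc2 e)" using truncated_moments(2)[OF e] by (intro sum_mono)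
  finally show ?thesis using a by (simp add: divide_right_mono)
qed

text \<open>Chebyshev's inequality; the cross terms of the square vanish by independence.\<close>

lemma prob_dev:
  assumes e: "0 \<le> e" "tail.excess e \<le> 1 / 2" and a: "0 < a"
  shows "prob {\<omega> \<in> space M. a \<le> \<bar>dev e n \<omega> + real n * tail.excess e\<bar>} \<le> real n * tail.trunc2 e / a\<^sup>2"
proof -
  define Z where "Z i \<omega> = min (H i \<omega>) e - 1 + tail.excess e" for i \<omega>
  have Zint: "integrable M (Z i)" for i unfolding Z_def[abs_def] using truncated_moments(3)[OF e] by simp
  have Z0: "(\<integral>\<omega>. Z i \<omega> \<partial>M) = 0" for i
    using truncated_moments(3,4)[OF e, of i] by (simp add: Z_def prob_space)
  have Zb: "\<bar>Z i \<omega>\<bar> \<le> e + 1 + tail.excess e" if "\<omega> \<in> space M" for i \<omega>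
    using H_nonneg[OF that, of i] e tail.excess_nonneg[of e] by (auto simp: Z_def min_def)
  have ZZ: "integrable M (\<lambda>\<omega>. Z i \<omega> * Z j \<omega>)" for i j
  proof (rule integrable_const_bound)
    show "AE \<omega> in M. norm (Z i \<omega> * Z j \<omega>) \<le> (e + 1 + tail.excess e) * (e + 1 + tail.excess e)"
      using Zb by (auto intro!: AE_I2 mult_mono order_trans[OF _ Zb] simp: abs_mult)
  qed (simp add: Z_def)
  have indepZ: "indep_vars (\<lambda>_. borel) Z UNIV"
    unfolding Z_def[abs_def] by (rule indep_vars_compose2[OF indep, of "\<lambda>_ x. min x e - 1 + tail.excess e"]) simp
  have cross: "(\<integral>\<omega>. Z i \<omega> * Z j \<omega> \<partial>M) \<le> (if i = j then tail.trunc2 e else 0)" for i j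
  proof (cases "i = j")
    case True
    have "(\<integral>\<omega>. Z i \<omega> * Z i \<omega> \<partial>M) = (\<integral>\<omega>. (min (H i \<omega>) e - 1)\<^sup>2 + 2 * tail.excess e * (min (H i \<omega>) e - 1) + (tail.excess e)\<^sup>2 \<partial>M)"
      by (rule Bochner_Integration.integral_cong) (auto simp: Z_def power2_eq_square algebra_simps)
    also have "\<dots> = (\<integral>\<omega>. (min (H i \<omega>) e - 1)\<^sup>2 \<partial>M) + 2 * tail.excess e * (\<integral>\<omega>. min (H i \<omega>) e - 1 \<partial>M) + (tail.excess e)\<^sup>2"
      using truncated_moments(1,3)[OF e, of i] by (simp add: prob_space)
    also have "\<dots> = (\<integral>\<omega>. (min (H i \<omega>) e - 1)\<^sup>2 \<partial>M) - (tail.excess e)\<^sup>2"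
      using truncated_moments(4)[OF e, of i] by (simp add: power2_eq_square)
    also have "\<dots> \<le> tail.trunc2 e" using truncated_moments(2)[OF e, of i] zero_le_power2[of "tail.excess e"] by linarith
    finally show ?thesis using True by simp
  next
    case False
    have "(\<integral>\<omega>. (\<Prod>k\<in>{i, j}. Z k \<omega>) \<partial>M) = (\<Prod>k\<in>{i, j}. \<integral>\<omega>. Z k \<omega> \<partial>M)"
      using indep_vars_subset[OF indepZ, of "{i, j}"] Zint by (intro indep_vars_lebesgue_integral) auto
    then show ?thesis using False by (simp add: Z0)
  qed
  have eq: "dev e n \<omega> + real n * tail.excess e = (\<Sum>i<n. Z i \<omega>)" for \<omega>
    by (simp add: dev_def Z_def sum.distrib sum_subtractf)
  have sq: "(\<Sum>i<n. Z i \<omega>)\<^sup>2 = (\<Sum>i<n. \<Sum>j<n. Z i \<omega> * Z j \<omega>)" for \<omega>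
    by (simp add: power2_eq_square sum_product)
  have "{\<omega> \<in> space M. a \<le> \<bar>dev e n \<omega> + real n * tail.excess e\<bar>} = {\<omega> \<in> space M. a\<^sup>2 \<le> (\<Sum>i<n. Z i \<omega>)\<^sup>2}"
    unfolding eq using a abs_le_square_iff[of a] by auto
  also have "prob \<dots> \<le> (\<integral>\<omega>. (\<Sum>i<n. Z i \<omega>)\<^sup>2 \<partial>M) / a\<^sup>2"
  proof (rule integral_Markov_inequality_measure[where A="{}"])
    show "integrable M (\<lambda>\<omega>. (\<Sum>i<n. Z i \<omega>)\<^sup>2)" unfolding sq using ZZ by auto
  qed (use a in auto)
  also have "(\<integral>\<omega>. (\<Sum>i<n. Z i \<omega>)\<^sup>2 \<partial>M) = (\<Sum>i<n. \<Sum>j<n. \<integral>\<omega>. Z i \<omega> * Z j \<omega> \<partial>M)"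
    unfolding sq using ZZ by (simp add: Bochner_Integration.integral_sum Bochner_Integration.integrable_sum)
  also have "\<dots> \<le> (\<Sum>i<n. \<Sum>j<n. if i = j then tail.trunc2 e else 0)"
    by (intro sum_mono cross)
  also have "\<dots> = real n * tail.trunc2 e" by simp
  finally show ?thesis using a by (simp add: divide_right_mono)
qed

end

section \<open>Asymptotics of the likelihood ratio\<close>

text \<open>Here \<open>S n\<close> stands for half the likelihood-ratio statistic. Apart from measurability, two facts about
  the maximum are recorded: the statistic is the value of the log-likelihood at some admissible
  parameter, and it is at least the value at every parameter below one, where all arguments are
  automatically positive.\<close>

locale iid_likelihood_ratio = iid_heavy_sample M \<mu> H
  for M :: "'a measure" and \<mu> :: "real measure" and H :: "nat \<Rightarrow> 'a \<Rightarrow> real" +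
  fixes S :: "nat \<Rightarrow> 'a \<Rightarrow> real" and b :: "nat \<Rightarrow> real"
  assumes S_measurable: "\<And>n. n \<ge> 1 \<Longrightarrow> S n \<in> borel_measurable M"
    and S_attained: "\<And>n \<omega>. n \<ge> 1 \<Longrightarrow> \<omega> \<in> space M \<Longrightarrow>
      \<exists>\<theta>\<ge>0. (\<forall>i<n. 0 < 1 + \<theta> * (H i \<omega> - 1)) \<and> S n \<omega> = (\<Sum>i<n. ln (1 + \<theta> * (H i \<omega> - 1)))"
    and S_ge: "\<And>n \<omega> \<theta>. n \<ge> 1 \<Longrightarrow> \<omega> \<in> space M \<Longrightarrow> 0 \<le> \<theta> \<Longrightarrow> \<theta> < 1 \<Longrightarrow>
      (\<Sum>i<n. ln (1 + \<theta> * (H i \<omega> - 1))) \<le> S n \<omega>"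
    and b_nonneg: "\<And>n. 0 \<le> b n" and b_eq: "\<And>n. real n * tail.excess (b n) = b n"
    and b_top: "filterlim b at_top sequentially"
begin

text \<open>Asymptotically the probability that the statistic is positive. Every error below is compared with
  this vanishing quantity.\<close>

definition jump_rate :: "nat \<Rightarrow> real" where "jump_rate n = real n * tail.T (b n)"

lemma jump_rate_pos: "n \<ge> 1 \<Longrightarrow> 0 < jump_rate n"
  by (simp add: jump_rate_def tail.T_pos)

lemma jump_rate_tendsto_0: "jump_rate \<longlonglongrightarrow> 0"
proof -
  have "b n * tail.T (b n) / tail.excess (b n) = jump_rate n" for n
    using b_eq[of n] tail.excess_pos[of "b n"] by (simp add: jump_rate_def field_simps)
  with filterlim_compose[OF tail.tail_negligible b_top] show ?thesis by simp
qed

lemma tail_over_jump_rate: "x > 0 \<Longrightarrow> (\<lambda>n. real n * tail.T (x * b n) / jump_rate n) \<longlonglongrightarrow> 1 / x"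
proof -
  assume "x > 0"
  from filterlim_compose[OF tail.T_ratio[OF this] b_top]
  have "(\<lambda>n. tail.T (x * b n) / tail.T (b n)) \<longlonglongrightarrow> 1 / x" .
  then show ?thesis
  proof (rule Lim_transform_eventually)
    show "\<forall>\<^sub>F n in sequentially. tail.T (x * b n) / tail.T (b n) = real n * tail.T (x * b n) / jump_rate n"
      using eventually_gt_at_top[of 0] by eventually_elim (simp add: jump_rate_def)
  qed
qed

lemma tail_square_over_jump_rate: "x > 0 \<Longrightarrow> (\<lambda>n. (real n * tail.T (x * b n))\<^sup>2 / jump_rate n) \<longlonglongrightarrow> 0"
proof -
  assume x: "x > 0"
  have "(\<lambda>n. jump_rate n * (real n * tail.T (x * b n) / jump_rate n) * (real n * tail.T (x * b n) / jump_rate n)) \<longlonglongrightarrow> 0 * (1 / x) * (1 / x)"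
    by (intro tendsto_mult jump_rate_tendsto_0 tail_over_jump_rate x)
  then have "(\<lambda>n. jump_rate n * (real n * tail.T (x * b n) / jump_rate n) * (real n * tail.T (x * b n) / jump_rate n)) \<longlonglongrightarrow> 0" by simp
  then show ?thesis
  proof (rule Lim_transform_eventually)
    show "\<forall>\<^sub>F n in sequentially. jump_rate n * (real n * tail.T (x * b n) / jump_rate n) * (real n * tail.T (x * b n) / jump_rate n)
        = (real n * tail.T (x * b n))\<^sup>2 / jump_rate n"
      using eventually_ge_at_top[of 1]
    proof eventually_elim
      case (elim n)
      then show ?case using jump_rate_pos[of n] by (simp add: power2_eq_square)
    qed
  qed
qed

lemma b_ev: "\<forall>\<^sub>F n in sequentially. Z < b n"
  using b_top by (simp add: filterlim_at_top_dense)

text \<open>The truncated sum has mean \<open>- n * excess (x * b n)\<close>, which for every fixed \<open>x\<close> is asymptotically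
  \<open>- b n\<close>, because the excess varies slowly.\<close>

lemma centring: 
  assumes "x > 0" "\<eta> > 0" shows "\<forall>\<^sub>F n in sequentially. \<bar>real n * tail.excess (x * b n) - b n\<bar> \<le> \<eta> * b n"
proof -
  have "(\<lambda>n. tail.excess (x * b n) / tail.excess (b n)) \<longlonglongrightarrow> 1"
    using filterlim_compose[OF tail.excess_slowly_varying[OF assms(1)] b_top] .
  then have "\<forall>\<^sub>F n in sequentially. \<bar>tail.excess (x * b n) / tail.excess (b n) - 1\<bar> < \<eta>"
    using assms(2) by (auto dest!: tendstoD simp: dist_real_def)
  then show ?thesis
    using eventually_ge_at_top[of 1]
  proof eventually_elim
    case (elim n)
    have e: "tail.excess (b n) > 0" by (rule tail.excess_pos)
    have "real n * tail.excess (x * b n) = b n * (tail.excess (x * b n) / tail.excess (b n))"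
      using e b_eq[of n] by (simp add: field_simps)
    then have "\<bar>real n * tail.excess (x * b n) - b n\<bar> = b n * \<bar>tail.excess (x * b n) / tail.excess (b n) - 1\<bar>"
      using b_nonneg[of n] abs_mult[of "b n" "tail.excess (x * b n) / tail.excess (b n) - 1"] by (simp add: algebra_simps)
    also have "\<dots> \<le> b n * \<eta>" using elim b_nonneg by (intro mult_left_mono) auto
    finally show ?case by (simp add: mult.commute)
  qed
qed

text \<open>The complement is the event on which the deterministic bounds \<open>loglik_upper\<close> and \<open>loglik_lower\<close>
  apply.\<close>

definition atypical :: "real \<Rightarrow> real \<Rightarrow> nat \<Rightarrow> 'a set" where
  "atypical \<epsilon> \<eta> n =
     {\<omega> \<in> space M. \<exists>i<n. \<exists>j<n. i \<noteq> j \<and> \<epsilon> * b n < H i \<omega> \<and> \<epsilon> * b n < H j \<omega>} \<union>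
     {\<omega> \<in> space M. \<eta> / 2 * b n \<le> \<bar>dev (\<epsilon> * b n) n \<omega> + real n * tail.excess (\<epsilon> * b n)\<bar>} \<union>
     {\<omega> \<in> space M. \<eta> * (b n)\<^sup>2 \<le> dev2 (\<epsilon> * b n) n \<omega>}"

lemma atypical_measurable [measurable]: "atypical \<epsilon> \<eta> n \<in> sets M"
  unfolding atypical_def by measurable

text \<open>The crucial point is the factor \<open>\<epsilon>\<close>: truncating at \<open>\<epsilon> * b n\<close> bounds the variance by a multiple of
  \<open>n * (\<epsilon> * b n)\<^sup>2 * T (\<epsilon> * b n)\<close>, that is of \<open>\<epsilon> * (b n)\<^sup>2\<close> times the jump rate. So although
  Chebyshev's inequality only yields a bound of the order of the jump rate, the constant can be made
  arbitrarily small.\<close>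

lemma prob_atypical:
  obtains K where "K > 0" "\<And>\<epsilon> \<eta>. 0 < \<epsilon> \<Longrightarrow> 0 < \<eta> \<Longrightarrow> \<eta> \<le> 1 \<Longrightarrow>
    \<forall>\<^sub>F n in sequentially. prob (atypical \<epsilon> \<eta> n) \<le> \<epsilon> * (K / \<eta>\<^sup>2) * jump_rate n"
proof -
  obtain C where C: "C > 0" and trunc: "\<forall>\<^sub>F x in at_top. tail.trunc2 x \<le> C * (x\<^sup>2 * tail.T x)"
    by (rule tail.trunc2_bound)
  show ?thesis
  proof (rule that[of "1 + 10 * C"])
    show "1 + 10 * C > 0" using C by simp
    fix \<epsilon> \<eta> :: real assume \<epsilon>: "0 < \<epsilon>" and \<eta>: "0 < \<eta>" "\<eta> \<le> 1"
    have top: "filterlim (\<lambda>n. \<epsilon> * b n) at_top sequentially"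
      by (rule filterlim_tendsto_pos_mult_at_top[OF tendsto_const \<epsilon> b_top])
    have "\<forall>\<^sub>F n in sequentially. tail.trunc2 (\<epsilon> * b n) \<le> C * ((\<epsilon> * b n)\<^sup>2 * tail.T (\<epsilon> * b n))"
      using eventually_compose_filterlim[OF trunc top] .
    moreover have "\<forall>\<^sub>F n in sequentially. tail.excess (\<epsilon> * b n) < 1 / 2"
      using filterlim_compose[OF tail.excess_tendsto_0 top] by (rule order_tendstoD(2)) simp
    moreover have "\<forall>\<^sub>F n in sequentially. real n * tail.T (\<epsilon> * b n) / jump_rate n < 2 / \<epsilon>"
      by (rule order_tendstoD(2)[OF tail_over_jump_rate[OF \<epsilon>]]) (use \<epsilon> in \<open>simp add: divide_strict_right_mono\<close>)
    moreover have "\<forall>\<^sub>F n in sequentially. (real n * tail.T (\<epsilon> * b n))\<^sup>2 / jump_rate n < \<epsilon>"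
      using tail_square_over_jump_rate[OF \<epsilon>] \<epsilon> by (rule order_tendstoD(2))
    ultimately show "\<forall>\<^sub>F n in sequentially. prob (atypical \<epsilon> \<eta> n) \<le> \<epsilon> * ((1 + 10 * C) / \<eta>\<^sup>2) * jump_rate n"
      using b_ev[of 0] eventually_ge_at_top[of 1]
    proof eventually_elim
      case (elim n)
      have pn: "jump_rate n > 0" using elim by (intro jump_rate_pos)
      have bn: "b n > 0" using elim by simp
      let ?e = "\<epsilon> * b n"
      have e: "0 \<le> ?e" "tail.excess ?e \<le> 1 / 2" using \<epsilon> bn elim by auto
      have "real n * tail.T ?e \<le> 2 / \<epsilon> * jump_rate n" using elim(3) pn by (simp add: pos_divide_less_eq)
      then have "C * \<epsilon>\<^sup>2 * (b n)\<^sup>2 * (real n * tail.T ?e) \<le> C * \<epsilon>\<^sup>2 * (b n)\<^sup>2 * (2 / \<epsilon> * jump_rate n)"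
        using C by (intro mult_left_mono) auto
      also have "\<dots> = 2 * C * \<epsilon> * (b n)\<^sup>2 * jump_rate n" using \<epsilon> by (simp add: power2_eq_square)
      finally have "C * \<epsilon>\<^sup>2 * (b n)\<^sup>2 * (real n * tail.T ?e) \<le> 2 * C * \<epsilon> * (b n)\<^sup>2 * jump_rate n" .
      moreover have "real n * tail.trunc2 ?e \<le> real n * (C * (?e\<^sup>2 * tail.T ?e))"
        using elim(1) by (intro mult_left_mono) auto
      moreover have "real n * (C * (?e\<^sup>2 * tail.T ?e)) = C * \<epsilon>\<^sup>2 * (b n)\<^sup>2 * (real n * tail.T ?e)"
        by (simp add: power_mult_distrib)
      ultimately have nV: "real n * tail.trunc2 ?e \<le> 2 * C * \<epsilon> * (b n)\<^sup>2 * jump_rate n" by linarith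
      have ep: "0 \<le> \<epsilon> * jump_rate n" using \<epsilon> pn by simp
      have \<eta>2: "1 \<le> 1 / \<eta>\<^sup>2" "1 / \<eta> \<le> 1 / \<eta>\<^sup>2"
        using \<eta> by (auto simp: power2_eq_square field_simps mult_le_one)
      have "prob {\<omega> \<in> space M. \<exists>i<n. \<exists>j<n. i \<noteq> j \<and> ?e < H i \<omega> \<and> ?e < H j \<omega>} \<le> (real n * tail.T ?e)\<^sup>2"
        by (rule prob_two_large)
      also have "\<dots> \<le> \<epsilon> * jump_rate n * 1" using elim(4) pn by (simp add: pos_divide_less_eq)
      also have "\<dots> \<le> \<epsilon> * jump_rate n * (1 / \<eta>\<^sup>2)" by (intro mult_left_mono \<eta>2 ep)
      finally have 1: "prob {\<omega> \<in> space M. \<exists>i<n. \<exists>j<n. i \<noteq> j \<and> ?e < H i \<omega> \<and> ?e < H j \<omega>} \<le> \<epsilon> * jump_rate n * (1 / \<eta>\<^sup>2)" .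
      have "prob {\<omega> \<in> space M. \<eta> / 2 * b n \<le> \<bar>dev ?e n \<omega> + real n * tail.excess ?e\<bar>} \<le> real n * tail.trunc2 ?e / (\<eta> / 2 * b n)\<^sup>2"
        using \<eta> bn by (intro prob_dev e) auto
      also have "\<dots> \<le> 2 * C * \<epsilon> * (b n)\<^sup>2 * jump_rate n / (\<eta> / 2 * b n)\<^sup>2"
        by (intro divide_right_mono nV) auto
      also have "\<dots> = 8 * C * (\<epsilon> * jump_rate n * (1 / \<eta>\<^sup>2))" using bn by (simp add: power_mult_distrib power_divide)
      finally have 2: "prob {\<omega> \<in> space M. \<eta> / 2 * b n \<le> \<bar>dev ?e n \<omega> + real n * tail.excess ?e\<bar>} \<le> 8 * C * (\<epsilon> * jump_rate n * (1 / \<eta>\<^sup>2))" .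
      have "prob {\<omega> \<in> space M. \<eta> * (b n)\<^sup>2 \<le> dev2 ?e n \<omega>} \<le> real n * tail.trunc2 ?e / (\<eta> * (b n)\<^sup>2)"
        using \<eta> bn by (intro prob_dev2 e) auto
      also have "\<dots> \<le> 2 * C * \<epsilon> * (b n)\<^sup>2 * jump_rate n / (\<eta> * (b n)\<^sup>2)"
        using \<eta> by (intro divide_right_mono nV) auto
      also have "\<dots> = 2 * C * (\<epsilon> * jump_rate n * (1 / \<eta>))" using bn by simp
      also have "\<dots> \<le> 2 * C * (\<epsilon> * jump_rate n * (1 / \<eta>\<^sup>2))" using C by (intro mult_left_mono \<eta>2 ep) auto
      finally have 3: "prob {\<omega> \<in> space M. \<eta> * (b n)\<^sup>2 \<le> dev2 ?e n \<omega>} \<le> 2 * C * (\<epsilon> * jump_rate n * (1 / \<eta>\<^sup>2))" .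
      have "prob (A \<union> B \<union> D) \<le> prob A + prob B + prob D" if "A \<in> events" "B \<in> events" "D \<in> events" for A B D
        using measure_Un_le[of "A \<union> B" M D] measure_Un_le[of A M B] that by auto
      then have "prob (atypical \<epsilon> \<eta> n) \<le> \<epsilon> * jump_rate n * (1 / \<eta>\<^sup>2) + 8 * C * (\<epsilon> * jump_rate n * (1 / \<eta>\<^sup>2)) + 2 * C * (\<epsilon> * jump_rate n * (1 / \<eta>\<^sup>2))"
        unfolding atypical_def by (rule order_trans) (use 1 2 3 in auto)
      also have "\<dots> = \<epsilon> * ((1 + 10 * C) / \<eta>\<^sup>2) * jump_rate n" by (simp add: add_divide_distrib algebra_simps)
      finally show ?case .
    qed
  qed
qed

lemma typical:
  assumes "\<omega> \<in> space M" "\<omega> \<notin> atypical \<epsilon> \<eta> n" "\<bar>real n * tail.excess (\<epsilon> * b n) - b n\<bar> \<le> \<eta> / 2 * b n"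
  shows "\<And>i j. i < n \<Longrightarrow> j < n \<Longrightarrow> \<epsilon> * b n < H i \<omega> \<Longrightarrow> \<epsilon> * b n < H j \<omega> \<Longrightarrow> i = j"
    and "(\<Sum>i<n. min (H i \<omega>) (\<epsilon> * b n) - 1) \<le> - ((1 - \<eta>) * b n)"
    and "- ((1 + \<eta>) * b n) \<le> (\<Sum>i<n. min (H i \<omega>) (\<epsilon> * b n) - 1)"
    and "(\<Sum>i<n. (min (H i \<omega>) (\<epsilon> * b n) - 1)\<^sup>2) \<le> \<eta> * (b n)\<^sup>2"
proof -
  have d: "\<bar>dev (\<epsilon> * b n) n \<omega> + real n * tail.excess (\<epsilon> * b n)\<bar> < \<eta> / 2 * b n"
    using assms(1,2) by (auto simp: atypical_def not_le)
  have centre: "v \<le> - (B - 2 * c) \<and> - (B + 2 * c) \<le> v" if "\<bar>v + m\<bar> < c" "\<bar>m - B\<bar> \<le> c" for v m c B :: real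
    using that by linarith
  have "(1 - \<eta>) * b n = b n - 2 * (\<eta> / 2 * b n)" "(1 + \<eta>) * b n = b n + 2 * (\<eta> / 2 * b n)"
    by (simp_all add: algebra_simps)
  then show "(\<Sum>i<n. min (H i \<omega>) (\<epsilon> * b n) - 1) \<le> - ((1 - \<eta>) * b n)"
    "- ((1 + \<eta>) * b n) \<le> (\<Sum>i<n. min (H i \<omega>) (\<epsilon> * b n) - 1)"
    using centre[OF d assms(3)] by (simp_all only: dev_def)
  show "(\<Sum>i<n. (min (H i \<omega>) (\<epsilon> * b n) - 1)\<^sup>2) \<le> \<eta> * (b n)\<^sup>2"
    using assms(1,2) by (auto simp: atypical_def dev2_def)
  show "i = j" if "i < n" "j < n" "\<epsilon> * b n < H i \<omega>" "\<epsilon> * b n < H j \<omega>" for i j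
    using assms(1,2) that by (auto simp: atypical_def)
qed

lemma S_event_measurable: "n \<ge> 1 \<Longrightarrow> {\<omega> \<in> space M. z < S n \<omega>} \<in> events"
  using S_measurable[of n] by measurable

text \<open>On typical samples without an observation above \<open>(1 - 2 * \<eta>) * y * b n\<close> the statistic is at most
  \<open>gain y\<close>.\<close>

lemma prob_S_upper:
  assumes y: "1 \<le> y" and \<delta>: "0 < \<delta>"
  shows "\<forall>\<^sub>F n in sequentially. prob {\<omega> \<in> space M. gain y < S n \<omega>} \<le> (1 / y + \<delta>) * jump_rate n"
proof -
  obtain K where K: "K > 0" and atyp: "\<And>\<epsilon> \<eta>. 0 < \<epsilon> \<Longrightarrow> 0 < \<eta> \<Longrightarrow> \<eta> \<le> 1 \<Longrightarrow>
    \<forall>\<^sub>F n in sequentially. prob (atypical \<epsilon> \<eta> n) \<le> \<epsilon> * (K / \<eta>\<^sup>2) * jump_rate n"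
    by (rule prob_atypical) blast
  have "((\<lambda>\<eta>. 1 / ((1 - 2 * \<eta>) * y)) \<longlongrightarrow> 1 / ((1 - 2 * 0) * y)) (at_right 0)"
    using y by (intro tendsto_intros) auto
  then have "\<forall>\<^sub>F \<eta> in at_right 0. 1 / ((1 - 2 * \<eta>) * y) < 1 / y + \<delta> / 2"
    using \<delta> by (intro order_tendstoD(2)) auto
  moreover have "\<forall>\<^sub>F \<eta> in at_right (0 :: real). \<eta> \<in> {0<..<1 / 2}" by (rule eventually_at_right_real) simp
  ultimately have "\<forall>\<^sub>F \<eta> in at_right 0. 1 / ((1 - 2 * \<eta>) * y) < 1 / y + \<delta> / 2 \<and> \<eta> \<in> {0<..<1 / 2}"
    by (rule eventually_conj)
  then obtain \<eta> where \<eta>: "1 / ((1 - 2 * \<eta>) * y) < 1 / y + \<delta> / 2" "0 < \<eta>" "\<eta> < 1 / 2"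
    using eventually_happens' trivial_limit_at_right_real by fastforce
  have \<eta>1: "\<eta> < 1" using \<eta> by simp
  \<comment> \<open>Chosen after \<open>\<eta>\<close>, so that the atypical samples cost half of the allowed error.\<close>
  define \<epsilon> where "\<epsilon> = \<delta> / 2 * \<eta>\<^sup>2 / K"
  have \<epsilon>: "0 < \<epsilon>" "\<epsilon> * (K / \<eta>\<^sup>2) = \<delta> / 2" using \<delta> \<eta> K by (auto simp: \<epsilon>_def)
  define x where "x = (1 - 2 * \<eta>) * y"
  have x: "0 < x" "1 / x < 1 / y + \<delta> / 2" using \<eta> y by (auto simp: x_def)
  show ?thesis
    using atyp[OF \<epsilon>(1) \<eta>(2) less_imp_le[OF \<eta>1]] order_tendstoD(2)[OF tail_over_jump_rate[OF x(1)] x(2)]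
      centring[OF \<epsilon>(1) half_gt_zero[OF \<eta>(2)]] b_ev[of "1 / \<eta>"] eventually_ge_at_top[of 1]
  proof eventually_elim
    case (elim n)
    have "1 / \<eta> > 0" using \<eta> by simp
    then have "b n > 0" using elim(4) by linarith
    moreover have "1 \<le> \<eta> * b n" using elim(4) \<eta> by (simp add: field_simps)
    ultimately have bn: "b n > 0" "1 \<le> \<eta> * b n" by auto
    have "{\<omega> \<in> space M. gain y < S n \<omega>} \<subseteq> atypical \<epsilon> \<eta> n \<union> {\<omega> \<in> space M. \<exists>i<n. x * b n < H i \<omega>}"
    proof (rule subsetI, rule ccontr)
      fix \<omega> assume \<omega>: "\<omega> \<in> {\<omega> \<in> space M. gain y < S n \<omega>}"
        and not: "\<omega> \<notin> atypical \<epsilon> \<eta> n \<union> {\<omega> \<in> space M. \<exists>i<n. x * b n < H i \<omega>}"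
      have "H i \<omega> \<le> x * b n" if "i < n" for i
        using that not \<omega> by (cases "H i \<omega> \<le> x * b n") auto
      with \<omega> not have \<omega>': "\<omega> \<in> space M" "\<omega> \<notin> atypical \<epsilon> \<eta> n" "\<And>i. i < n \<Longrightarrow> H i \<omega> \<le> x * b n" by auto
      obtain \<theta> where \<theta>: "\<theta> \<ge> 0" "\<And>i. i < n \<Longrightarrow> 0 < 1 + \<theta> * (H i \<omega> - 1)"
        and S: "S n \<omega> = (\<Sum>i<n. ln (1 + \<theta> * (H i \<omega> - 1)))"
        using S_attained[of n \<omega>] elim \<omega>' by auto
      have "(\<Sum>i<n. ln (1 + \<theta> * (H i \<omega> - 1))) \<le> gain y"
      proof (rule loglik_upper[where e="\<epsilon> * b n" and b="b n" and \<eta>=\<eta>])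
        show "H i \<omega> \<le> (1 - 2 * \<eta>) * b n * y" if "i < n" for i
          using \<omega>'(3)[OF that] by (simp add: x_def algebra_simps)
      qed (use typical[OF \<omega>'(1,2)] elim \<theta> bn \<epsilon> \<eta> y H_nonneg \<omega>' in auto)
      then show False using \<omega> S by auto
    qed
    then have "prob {\<omega> \<in> space M. gain y < S n \<omega>} \<le> prob (atypical \<epsilon> \<eta> n \<union> {\<omega> \<in> space M. \<exists>i<n. x * b n < H i \<omega>})"
      by (intro finite_measure_mono) auto
    also have "\<dots> \<le> prob (atypical \<epsilon> \<eta> n) + prob {\<omega> \<in> space M. \<exists>i<n. x * b n < H i \<omega>}"
      by (intro measure_Un_le) auto
    also have "\<dots> \<le> \<delta> / 2 * jump_rate n + (1 / y + \<delta> / 2) * jump_rate n"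
    proof (rule add_mono)
      show "prob (atypical \<epsilon> \<eta> n) \<le> \<delta> / 2 * jump_rate n" using elim(1) unfolding \<epsilon>(2) .
      have "real n * tail.T (x * b n) \<le> (1 / y + \<delta> / 2) * jump_rate n"
        using elim jump_rate_pos[of n] by (simp add: pos_divide_less_eq less_imp_le)
      then show "prob {\<omega> \<in> space M. \<exists>i<n. x * b n < H i \<omega>} \<le> (1 / y + \<delta> / 2) * jump_rate n"
        using prob_some_large(1)[of n "x * b n"] by linarith
    qed
    also have "\<dots> = (1 / y + \<delta>) * jump_rate n" by (simp add: algebra_simps)
    finally show ?case .
  qed
qed

text \<open>On typical samples an observation above \<open>x * b n\<close> with \<open>x > y\<close> pushes the statistic above \<open>gain y\<close>;
  then \<open>x\<close> is taken close to \<open>y\<close>. For \<open>y = 1\<close> the optimal parameter would be zero, which is why this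
  case is excluded here.\<close>

lemma prob_S_lower_strict:
  assumes y: "1 < y" and \<delta>: "0 < \<delta>"
  shows "\<forall>\<^sub>F n in sequentially. (1 / y - \<delta>) * jump_rate n \<le> prob {\<omega> \<in> space M. gain y < S n \<omega>}"
proof -
  obtain K where K: "K > 0" and atyp: "\<And>\<epsilon> \<eta>. 0 < \<epsilon> \<Longrightarrow> 0 < \<eta> \<Longrightarrow> \<eta> \<le> 1 \<Longrightarrow>
    \<forall>\<^sub>F n in sequentially. prob (atypical \<epsilon> \<eta> n) \<le> \<epsilon> * (K / \<eta>\<^sup>2) * jump_rate n"
    by (rule prob_atypical) blast
  have "((\<lambda>x. 1 / x) \<longlongrightarrow> 1 / y) (at_right y)" using y by (intro tendsto_intros) auto
  then have "\<forall>\<^sub>F x in at_right y. 1 / y - \<delta> / 3 < 1 / x"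
    using \<delta> by (intro order_tendstoD(1)) auto
  moreover have "\<forall>\<^sub>F x in at_right y. x \<in> {y<..<y + 1}" by (rule eventually_at_right_real) simp
  ultimately have "\<forall>\<^sub>F x in at_right y. 1 / y - \<delta> / 3 < 1 / x \<and> x \<in> {y<..<y + 1}" by (rule eventually_conj)
  then obtain x where x: "1 / y - \<delta> / 3 < 1 / x" "y < x"
    using eventually_happens' trivial_limit_at_right_real by fastforce
  have x0: "0 < x" using x y by simp
  define s where "s = 1 - 1 / y"
  have s: "0 < s" "s < 1" "1 + s * y = y" using y by (auto simp: s_def field_simps)
  \<comment> \<open>The surplus created by passing from \<open>y\<close> to the midpoint of \<open>y\<close> and \<open>x\<close>; it absorbs all errors.\<close>
  define \<gamma> where "\<gamma> = ln (1 + s * ((x + y) / 2)) - ln y"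
  have "s * y < s * ((x + y) / 2)" using s x by (intro mult_strict_left_mono) auto
  then have "y < 1 + s * ((x + y) / 2)" using s by linarith
  then have \<gamma>: "0 < \<gamma>" using y by (simp add: \<gamma>_def)
  define \<eta> where "\<eta> = min 1 (\<gamma> / 6)"
  have \<eta>: "0 < \<eta>" "\<eta> \<le> 1" "3 * \<eta> \<le> \<gamma> / 2" using \<gamma> by (auto simp: \<eta>_def min_def)
  define \<epsilon> where "\<epsilon> = min (\<delta> / 3 * \<eta>\<^sup>2 / K) (min (1 / 2) (\<gamma> / 3))"
  have "0 < \<epsilon>" "\<epsilon> \<le> 1 / 2" "\<epsilon> \<le> \<gamma> / 3" using \<delta> \<eta> K \<gamma> by (simp_all add: \<epsilon>_def)
  then have \<epsilon>: "0 < \<epsilon>" "\<epsilon> \<le> 1 / 2" "\<epsilon> < \<gamma> / 2" using \<gamma> by auto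
  have "\<epsilon> * (K / \<eta>\<^sup>2) \<le> (\<delta> / 3 * \<eta>\<^sup>2 / K) * (K / \<eta>\<^sup>2)"
    using K by (intro mult_right_mono) (auto simp: \<epsilon>_def)
  also have "\<dots> = \<delta> / 3" using K \<eta> by simp
  finally have \<epsilon>K: "\<epsilon> * (K / \<eta>\<^sup>2) \<le> \<delta> / 3" .
  have \<delta>3: "0 < \<delta> / 3" using \<delta> by simp
  show ?thesis
    using atyp[OF \<epsilon>(1) \<eta>(1,2)] order_tendstoD(1)[OF tail_over_jump_rate[OF x0] x(1)]
      order_tendstoD(2)[OF tail_square_over_jump_rate[OF x0] \<delta>3]
      centring[OF \<epsilon>(1) half_gt_zero[OF \<eta>(1)]] b_ev[of 2] b_ev[of "2 / (x - y)"] eventually_ge_at_top[of 1]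
  proof eventually_elim
    case (elim n)
    have bn: "2 \<le> b n" using elim by simp
    have pn: "0 < jump_rate n" using elim by (intro jump_rate_pos)
    have inc: "{\<omega> \<in> space M. \<exists>i<n. x * b n < H i \<omega>} \<subseteq> atypical \<epsilon> \<eta> n \<union> {\<omega> \<in> space M. gain y < S n \<omega>}"
    proof
      fix \<omega> assume "\<omega> \<in> {\<omega> \<in> space M. \<exists>i<n. x * b n < H i \<omega>}"
      then obtain j where \<omega>: "\<omega> \<in> space M" and j: "j < n" "x * b n < H j \<omega>" by auto
      show "\<omega> \<in> atypical \<epsilon> \<eta> n \<union> {\<omega> \<in> space M. gain y < S n \<omega>}"
      proof (cases "\<omega> \<in> atypical \<epsilon> \<eta> n")
        case False
        note good = typical[OF \<omega> False elim(4)]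
        have "gain y = ln (1 + s * y) - s" unfolding s(3) by (simp add: gain_def s_def)
        also have "\<dots> = ln (1 + s * ((x + y) / 2)) - \<gamma> - s" by (simp add: \<gamma>_def s(3))
        also have "\<dots> < ln (1 + s * ((x + y) / 2)) - s - (3 * \<eta> + \<epsilon>)" using \<eta> \<epsilon> by linarith
        also have "\<dots> \<le> ln (1 + s * x - s / b n) - s - (3 * \<eta> + \<epsilon>)"
        proof -
          have "2 / b n \<le> x - y" using elim(6) x bn by (simp add: field_simps)
          then have "s * (1 / b n) \<le> s * ((x - y) / 2)" using s by (intro mult_left_mono) auto
          then have "1 + s * ((x + y) / 2) \<le> 1 + s * x - s / b n" by (simp add: field_simps)
          moreover have "0 < 1 + s * ((x + y) / 2)" using s x0 y by (intro add_pos_pos mult_pos_pos) auto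
          ultimately show ?thesis by (simp add: ln_mono)
        qed
        also have "\<dots> \<le> (\<Sum>i<n. ln (1 + s / b n * (H i \<omega> - 1)))"
          using s \<epsilon> \<eta> x y j bn H_nonneg[OF \<omega>] by (intro loglik_lower[OF _ _ _ _ _ _ _ _ good(1,3,4)]) auto
        also have "\<dots> \<le> S n \<omega>"
          using elim \<omega> s bn by (intro S_ge) (auto simp: field_simps)
        finally show ?thesis using \<omega> by auto
      qed simp
    qed
    have "(1 / y - \<delta>) * jump_rate n = (1 / y - \<delta> / 3) * jump_rate n - \<delta> / 3 * jump_rate n - \<delta> / 3 * jump_rate n" by (simp add: algebra_simps)
    also have "\<dots> \<le> real n * tail.T (x * b n) - (real n * tail.T (x * b n))\<^sup>2 - prob (atypical \<epsilon> \<eta> n)"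
    proof (intro diff_mono)
      show "(1 / y - \<delta> / 3) * jump_rate n \<le> real n * tail.T (x * b n)"
        using elim(2) pn by (simp add: pos_less_divide_eq)
      show "(real n * tail.T (x * b n))\<^sup>2 \<le> \<delta> / 3 * jump_rate n" using elim(3) pn by (simp add: pos_divide_less_eq)
      have "\<epsilon> * (K / \<eta>\<^sup>2) * jump_rate n \<le> \<delta> / 3 * jump_rate n" using \<epsilon>K pn by (intro mult_right_mono) auto
      then show "prob (atypical \<epsilon> \<eta> n) \<le> \<delta> / 3 * jump_rate n" using elim(1) by linarith
    qed
    also have "\<dots> \<le> prob {\<omega> \<in> space M. \<exists>i<n. x * b n < H i \<omega>} - prob (atypical \<epsilon> \<eta> n)"
      using prob_some_large(2)[of n "x * b n"] by simp
    also have "\<dots> \<le> prob {\<omega> \<in> space M. gain y < S n \<omega>}"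
    proof -
      have "prob {\<omega> \<in> space M. \<exists>i<n. x * b n < H i \<omega>} \<le> prob (atypical \<epsilon> \<eta> n \<union> {\<omega> \<in> space M. gain y < S n \<omega>})"
        using S_event_measurable elim by (intro finite_measure_mono inc) auto
      also have "\<dots> \<le> prob (atypical \<epsilon> \<eta> n) + prob {\<omega> \<in> space M. gain y < S n \<omega>}"
        using S_event_measurable elim by (intro measure_Un_le) auto
      finally show ?thesis by simp
    qed
    finally show ?case .
  qed
qed

text \<open>The lower bound at \<open>y = 1\<close>, which concerns the event that the statistic is positive, follows by
  monotonicity from values slightly above one.\<close>

lemma prob_S_asymptotics:
  assumes y: "1 \<le> y"
  shows "(\<lambda>n. prob {\<omega> \<in> space M. gain y < S n \<omega>} / jump_rate n) \<longlonglongrightarrow> 1 / y"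
proof (rule order_tendstoI)
  fix u assume u: "1 / y < u"
  then have "0 < (u - 1 / y) / 2" by simp
  from prob_S_upper[OF y this] show "\<forall>\<^sub>F n in sequentially. prob {\<omega> \<in> space M. gain y < S n \<omega>} / jump_rate n < u"
    using eventually_ge_at_top[of 1]
  proof eventually_elim
    case (elim n)
    have "prob {\<omega> \<in> space M. gain y < S n \<omega>} / jump_rate n \<le> 1 / y + (u - 1 / y) / 2"
      using elim jump_rate_pos[of n] by (simp add: pos_divide_le_eq)
    also have "\<dots> < u" using u by (simp add: field_simps)
    finally show ?case .
  qed
next
  fix l assume l: "l < 1 / y"
  have "((\<lambda>x. 1 / x) \<longlongrightarrow> 1 / y) (at_right y)" using y by (intro tendsto_intros) auto
  then have "\<forall>\<^sub>F x in at_right y. l < 1 / x" using l by (rule order_tendstoD(1))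
  moreover have "\<forall>\<^sub>F x in at_right y. x \<in> {y<..<y + 1}" by (rule eventually_at_right_real) simp
  ultimately have "\<forall>\<^sub>F x in at_right y. l < 1 / x \<and> x \<in> {y<..<y + 1}" by (rule eventually_conj)
  then obtain x where x: "l < 1 / x" "y < x"
    using eventually_happens' trivial_limit_at_right_real by fastforce
  then have x1: "1 < x" using y by simp
  have gain_le: "gain y \<le> gain x" using y x by (intro gain_mono) auto
  have d: "0 < (1 / x - l) / 2" using x by simp
  show "\<forall>\<^sub>F n in sequentially. l < prob {\<omega> \<in> space M. gain y < S n \<omega>} / jump_rate n"
    using prob_S_lower_strict[OF x1 d] eventually_ge_at_top[of 1]
  proof eventually_elim
    case (elim n)
    have "(1 / x - (1 / x - l) / 2) * jump_rate n \<le> prob {\<omega> \<in> space M. gain x < S n \<omega>}" by (rule elim(1))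
    also have "\<dots> \<le> prob {\<omega> \<in> space M. gain y < S n \<omega>}"
      using gain_le S_event_measurable elim by (intro finite_measure_mono) auto
    finally have "1 / x - (1 / x - l) / 2 \<le> prob {\<omega> \<in> space M. gain y < S n \<omega>} / jump_rate n"
      using jump_rate_pos[OF elim(2)] by (simp add: pos_le_divide_eq)
    moreover have "l < 1 / x - (1 / x - l) / 2" using x(1) by (simp add: field_simps)
    ultimately show ?case by linarith
  qed
qed

lemma prob_S_conditional:
  assumes y: "1 \<le> y"
  shows "(\<lambda>n. prob {\<omega> \<in> space M. S n \<omega> \<le> gain y \<and> 0 < S n \<omega>} / prob {\<omega> \<in> space M. 0 < S n \<omega>}) \<longlonglongrightarrow> 1 - 1 / y"
proof -
  let ?P = "\<lambda>y n. prob {\<omega> \<in> space M. gain y < S n \<omega>}"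
  have l1: "(\<lambda>n. ?P 1 n / jump_rate n) \<longlonglongrightarrow> 1" using prob_S_asymptotics[of 1] by simp
  have "(\<lambda>n. (?P 1 n / jump_rate n - ?P y n / jump_rate n) / (?P 1 n / jump_rate n)) \<longlonglongrightarrow> (1 - 1 / y) / 1"
    by (intro tendsto_divide tendsto_diff l1 prob_S_asymptotics y) simp
  then have "(\<lambda>n. (?P 1 n / jump_rate n - ?P y n / jump_rate n) / (?P 1 n / jump_rate n)) \<longlonglongrightarrow> 1 - 1 / y" by simp
  then show ?thesis
  proof (rule Lim_transform_eventually)
    show "\<forall>\<^sub>F n in sequentially. (?P 1 n / jump_rate n - ?P y n / jump_rate n) / (?P 1 n / jump_rate n)
      = prob {\<omega> \<in> space M. S n \<omega> \<le> gain y \<and> 0 < S n \<omega>} / prob {\<omega> \<in> space M. 0 < S n \<omega>}"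
      using eventually_ge_at_top[of 1]
    proof eventually_elim
      case (elim n)
      have g: "0 \<le> gain y" using gain_pos[of y] y by (cases "y = 1") auto
      have "{\<omega> \<in> space M. S n \<omega> \<le> gain y \<and> 0 < S n \<omega>} = {\<omega> \<in> space M. 0 < S n \<omega>} - {\<omega> \<in> space M. gain y < S n \<omega>}"
        by auto
      moreover have "{\<omega> \<in> space M. gain y < S n \<omega>} \<subseteq> {\<omega> \<in> space M. 0 < S n \<omega>}" using g by auto
      ultimately have "prob {\<omega> \<in> space M. S n \<omega> \<le> gain y \<and> 0 < S n \<omega>} = ?P 1 n - ?P y n"
        using S_event_measurable[OF elim] by (simp add: finite_measure_Diff)
      moreover have "0 < jump_rate n" by (rule jump_rate_pos[OF elim])
      ultimately show ?case by (simp add: diff_divide_distrib[symmetric])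
    qed
  qed
qed

end

section \<open>The limit law and the maximum-likelihood estimator\<close>

lemma gain_surj:
  assumes "0 \<le> x" obtains y where "1 \<le> y" "gain y = x"
proof -
  have "\<exists>y\<ge>1. y \<le> exp (x + 1) \<and> gain y = x"
  proof (rule IVT)
    show "x \<le> gain (exp (x + 1))" by (simp add: gain_def)
    show "\<forall>y. 1 \<le> y \<and> y \<le> exp (x + 1) \<longrightarrow> isCont gain y"
      unfolding gain_def[abs_def] by (auto intro!: continuous_intros)
  qed (use assms in auto)
  then show ?thesis using that by blast
qed

lemma limit_quantile_gain: "u < 1 \<Longrightarrow> limit_quantile u = 2 * gain (1 / (1 - u))"
  by (simp add: limit_quantile_def gain_def ln_div)

text \<open>Prescribing the quantile function determines the distribution function by this adjunction.\<close>

lemma limit_cdf_galois: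
  assumes "0 < u" "u < 1" shows "u \<le> limit_cdf x \<longleftrightarrow> limit_quantile u \<le> x"
proof -
  obtain \<nu> where \<nu>: "real_distribution \<nu>" "limit_cdf = cdf \<nu>"
    using is_limit_cdf_limit_cdf by (auto simp: is_limit_cdf_def)
  then interpret cdf_distribution \<nu> by (simp add: cdf_distribution_def)
  show ?thesis
    using assms is_limit_cdf_limit_cdf pseudoinverse[of u x] \<nu>(2) by (simp add: is_limit_cdf_def quantile_def)
qed

lemma limit_cdf_bounds: "0 \<le> limit_cdf x" "limit_cdf x \<le> 1"
proof -
  obtain \<nu> where \<nu>: "real_distribution \<nu>" "limit_cdf = cdf \<nu>"
    using is_limit_cdf_limit_cdf by (auto simp: is_limit_cdf_def)
  then interpret real_distribution \<nu> by simp
  show "0 \<le> limit_cdf x" "limit_cdf x \<le> 1" by (simp_all add: \<nu>(2) cdf_def)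
qed

lemma limit_cdf_eqI:
  assumes v: "0 \<le> v" "v < 1" and iff: "\<And>u. 0 < u \<Longrightarrow> u < 1 \<Longrightarrow> limit_quantile u \<le> x \<longleftrightarrow> u \<le> v"
  shows "limit_cdf x = v"
proof (rule ccontr)
  assume "limit_cdf x \<noteq> v"
  then consider "limit_cdf x < v" | "v < limit_cdf x" by linarith
  then show False
  proof cases
    case 1
    then have "0 < v" using limit_cdf_bounds(1)[of x] by linarith
    then have "v \<le> limit_cdf x" using v iff[of v] limit_cdf_galois[of v x] by simp
    then show False using 1 by simp
  next
    case 2
    then obtain u where u: "v < u" "u < limit_cdf x" using dense by blast
    then have "0 < u" "u < 1" using v limit_cdf_bounds(2)[of x] by auto
    then show False using u iff[of u] limit_cdf_galois[of u x] by simp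
  qed
qed

lemma limit_cdf_gain:
  assumes y: "1 \<le> y" shows "limit_cdf (2 * gain y) = 1 - 1 / y"
proof (rule limit_cdf_eqI)
  fix u :: real assume u: "0 < u" "u < 1"
  have q: "limit_quantile u = 2 * gain (1 / (1 - u))" using u by (simp add: limit_quantile_gain)
  show "limit_quantile u \<le> 2 * gain y \<longleftrightarrow> u \<le> 1 - 1 / y"
  proof
    assume "u \<le> 1 - 1 / y"
    then have "1 / (1 - u) \<le> y" using u y by (simp add: field_simps)
    then show "limit_quantile u \<le> 2 * gain y" unfolding q using u gain_mono[of "1 / (1 - u)" y] by simp
  next
    assume le: "limit_quantile u \<le> 2 * gain y"
    show "u \<le> 1 - 1 / y"
    proof (rule ccontr)
      assume not: "\<not> u \<le> 1 - 1 / y"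
      show False
      proof (cases "y = 1")
        case True
        then show False using le u gain_pos[of "1 / (1 - u)"] unfolding q by simp
      next
        case False
        then have v: "0 < 1 - 1 / y" using y by simp
        have "limit_quantile (1 - 1 / y) < limit_quantile u"
          using not u by (intro limit_quantile_strict_mono v) auto
        moreover have "limit_quantile (1 - 1 / y) = 2 * gain y" using y by (subst limit_quantile_gain) auto
        ultimately show False using le by simp
      qed
    qed
  qed
qed (use y in auto)

lemma limit_cdf_neg: "x < 0 \<Longrightarrow> limit_cdf x = 0"
proof (rule limit_cdf_eqI)
  fix u :: real assume "x < 0" "0 < u" "u < 1"
  moreover from this have "0 < limit_quantile u" using gain_pos[of "1 / (1 - u)"] by (simp add: limit_quantile_gain)
  ultimately show "limit_quantile u \<le> x \<longleftrightarrow> u \<le> 0" by simp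
qed auto

lemma limit_quantile_series:
  assumes "0 < u" "u < 1"
  shows "(\<lambda>r. 2 * (u ^ (r + 2) / real (r + 2))) sums (- 2 * u - 2 * ln (1 - u))"
proof -
  have "(\<lambda>n. - ((- (- u)) ^ n) / of_nat n) sums ln (1 + - u)" using assms by (intro ln_series') auto
  then have "(\<lambda>n. - (u ^ n) / real n) sums ln (1 - u)" by simp
  from sums_split_initial_segment[OF this, of 2]
  have "(\<lambda>n. - (u ^ (n + 2)) / real (n + 2)) sums (ln (1 - u) + u)" by (simp add: numeral_2_eq_2)
  from sums_mult[OF this, of "-2"] show ?thesis by (simp add: algebra_simps)
qed

text \<open>The density \<open>std_normal_density\<close> factors out of the mixture, so that up to a constant the
  log-likelihood is a function of the density ratios.\<close>

lemma mixture_loglik_eq: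
  assumes "\<And>i. i < n \<Longrightarrow> 0 < 1 + \<theta> * (density_ratio f1 (xs i) - 1)"
  shows "mixture_loglik f1 n xs \<theta> = ereal ((\<Sum>i<n. ln (std_normal_density (xs i)))
    + (\<Sum>i<n. ln (1 + \<theta> * (density_ratio f1 (xs i) - 1))))"
proof -
  have "ext_ln ((1 - \<theta>) * std_normal_density (xs i) + \<theta> * f1 (xs i))
    = ereal (ln (std_normal_density (xs i)) + ln (1 + \<theta> * (density_ratio f1 (xs i) - 1)))" if "i < n" for i
  proof -
    let ?d = "std_normal_density (xs i)"
    have d: "0 < ?d" by (simp add: normal_density_pos)
    have "(1 - \<theta>) * ?d + \<theta> * f1 (xs i) = ?d * (1 + \<theta> * (density_ratio f1 (xs i) - 1))"
      using d by (simp add: density_ratio_def field_simps)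
    then show ?thesis using d assms[OF that] by (simp add: ext_ln_def ln_mult)
  qed
  then show ?thesis unfolding mixture_loglik_def by (simp add: sum.distrib[symmetric])
qed

lemma mixture_loglik_minus_infinity:
  assumes i: "i < n" "\<not> 0 < 1 + \<theta> * (density_ratio f1 (xs i) - 1)"
  shows "mixture_loglik f1 n xs \<theta> = - \<infinity>"
proof -
  let ?t = "\<lambda>i. ext_ln ((1 - \<theta>) * std_normal_density (xs i) + \<theta> * f1 (xs i))"
  let ?d = "std_normal_density (xs i)"
  have d: "0 < ?d" by (simp add: normal_density_pos)
  have "(1 - \<theta>) * ?d + \<theta> * f1 (xs i) = ?d * (1 + \<theta> * (density_ratio f1 (xs i) - 1))"
    using d by (simp add: density_ratio_def field_simps)
  also have "\<not> 0 < \<dots>" using d i(2) by (simp add: zero_less_mult_iff)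
  finally have "?t i = - \<infinity>" by (simp add: ext_ln_def)
  moreover have "(\<Sum>k\<in>{..<n} - {i}. ?t k) \<noteq> \<infinity>" by (auto simp: sum_Pinfty ext_ln_def)
  moreover have "mixture_loglik f1 n xs \<theta> = ?t i + (\<Sum>k\<in>{..<n} - {i}. ?t k)"
    unfolding mixture_loglik_def using i(1) by (simp add: sum.remove)
  ultimately show ?thesis by simp
qed

text \<open>At \<open>\<theta> = 0\<close> the log-likelihood is finite, so at the maximum it is not minus infinity, and all
  arguments of the logarithm are positive there.\<close>

lemma mle_likelihood_ratio:
  assumes "is_mixture_mle f1 n xs \<theta>hat"
  shows mle_range: "0 \<le> \<theta>hat" "\<theta>hat \<le> 1"
    and mle_pos: "\<And>i. i < n \<Longrightarrow> 0 < 1 + \<theta>hat * (density_ratio f1 (xs i) - 1)"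
    and mle_max: "\<And>\<theta>. 0 \<le> \<theta> \<Longrightarrow> \<theta> \<le> 1 \<Longrightarrow> (\<And>i. i < n \<Longrightarrow> 0 < 1 + \<theta> * (density_ratio f1 (xs i) - 1)) \<Longrightarrow>
      (\<Sum>i<n. ln (1 + \<theta> * (density_ratio f1 (xs i) - 1))) \<le> (\<Sum>i<n. ln (1 + \<theta>hat * (density_ratio f1 (xs i) - 1)))"
proof -
  have mle: "\<theta>hat \<in> {0..1}" "\<And>\<theta>. \<theta> \<in> {0..1} \<Longrightarrow> mixture_loglik f1 n xs \<theta> \<le> mixture_loglik f1 n xs \<theta>hat"
    using assms by (auto simp: is_mixture_mle_def is_arg_max_def not_less)
  show "0 \<le> \<theta>hat" "\<theta>hat \<le> 1" using mle(1) by auto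
  show pos: "0 < 1 + \<theta>hat * (density_ratio f1 (xs i) - 1)" if "i < n" for i
  proof (rule ccontr)
    assume "\<not> 0 < 1 + \<theta>hat * (density_ratio f1 (xs i) - 1)"
    then have "mixture_loglik f1 n xs 0 \<le> - \<infinity>"
      using mle(2)[of 0] mixture_loglik_minus_infinity[OF that, of \<theta>hat] by simp
    then show False by (simp add: mixture_loglik_eq)
  qed
  show "(\<Sum>i<n. ln (1 + \<theta> * (density_ratio f1 (xs i) - 1))) \<le> (\<Sum>i<n. ln (1 + \<theta>hat * (density_ratio f1 (xs i) - 1)))"
    if "0 \<le> \<theta>" "\<theta> \<le> 1" "\<And>i. i < n \<Longrightarrow> 0 < 1 + \<theta> * (density_ratio f1 (xs i) - 1)" for \<theta>
    using mle(2)[of \<theta>] that by (simp add: mixture_loglik_eq[OF that(3)] mixture_loglik_eq[OF pos])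
qed

lemma one_plus_mult_pos:
  fixes \<theta> h :: real
  assumes "0 \<le> \<theta>" "\<theta> < 1" "0 \<le> h" shows "0 < 1 + \<theta> * (h - 1)"
proof -
  have "0 \<le> \<theta> * h" using assms by simp
  moreover have "1 + \<theta> * (h - 1) = (1 - \<theta>) + \<theta> * h" by (simp add: algebra_simps)
  ultimately show ?thesis using assms by linarith
qed

text \<open>The estimator itself may fail to be measurable. Its maximal value is measurable, since by continuity
  it is a supremum over rational parameters below one.\<close>

lemma maximised_sum_measurable:
  fixes H :: "nat \<Rightarrow> 'a \<Rightarrow> real" and S :: "'a \<Rightarrow> real"
  assumes [measurable]: "\<And>i. H i \<in> borel_measurable M" and H: "\<And>i \<omega>. \<omega> \<in> space M \<Longrightarrow> 0 \<le> H i \<omega>"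
    and attained: "\<And>\<omega>. \<omega> \<in> space M \<Longrightarrow> \<exists>\<theta>\<ge>0. \<theta> \<le> 1 \<and> (\<forall>i<n. 0 < 1 + \<theta> * (H i \<omega> - 1)) \<and> S \<omega> = (\<Sum>i<n. ln (1 + \<theta> * (H i \<omega> - 1)))"
    and max: "\<And>\<omega> \<theta>. \<omega> \<in> space M \<Longrightarrow> 0 \<le> \<theta> \<Longrightarrow> \<theta> < 1 \<Longrightarrow> (\<Sum>i<n. ln (1 + \<theta> * (H i \<omega> - 1))) \<le> S \<omega>"
  shows "S \<in> borel_measurable M"
  unfolding borel_measurable_iff_greater
proof
  fix a
  let ?F = "\<lambda>\<omega> \<theta>. \<Sum>i<n. ln (1 + \<theta> * (H i \<omega> - 1))"
  have "{\<omega> \<in> space M. a < S \<omega>} = (\<Union>q\<in>\<rat> \<inter> {0..<1}. {\<omega> \<in> space M. a < ?F \<omega> q})"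
  proof (intro set_eqI iffI)
    fix \<omega> assume "\<omega> \<in> (\<Union>q\<in>\<rat> \<inter> {0..<1}. {\<omega> \<in> space M. a < ?F \<omega> q})"
    then obtain q where "0 \<le> q" "q < 1" "\<omega> \<in> space M" "a < ?F \<omega> q" by auto
    then show "\<omega> \<in> {\<omega> \<in> space M. a < S \<omega>}" using max[of \<omega> q] by auto
  next
    fix \<omega> assume "\<omega> \<in> {\<omega> \<in> space M. a < S \<omega>}"
    then have \<omega>: "\<omega> \<in> space M" and a: "a < S \<omega>" by auto
    obtain \<theta> where \<theta>: "0 \<le> \<theta>" "\<theta> \<le> 1" and pos: "\<And>i. i < n \<Longrightarrow> 0 < 1 + \<theta> * (H i \<omega> - 1)" and S: "S \<omega> = ?F \<omega> \<theta>"
      using attained[OF \<omega>] by blast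
    have "isCont (?F \<omega>) \<theta>" by (intro continuous_intros) (use pos in force)
    then have "((?F \<omega>) \<longlongrightarrow> ?F \<omega> \<theta>) (nhds \<theta>)" unfolding continuous_at tendsto_nhds_iff by simp
    then have "\<forall>\<^sub>F t in nhds \<theta>. a < ?F \<omega> t" using a unfolding S by (rule order_tendstoD(1))
    then obtain d where d: "d > 0" "\<And>t. dist t \<theta> < d \<Longrightarrow> a < ?F \<omega> t" by (auto simp: eventually_nhds_metric)
    have "max 0 (\<theta> - d) < min 1 (\<theta> + d)" using \<theta> d(1) by auto
    then obtain q where q: "q \<in> \<rat>" "max 0 (\<theta> - d) < q" "q < min 1 (\<theta> + d)" using Rats_dense_in_real by blast
    then have "a < ?F \<omega> q" by (intro d(2)) (auto simp: dist_real_def)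
    then show "\<omega> \<in> (\<Union>q\<in>\<rat> \<inter> {0..<1}. {\<omega> \<in> space M. a < ?F \<omega> q})" using q \<omega> by auto
  qed
  also have "\<dots> \<in> sets M"
    by (intro sets.countable_UN'' countable_Int1 countable_rat) measurable
  finally show "{\<omega> \<in> space M. a < S \<omega>} \<in> sets M" .
qed

lemma density_ratio_nonneg: "prob_density f1 \<Longrightarrow> 0 \<le> density_ratio f1 x"
  by (simp add: prob_density_def density_ratio_def)

lemma density_ratio_measurable: "prob_density f1 \<Longrightarrow> density_ratio f1 \<in> borel_measurable borel"
  unfolding prob_density_def density_ratio_def[abs_def] by auto

text \<open>Integrating the ratio against the null density integrates \<open>f1\<close>.\<close>

lemma density_ratio_mean:
  assumes f1: "prob_density f1"
  shows "integrable std_normal_distribution (density_ratio f1)" "(\<integral>x. density_ratio f1 x \<partial>std_normal_distribution) = 1"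
proof -
  note [measurable] = density_ratio_measurable[OF f1]
  have "(\<integral>\<^sup>+x. ennreal (density_ratio f1 x) \<partial>std_normal_distribution) = (\<integral>\<^sup>+x. ennreal (f1 x) \<partial>lborel)"
  proof (subst nn_integral_density)
    have "ennreal (std_normal_density x) * ennreal (density_ratio f1 x) = ennreal (f1 x)" for x
    proof -
      have "0 < std_normal_density x" by (simp add: normal_density_pos)
      then have "std_normal_density x * density_ratio f1 x = f1 x" by (simp add: density_ratio_def)
      then show ?thesis by (simp add: ennreal_mult'[symmetric])
    qed
    then show "(\<integral>\<^sup>+x. ennreal (std_normal_density x) * ennreal (density_ratio f1 x) \<partial>lborel) = (\<integral>\<^sup>+x. ennreal (f1 x) \<partial>lborel)"
      by simp
  qed auto
  then have nn: "(\<integral>\<^sup>+x. ennreal (density_ratio f1 x) \<partial>std_normal_distribution) = ennreal 1"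
    using f1 by (simp add: prob_density_def)
  show "integrable std_normal_distribution (density_ratio f1)"
    by (rule integrableI_nn_integral_finite[OF _ _ nn]) (auto simp: density_ratio_nonneg[OF f1])
  show "(\<integral>x. density_ratio f1 x \<partial>std_normal_distribution) = 1"
    by (subst integral_eq_nn_integral) (auto simp: nn density_ratio_nonneg[OF f1])
qed

theorem theorem7p2:
  fixes M :: "'a measure" and X :: "nat \<Rightarrow> 'a \<Rightarrow> real"
    and f1 :: "real \<Rightarrow> real" and \<theta>hat :: "nat \<Rightarrow> 'a \<Rightarrow> real" and \<nu> :: "real measure"
  defines "\<Lambda> \<equiv> \<lambda>n \<omega>. lr_statistic f1 n (\<lambda>i. X i \<omega>) (\<theta>hat n \<omega>)"
  assumes "prob_space M"
    and "prob_space.indep_vars M (\<lambda>_. borel) X UNIV"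
    and "\<And>i. distributed M lborel (X i) std_normal_density"
    and "prob_density f1"
    and "max_skew_cauchy \<nu>"
    and "in_domain_of_attraction (distr M borel (\<lambda>\<omega>. density_ratio f1 (X 0 \<omega>))) \<nu>"
    and "\<And>n \<omega>. n \<ge> 1 \<Longrightarrow> \<omega> \<in> space M \<Longrightarrow> is_mixture_mle f1 n (\<lambda>i. X i \<omega>) (\<theta>hat n \<omega>)"
  shows "(\<forall>u\<in>{0<..<1}. quantile limit_cdf u = - 2 * u - 2 * ln (1 - u) \<and>
            (\<lambda>r. 2 * (u ^ (r + 2) / real (r + 2))) sums (- 2 * u - 2 * ln (1 - u))) \<and>
         (\<forall>x. (\<lambda>n. \<P>(\<omega> in M. \<Lambda> n \<omega> \<le> x \<bar> \<Lambda> n \<omega> > 0)) \<longlonglongrightarrow> limit_cdf x)"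
proof -
  interpret prob_space M by fact
  note indep_X = assms(3) and dist_X = assms(4) and f1 = assms(5) and \<nu> = assms(6) and dom = assms(7) and mle = assms(8)
  note [measurable] = density_ratio_measurable[OF f1]
  have X_meas [measurable]: "X i \<in> borel_measurable M" for i
    using distributed_measurable[OF dist_X] by simp
  define H where "H i \<omega> = density_ratio f1 (X i \<omega>)" for i \<omega>
  define \<mu> where "\<mu> = distr M borel (H 0)"
  have H_meas [measurable]: "H i \<in> borel_measurable M" for i unfolding H_def[abs_def] by measurable
  have H_nonneg: "0 \<le> H i \<omega>" for i \<omega> by (simp add: H_def density_ratio_nonneg[OF f1])
  have law_X: "distr std_normal_distribution borel (density_ratio f1) = distr M borel (H i)" for i
  proof -
    have "distr M borel (H i) = distr (distr M lborel (X i)) borel (density_ratio f1)"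
      by (subst distr_distr) (auto simp: comp_def H_def[abs_def])
    then show ?thesis by (simp add: distributed_distr_eq_density[OF dist_X])
  qed
  have law: "distr M borel (H i) = \<mu>" for i using law_X[of i] law_X[of 0] by (simp add: \<mu>_def)
  have \<mu>: "real_distribution \<mu>" unfolding \<mu>_def by (rule real_distribution_distr) simp
  have nonneg: "AE x in \<mu>. 0 \<le> x" unfolding \<mu>_def by (subst AE_distr_iff) (auto simp: H_nonneg)
  have dom': "in_domain_of_attraction \<mu> \<nu>" using dom by (simp add: \<mu>_def H_def[abs_def])
  have \<mu>_eq: "\<mu> = distr std_normal_distribution borel (density_ratio f1)" using law_X[of 0] by (simp add: \<mu>_def)
  interpret tail: unit_mean_cauchy_tail \<mu>
  proof (intro unit_mean_cauchy_tail.intro unit_mean_cauchy_tail_axioms.intro \<mu> nonneg)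
    show "integrable \<mu> (\<lambda>x. x)"
      unfolding \<mu>_eq using density_ratio_mean(1)[OF f1] by (subst integrable_distr_eq) auto
    show "(\<integral>x. x \<partial>\<mu>) = 1"
      unfolding \<mu>_eq using density_ratio_mean(2)[OF f1] by (subst integral_distr) auto
  qed (use tail_of_domain_of_attraction[OF \<mu> nonneg \<nu> dom'] in auto)
  obtain b where b: "\<And>n. 0 \<le> b n" "\<And>n. real n * tail.excess (b n) = b n" "filterlim b at_top sequentially"
    by (rule tail.norming_sequence) blast
  define S where "S n \<omega> = \<Lambda> n \<omega> / 2" for n \<omega>
  have S_eq: "S n \<omega> = (\<Sum>i<n. ln (1 + \<theta>hat n \<omega> * (H i \<omega> - 1)))" for n \<omega>
    by (simp add: S_def \<Lambda>_def lr_statistic_def H_def)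
  have S_max: "(\<Sum>i<n. ln (1 + \<theta> * (H i \<omega> - 1))) \<le> S n \<omega>"
    if "n \<ge> 1" "\<omega> \<in> space M" "0 \<le> \<theta>" "\<theta> < 1" for n \<omega> \<theta>
    unfolding S_eq H_def using that H_nonneg[unfolded H_def]
    by (intro mle_max[OF mle] one_plus_mult_pos) auto
  have S_att: "\<exists>\<theta>\<ge>0. \<theta> \<le> 1 \<and> (\<forall>i<n. 0 < 1 + \<theta> * (H i \<omega> - 1)) \<and> S n \<omega> = (\<Sum>i<n. ln (1 + \<theta> * (H i \<omega> - 1)))"
    if "n \<ge> 1" "\<omega> \<in> space M" for n \<omega>
    using mle_range[OF mle[OF that]] mle_pos[OF mle[OF that]]
    by (intro exI[of _ "\<theta>hat n \<omega>"]) (auto simp: S_eq H_def)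
  interpret LR: iid_likelihood_ratio M \<mu> H S b
  proof (intro iid_likelihood_ratio.intro iid_heavy_sample.intro iid_heavy_sample_axioms.intro iid_likelihood_ratio_axioms.intro)
    show "indep_vars (\<lambda>_. borel) H UNIV"
      unfolding H_def[abs_def] by (rule indep_vars_compose2[OF indep_X]) measurable
    show "S n \<in> borel_measurable M" if "n \<ge> 1" for n
      by (rule maximised_sum_measurable[where H=H and n=n]) (use that H_nonneg S_att S_max in auto)
  qed (use law H_nonneg b S_att S_max prob_space_axioms tail.unit_mean_cauchy_tail_axioms in blast)+
  have lim: "(\<lambda>n. \<P>(\<omega> in M. \<Lambda> n \<omega> \<le> x \<bar> \<Lambda> n \<omega> > 0)) \<longlonglongrightarrow> limit_cdf x" for x
  proof (cases "x < 0")
    case True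
    then have "{\<omega> \<in> space M. \<Lambda> n \<omega> \<le> x \<and> 0 < \<Lambda> n \<omega>} = {}" for n by auto
    then show ?thesis unfolding cond_prob_def by (simp only: limit_cdf_neg[OF True]) simp
  next
    case False
    \<comment> \<open>Nonnegative levels are parametrised as \<open>x = 2 * gain y\<close>.\<close>
    then obtain y where y: "1 \<le> y" "gain y = x / 2" using gain_surj[of "x / 2"] by auto
    have "\<P>(\<omega> in M. \<Lambda> n \<omega> \<le> x \<bar> \<Lambda> n \<omega> > 0)
      = prob {\<omega> \<in> space M. S n \<omega> \<le> gain y \<and> 0 < S n \<omega>} / prob {\<omega> \<in> space M. 0 < S n \<omega>}" for n
      by (simp add: cond_prob_def S_def y)
    moreover have "limit_cdf x = 1 - 1 / y" using limit_cdf_gain[OF y(1)] y(2) by simp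
    ultimately show ?thesis using LR.prob_S_conditional[OF y(1)] by simp
  qed
  have "quantile limit_cdf u = - 2 * u - 2 * ln (1 - u)" if "u \<in> {0<..<1}" for u
    using is_limit_cdf_limit_cdf that by (simp add: is_limit_cdf_def limit_quantile_def)
  then show ?thesis using lim limit_quantile_series by auto
qed

end
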